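(* Let $V:\mathbb R\to\mathbb R$ be twice differentiable with $0<C_-\le V''(\cdot)\le C_+$ for constants $C_\pm$, and let $\rho\in\mathbb R$. Consider on $\mathbb Z$ the conservative Ginzburg-Landau dynamics $\eta(t)$ with Hamiltonian $H(\eta)=\sum_xV(\eta_x)$ and the coupled random walk $X(t)$ on the bonds of $\mathbb Z$, as defined in the context. Then for every $i\in\mathbb Z$ and every $t\ge0$, $$\frac1{C_+}\Big\langle\mathbb E^\eta_{(0,1)}\big(1_{X(t)=(i,i+1)}\big)\Big\rangle_\rho\;\le\;\big\langle\eta_0(0);\eta_i(t)\big\rangle_\rho\;\le\;\frac1{C_-}\Big\langle\mathbb E^\eta_{(0,1)}\big(1_{X(t)=(i,i+1)}\big)\Big\rangle_\rho .$$
   Context: Dynamics on $\mathbb Z$: $\eta(t)\in\mathbb R^{\mathbb Z}$ solves, for every $i\in\mathbb Z$, $$d\eta_i(t)=\big(V'(\eta_{i+1})+V'(\eta_{i-1})-2V'(\eta_i)\big)dt+\sqrt2\,\big(dB_{(i,i+1)}(t)-dB_{(i-1,i)}(t)\big),$$ with $(B_{(i,i+1)})_{i\in\mathbb Z}$ independent standard Brownian motions; solutions are taken with values in the weighted spaces $\{\zeta:\sum_i\zeta_i^2e^{-r|i|}<\infty\}$, $r>0$. Invariant measure: $\langle\cdot\rangle_\rho$ is expectation under $\mu_\rho$, the product invariant measure on $\mathbb R^{\mathbb Z}$ with mean density $\rho$, i.e. the i.i.d. product measure with single-site density proportional to $e^{-V(x)+\lambda x}$, where $\lambda=\lambda(\rho)\in\mathbb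 R$ is chosen so that the single-site mean is $\rho$. For functions of the path, $\langle F(\eta(0));G(\eta(t))\rangle_\rho$ denotes the covariance of $F(\eta(0))$ and $G(\eta(t))$ when $\eta(0)$ has law $\mu_\rho$ and $\eta(\cdot)$ evolves by the dynamics. Random walk: $X(t)$ is a continuous-time walk on the bonds $\{(i,i+1):i\in\mathbb Z\}$ which, when at $(i,i+1)$ at time $t$, jumps to $(i+1,i+2)$ at rate $V''(\eta_{i+1}(t))$ and to $(i-1,i)$ at rate $V''(\eta_i(t))$. $\mathbb E^\eta_b$ denotes expectation for the joint process $(\eta(t),X(t))$ started at $\eta(0)=\eta$, $X(0)=b$; the outer $\langle\cdot\rangle_\rho$ averages over the initial configuration $\eta$. *)

theory Defs
  imports "HOL-Probability.Probability"
begin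

section \<open>The product invariant measures\<close>

definition site_measure :: "(real \<Rightarrow> real) \<Rightarrow> real \<Rightarrow> real measure" where
  "site_measure V l =
     density lborel
       (\<lambda>x. ennreal (exp (- V x + l * x) / (LINT y|lborel. exp (- V y + l * y))))"

definition chem_pot :: "(real \<Rightarrow> real) \<Rightarrow> real \<Rightarrow> real" where
  "chem_pot V \<rho> = (THE l. (LINT x|site_measure V l. x) = \<rho>)"

definition inv_measure :: "(real \<Rightarrow> real) \<Rightarrow> real \<Rightarrow> (int \<Rightarrow> real) measure" where
  "inv_measure V \<rho> = (\<Pi>\<^sub>M i\<in>(UNIV :: int set). site_measure V (chem_pot V \<rho>))"

definition weighted_space :: "real \<Rightarrow> (int \<Rightarrow> real) set" where
  "weighted_space r =
     {\<zeta>. (\<lambda>i. (\<zeta> i)\<^sup>2 * exp (- r * real_of_int \<bar>i\<bar>)) summable_on UNIV}"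

section \<open>Brownian motions indexed by bonds\<close>

definition brownian_motion :: "'w measure \<Rightarrow> (real \<Rightarrow> 'w \<Rightarrow> real) \<Rightarrow> bool" where
  "brownian_motion M W \<longleftrightarrow>
     (\<forall>t\<ge>0. W t \<in> borel_measurable M) \<and>
     (AE \<omega> in M. W 0 \<omega> = 0) \<and>
     (AE \<omega> in M. continuous_on {0..} (\<lambda>t. W t \<omega>)) \<and>
     (\<forall>s t. 0 \<le> s \<and> s < t \<longrightarrow>
        distributed M lborel (\<lambda>\<omega>. W t \<omega> - W s \<omega>)
          (\<lambda>x. ennreal (normal_density 0 (sqrt (t - s)) x))) \<and>
     (\<forall>(\<tau> :: nat \<Rightarrow> real) n. 0 \<le> \<tau> 0 \<and> mono \<tau> \<longrightarrow>
        prob_space.indep_vars M (\<lambda>_. borel)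
          (\<lambda>k \<omega>. W (\<tau> (Suc k)) \<omega> - W (\<tau> k) \<omega>) {..<n})"

text \<open>Throughout, the bond \<open>(i, i + 1)\<close> is represented by its left endpoint \<open>i\<close>. Independence
  of the family is independence of the entire paths.\<close>

definition bond_brownian_motions :: "'w measure \<Rightarrow> (int \<Rightarrow> real \<Rightarrow> 'w \<Rightarrow> real) \<Rightarrow> bool" where
  "bond_brownian_motions M B \<longleftrightarrow>
     (\<forall>i. brownian_motion M (B i)) \<and>
     prob_space.indep_vars M (\<lambda>_. \<Pi>\<^sub>M t\<in>{0..}. borel)
       (\<lambda>i \<omega>. \<lambda>t\<in>{0..}. B i t \<omega>) UNIV"

section \<open>The Ginzburg-Landau dynamics\<close>

text \<open>The noise is additive, so the stochastic differential equation is meaningful as a pathwise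
  integral equation. The last conjunct makes the initial configuration independent of the noise.\<close>

definition gl_dynamics ::
  "(real \<Rightarrow> real) \<Rightarrow> real \<Rightarrow> 'w measure \<Rightarrow> (int \<Rightarrow> real \<Rightarrow> 'w \<Rightarrow> real) \<Rightarrow>
     (real \<Rightarrow> 'w \<Rightarrow> int \<Rightarrow> real) \<Rightarrow> bool" where
  "gl_dynamics V r M B \<eta> \<longleftrightarrow>
     prob_space M \<and>
     bond_brownian_motions M B \<and>
     (\<forall>t\<ge>0. \<forall>i. (\<lambda>\<omega>. \<eta> t \<omega> i) \<in> borel_measurable M) \<and>
     (\<forall>\<omega>\<in>space M. \<forall>i. continuous_on {0..} (\<lambda>t. \<eta> t \<omega> i)) \<and>
     (AE \<omega> in M. \<forall>t\<ge>0. \<eta> t \<omega> \<in> weighted_space r) \<and>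
     (AE \<omega> in M. \<forall>t\<ge>0. \<forall>i.
        \<eta> t \<omega> i = \<eta> 0 \<omega> i
          + (LBINT s:{0..t}. deriv V (\<eta> s \<omega> (i + 1)) + deriv V (\<eta> s \<omega> (i - 1))
                - 2 * deriv V (\<eta> s \<omega> i))
          + sqrt 2 * (B i t \<omega> - B (i - 1) t \<omega>)) \<and>
     prob_space.indep_set M
       {\<eta> 0 -` A \<inter> space M | A. A \<in> sets (\<Pi>\<^sub>M i\<in>UNIV. borel)}
       {(\<lambda>\<omega>. \<lambda>(i, t)\<in>UNIV \<times> {0..}. B i t \<omega>) -` A \<inter> space M | A.
          A \<in> sets (\<Pi>\<^sub>M p\<in>UNIV \<times> {0..}. borel)}"

definition covar :: "'w measure \<Rightarrow> ('w \<Rightarrow> real) \<Rightarrow> ('w \<Rightarrow> real) \<Rightarrow> real" where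
  "covar M f g =
     (LINT \<omega>|M. (f \<omega> - integral\<^sup>L M f) * (g \<omega> - integral\<^sup>L M g))"

section \<open>The walk on the bonds\<close>

text \<open>The generator, at a frozen configuration \<open>\<zeta>\<close>, of the walk which jumps from the bond
  \<open>(b, b + 1)\<close> to its right neighbour at rate \<open>V''(\<zeta>\<^bsub>b+1\<^esub>)\<close> and to its left
  neighbour at rate \<open>V''(\<zeta>\<^bsub>b\<^esub>)\<close>.\<close>

definition walk_generator ::
  "(real \<Rightarrow> real) \<Rightarrow> (int \<Rightarrow> real) \<Rightarrow> (int \<Rightarrow> real) \<Rightarrow> int \<Rightarrow> real" where
  "walk_generator V \<zeta> f b =
     deriv (deriv V) (\<zeta> (b + 1)) * (f (b + 1) - f b)
     + deriv (deriv V) (\<zeta> b) * (f (b - 1) - f b)"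

definition martingale ::
  "'w measure \<Rightarrow> (real \<Rightarrow> 'w measure) \<Rightarrow> (real \<Rightarrow> 'w \<Rightarrow> real) \<Rightarrow> bool" where
  "martingale M F Y \<longleftrightarrow>
     (\<forall>t\<ge>0. subalgebra M (F t) \<and> Y t \<in> borel_measurable (F t) \<and> integrable M (Y t)) \<and>
     (\<forall>s t. 0 \<le> s \<and> s \<le> t \<longrightarrow>
        (AE \<omega> in M. real_cond_exp M (F s) (Y t) \<omega> = Y s \<omega>))"

text \<open>The walk is driven by randomness of its own, given the environment \<open>\<eta>\<close>: at time
  \<open>t\<close> the filtration contains the past of the walk and the whole path of \<open>\<eta>\<close>.\<close>

definition walk_filtration ::
  "'w measure \<Rightarrow> (real \<Rightarrow> 'w \<Rightarrow> int \<Rightarrow> real) \<Rightarrow> (real \<Rightarrow> 'w \<Rightarrow> int) \<Rightarrow> real \<Rightarrow> 'w measure" where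
  "walk_filtration M \<eta> X t =
     sigma (space M)
       ({(\<lambda>\<omega>. \<eta> u \<omega> i) -` A \<inter> space M | u i A. 0 \<le> u \<and> A \<in> sets borel} \<union>
        {X u -` A \<inter> space M | u A. 0 \<le> u \<and> u \<le> t})"

text \<open>Since \<open>V''\<close> need not be continuous, jumping at the given rates is not expressed by
  infinitesimal transition probabilities but by the compensation formula (the rates are the
  stochastic intensities of the jumps), i.e. by the martingale problem for the generator.\<close>

definition bond_walk ::
  "(real \<Rightarrow> real) \<Rightarrow> 'w measure \<Rightarrow> (real \<Rightarrow> 'w \<Rightarrow> int \<Rightarrow> real) \<Rightarrow> (real \<Rightarrow> 'w \<Rightarrow> int) \<Rightarrow> bool" where
  "bond_walk V M \<eta> X \<longleftrightarrow>
     (\<forall>t\<ge>0. X t \<in> M \<rightarrow>\<^sub>M count_space UNIV) \<and>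
     (\<forall>\<omega>\<in>space M. \<forall>t\<ge>0. continuous (at_right t) (\<lambda>s. X s \<omega>)) \<and>
     (\<forall>\<omega>\<in>space M. \<forall>t>0. \<exists>b. ((\<lambda>s. X s \<omega>) \<longlongrightarrow> b) (at_left t)) \<and>
     (\<forall>f :: int \<Rightarrow> real. bounded (range f) \<longrightarrow>
        martingale M (walk_filtration M \<eta> X)
          (\<lambda>t \<omega>. f (X t \<omega>) - f (X 0 \<omega>)
                  - (LBINT s:{0..t}. walk_generator V (\<eta> s \<omega>) f (X s \<omega>))))"

text \<open>The joint process \<open>(\<eta>(t), X(t))\<close> started at \<open>(\<zeta>, b)\<close>; expectation under \<open>M\<close> is the
  expectation written with superscript \<open>\<zeta>\<close> and subscript \<open>b\<close>.\<close>

definition joint_process_from ::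
  "(real \<Rightarrow> real) \<Rightarrow> real \<Rightarrow> (int \<Rightarrow> real) \<Rightarrow> int \<Rightarrow> 'w measure \<Rightarrow>
     (int \<Rightarrow> real \<Rightarrow> 'w \<Rightarrow> real) \<Rightarrow> (real \<Rightarrow> 'w \<Rightarrow> int \<Rightarrow> real) \<Rightarrow> (real \<Rightarrow> 'w \<Rightarrow> int) \<Rightarrow> bool" where
  "joint_process_from V r \<zeta> b M B \<eta> X \<longleftrightarrow>
     gl_dynamics V r M B \<eta> \<and>
     bond_walk V M \<eta> X \<and>
     (AE \<omega> in M. \<eta> 0 \<omega> = \<zeta>) \<and>
     (AE \<omega> in M. X 0 \<omega> = b)"

end

theory Submission
  imports Defs
begin

text \<open>Write \<open>\<Phi>\<close> for the solution as a function of the initial configuration \<open>\<zeta>\<close> and of the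
  noise. As the noise is additive, perturbing \<open>\<zeta> 0\<close> changes \<open>\<Phi>\<close> by a solution of
  \<open>D' i = V'' i+1 D i+1 + V'' i-1 D i-1 - 2 V'' i D i\<close>; hence \<open>\<Phi> i\<close> is nondecreasing in
  \<open>\<zeta> 0\<close>. Both \<open>x - V' x / C\<^sub>+\<close> and \<open>V' x / C\<^sub>- - x\<close> are nondecreasing too, so Chebyshev's
  association inequality compares the covariance of \<open>\<zeta> 0\<close> and \<open>\<Phi> i\<close> with that of
  \<open>V' (\<zeta> 0)\<close> and \<open>\<Phi> i\<close>, which integration by parts turns into the mean of \<open>D i\<close>.
  The differences of the solutions \<open>D\<close> started from neighbouring sites are the gradients of the
  transition probabilities of the bond walk. After averaging over the translation invariant
  initial measure this becomes a telescoping identity, and the mean of \<open>D i\<close> is the probability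
  that the walk started at \<open>(0, 1)\<close> sits at \<open>(i, i + 1)\<close>.

  All the equations are handled through their Picard iterates, which at every order are measurable,
  depend on finitely many coordinates and satisfy the gradient identity exactly.\<close>

section \<open>Picard iteration for nearest-neighbour drifts\<close>

text \<open>The solutions and walks in the theorem are arbitrary: they live on unrelated probability
  spaces, and nothing says that the law of the walk depends measurably on its initial configuration.
  Every quantity is therefore transported to one canonical space, initial configuration times noise,
  on which the solution is an explicit measurable function. The transport rests on uniqueness among
  solutions with a weighted bound uniform on compact time intervals, whereas the dynamics only gives
  a finite weighted norm at each single time. Two more obstacles shape the argument.
  \<open>V''\<close> need not be continuous, so the flow is differentiated through secant slopes of
  \<open>V'\<close>, which converge to \<open>V''\<close> pointwise. And telescoping the gradient
  identity leaves a term at infinity; at a fixed Picard order everything has finite support, so this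
  term vanishes. The price is an error of order (4 Cp t)^n / n!, where 4 Cp bounds the norm of the
  drifts on bounded sequences: two neighbours count once each and the centre twice.\<close>

lemma set_integral_singleton: "(LBINT s:{a::real}. f s) = (0::real)"
proof -
  have "AE s in lborel. indicator {a} s *\<^sub>R f s = 0"
    using AE_lborel_singleton[of a] by eventually_elim (auto simp: indicator_def)
  then show ?thesis unfolding set_lebesgue_integral_def by (rule integral_eq_zero_AE)
qed

text \<open>Its main use is in the inductions over Picard iterates: the bound on the integrand is
  recognised as the derivative of the next bound (an exponential, or a term of the exponential
  series), so no iterated integral is ever computed.\<close>

lemma set_integral_abs_le_FTC:
  fixes f g H :: "real \<Rightarrow> real"
  assumes f: "f \<in> borel_measurable borel" and t: "0 \<le> t"
    and le: "\<And>s. 0 \<le> s \<Longrightarrow> s \<le> t \<Longrightarrow> \<bar>f s\<bar> \<le> g s"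
    and H: "\<And>s. (H has_real_derivative g s) (at s)" and g: "\<And>s. isCont g s"
  shows "\<bar>LBINT s:{0..t}. f s\<bar> \<le> H t - H 0"
proof -
  have *: "has_bochner_integral lborel (\<lambda>s. g s * indicator {0..t} s) (H t - H 0)"
    by (rule has_bochner_integral_FTC_Icc_real) (use t H g in auto)
  have "\<bar>LBINT s:{0..t}. f s\<bar> \<le> (LINT s|lborel. g s * indicator {0..t} s)"
    unfolding set_lebesgue_integral_def real_norm_def[symmetric]
  proof (rule Bochner_Integration.integral_norm_bound_integral)
    have le': "norm (indicator {0..t} s *\<^sub>R f s) \<le> g s * indicator {0..t} s" for s
    proof (cases "s \<in> {0..t}")
      case True
      then show ?thesis using le[of s] by simp
    qed simp
    then show "norm (indicator {0..t} s *\<^sub>R f s) \<le> g s * indicator {0..t} s" for s .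
    show "integrable lborel (\<lambda>s. g s * indicator {0..t} s)"
      using * by (simp add: has_bochner_integral_iff)
    then show "integrable lborel (\<lambda>s. indicator {0..t} s *\<^sub>R f s)"
    proof (rule Bochner_Integration.integrable_bound)
      show "AE s in lborel. norm (indicator {0..t} s *\<^sub>R f s) \<le> norm (g s * indicator {0..t} s)"
        by (intro AE_I2 order_trans[OF le']) simp
    qed (use f in simp)
  qed
  also have "\<dots> = H t - H 0"
    using * by (simp add: has_bochner_integral_iff)
  finally show ?thesis .
qed

lemma power_fact_tendsto_0: "(\<lambda>n. x ^ n / fact n :: real) \<longlonglongrightarrow> 0"
  using summable_LIMSEQ_zero[OF summable_exp[of x]] by (simp add: field_simps)

lemma has_real_derivative_power_fact:
  "((\<lambda>s. (c * s) ^ Suc n / fact (Suc n)) has_real_derivative c * ((c * s) ^ n / fact n)) (at (s::real))"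
proof -
  have "((\<lambda>s. (c * s) ^ Suc n / fact (Suc n)) has_real_derivative
      (real (Suc n) * (c * s) ^ n * c) / fact (Suc n)) (at s)"
    by (rule derivative_eq_intros refl | simp)+
  also have "(real (Suc n) * (c * s) ^ n * c) / fact (Suc n) = c * ((c * s) ^ n / fact n)"
    by (simp add: divide_simps del: of_nat_Suc) 
  finally show ?thesis .
qed

text \<open>Starting from 0 rather than from \<open>v\<close> has two effects: for the linear drifts
  with a unit mass as forcing, the n-th iterate vanishes at distance n from that mass; and the error
  of the iterate of order 0 is the solution itself, so an a priori bound on the solution starts the
  error estimates.\<close>

fun pic :: "(real \<Rightarrow> (int \<Rightarrow> real) \<Rightarrow> int \<Rightarrow> real) \<Rightarrow> (real \<Rightarrow> int \<Rightarrow> real) \<Rightarrow> nat \<Rightarrow> real \<Rightarrow> int \<Rightarrow> real"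
  where
  "pic G v 0 t i = 0"
| "pic G v (Suc n) t i = v t i + (LBINT s:{0..t}. G s (pic G v n s) i)"

definition tame :: "real \<Rightarrow> (real \<Rightarrow> int \<Rightarrow> real) \<Rightarrow> bool" where
  "tame T x \<longleftrightarrow> (\<forall>j. (\<lambda>s. x s j) \<in> borel_measurable borel) \<and> (\<forall>j. \<exists>K. \<forall>s\<in>{0..T}. \<bar>x s j\<bar> \<le> K)"

definition solves ::
  "(real \<Rightarrow> (int \<Rightarrow> real) \<Rightarrow> int \<Rightarrow> real) \<Rightarrow> (real \<Rightarrow> int \<Rightarrow> real) \<Rightarrow> real \<Rightarrow> (real \<Rightarrow> int \<Rightarrow> real) \<Rightarrow> bool"
  where
  "solves G v T x \<longleftrightarrow> tame T x \<and> (\<forall>t\<in>{0..T}. \<forall>i. x t i = v t i + (LBINT s:{0..t}. G s (x s) i))"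

text \<open>Growth by at most a factor \<open>a\<close> towards either neighbour is what makes a
  nearest-neighbour drift Lipschitz in the sup norm weighted by 1 / w. Two instances occur: the
  constant 1 for bounded perturbations, and exp (k |i|) for typical configurations.\<close>

definition weight :: "real \<Rightarrow> (int \<Rightarrow> real) \<Rightarrow> bool" where
  "weight a w \<longleftrightarrow> (\<forall>i. 0 < w i \<and> w (i + 1) \<le> a * w i \<and> w (i - 1) \<le> a * w i)"

lemma weight_nonneg: "weight a w \<Longrightarrow> 0 \<le> a"
  unfolding weight_def by (meson less_le_trans less_le zero_less_mult_pos2)

lemma weight_one: "weight 1 (\<lambda>_. 1)"
  by (simp add: weight_def)

lemma weight_exp:
  assumes "0 \<le> k" shows "weight (exp k) (\<lambda>i. exp (k * real_of_int \<bar>i\<bar>))"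
proof -
  have "k * real_of_int \<bar>i + 1\<bar> \<le> k + k * real_of_int \<bar>i\<bar>" "k * real_of_int \<bar>i - 1\<bar> \<le> k + k * real_of_int \<bar>i\<bar>" for i
    using mult_left_mono[OF _ assms, of "real_of_int \<bar>i + 1\<bar>" "1 + real_of_int \<bar>i\<bar>"]
      mult_left_mono[OF _ assms, of "real_of_int \<bar>i - 1\<bar>" "1 + real_of_int \<bar>i\<bar>"]
    by (auto simp: algebra_simps)
  then show ?thesis by (simp add: weight_def exp_add[symmetric])
qed

lemma tame_mono: "tame T x \<Longrightarrow> t \<le> T \<Longrightarrow> tame t x"
  unfolding tame_def by (meson atLeastAtMost_iff order_trans)

lemma tame_weightI:
  "(\<And>j. (\<lambda>s. x s j) \<in> borel_measurable borel) \<Longrightarrow> (\<And>s j. 0 \<le> s \<Longrightarrow> s \<le> T \<Longrightarrow> \<bar>x s j\<bar> \<le> K * w j) \<Longrightarrow> tame T x"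
  unfolding tame_def by (intro conjI allI exI[of _ "K * w j" for j] ballI) auto

lemma borel_measurable_set_integral_Icc [measurable (raw)]:
  fixes g :: "'a \<Rightarrow> real \<Rightarrow> real"
  assumes [measurable]: "(\<lambda>(x, s). g x s) \<in> borel_measurable (N \<Otimes>\<^sub>M borel)" and [measurable]: "f \<in> borel_measurable N"
  shows "(\<lambda>x. LBINT s:{0..f x}. g x s) \<in> borel_measurable N"
proof -
  have "(\<lambda>(x, s). indicator {0..f x} s *\<^sub>R g x s) \<in> borel_measurable (N \<Otimes>\<^sub>M borel)"
    unfolding indicator_def atLeastAtMost_iff by measurable
  then show ?thesis
    unfolding set_lebesgue_integral_def
    by (intro lborel.borel_measurable_lebesgue_integral) (simp cong: measurable_cong_sets)
qed

text \<open>Common frame for the nonlinear Ginzburg-Landau drift, its linearisation on sites and the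
  generator on bonds. In time only measurability is asked, because the linear coefficients are
  values of \<open>V''\<close> along a path.\<close>

locale near_drift =
  fixes C :: real and G :: "real \<Rightarrow> (int \<Rightarrow> real) \<Rightarrow> int \<Rightarrow> real"
  assumes C_nonneg: "0 \<le> C"
    and lip: "\<And>s x y i. \<bar>G s x i - G s y i\<bar>
      \<le> C * (\<bar>x (i + 1) - y (i + 1)\<bar> + \<bar>x (i - 1) - y (i - 1)\<bar> + 2 * \<bar>x i - y i\<bar>)"
    and zero: "\<And>s i. G s (\<lambda>_. 0) i = 0"
    and meas: "\<And>x i. (\<And>j. (\<lambda>s. x s j) \<in> borel_measurable borel) \<Longrightarrow> (\<lambda>s. G s (x s) i) \<in> borel_measurable borel"
begin

lemma G_bound: "\<bar>G s x i\<bar> \<le> C * (\<bar>x (i + 1)\<bar> + \<bar>x (i - 1)\<bar> + 2 * \<bar>x i\<bar>)"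
  using lip[of s x i "\<lambda>_. 0"] by (simp add: zero)

text \<open>The factor 2 * a + 2 counts two neighbours, each at the price \<open>a\<close> of moving
  the weight by one site, and the centre twice. With \<open>a\<close> = 1 it is the 4 in the
  recurring constant 4 * Cp.\<close>

lemma lip_weight:
  assumes w: "weight a w" and le: "\<And>j. \<bar>x j - y j\<bar> \<le> c * w j" and c: "0 \<le> c"
  shows "\<bar>G s x i - G s y i\<bar> \<le> C * (2 * a + 2) * (c * w i)"
proof -
  have "\<bar>x (i + 1) - y (i + 1)\<bar> \<le> a * (c * w i)"
    using le[of "i + 1"] mult_left_mono[of "w (i + 1)" "a * w i" c] w c by (force simp: weight_def ac_simps)
  moreover have "\<bar>x (i - 1) - y (i - 1)\<bar> \<le> a * (c * w i)"
    using le[of "i - 1"] mult_left_mono[of "w (i - 1)" "a * w i" c] w c by (force simp: weight_def ac_simps)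
  ultimately have "\<bar>x (i + 1) - y (i + 1)\<bar> + \<bar>x (i - 1) - y (i - 1)\<bar> + 2 * \<bar>x i - y i\<bar> \<le> (2 * a + 2) * (c * w i)"
    using le[of i] by (simp add: algebra_simps)
  from mult_left_mono[OF this C_nonneg] lip[of s x i y] show ?thesis
    by (simp add: ac_simps)
qed

lemma tame_G_bound:
  assumes x: "tame T x"
  obtains K where "\<And>s. 0 \<le> s \<Longrightarrow> s \<le> T \<Longrightarrow> \<bar>G s (x s) i\<bar> \<le> K"
proof -
  obtain K where K: "\<And>j s. s \<in> {0..T} \<Longrightarrow> \<bar>x s j\<bar> \<le> K j"
    using x unfolding tame_def by metis
  have "\<bar>G s (x s) i\<bar> \<le> C * (K (i + 1) + K (i - 1) + 2 * K i)" if "0 \<le> s" "s \<le> T" for s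
    by (rule order_trans[OF G_bound], intro mult_left_mono add_mono K C_nonneg) (use that in auto)
  then show ?thesis using that by blast
qed

lemma tame_integrable:
  assumes x: "tame T x" and t: "t \<le> T"
  shows "set_integrable lborel {0..t} (\<lambda>s. G s (x s) i)"
proof -
  obtain K where K: "\<And>s. 0 \<le> s \<Longrightarrow> s \<le> T \<Longrightarrow> \<bar>G s (x s) i\<bar> \<le> K"
    using tame_G_bound[OF x] by metis
  have [measurable]: "(\<lambda>s. G s (x s) i) \<in> borel_measurable borel"
    by (rule meas) (use x in \<open>auto simp: tame_def\<close>)
  have "set_integrable lborel {0..t} (\<lambda>s. K)"
    by (simp add: set_integrable_def integrable_indicator_iff emeasure_lborel_Icc_eq)
  then show ?thesis
    by (rule set_integrable_bound)
      (use K t in \<open>auto simp: set_borel_measurable_def intro!: AE_I2 intro: order_trans[OF _ abs_ge_self]\<close>)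
qed

lemma tame_pic:
  assumes v: "tame T v" shows "tame T (pic G v n)"
proof (induction n)
  case 0
  then show ?case by (auto simp: tame_def)
next
  case (Suc n)
  have [measurable]: "(\<lambda>s. v s j) \<in> borel_measurable borel" for j
    using v by (simp add: tame_def)
  have G_meas[measurable]: "(\<lambda>s. G s (pic G v n s) j) \<in> borel_measurable borel" for j
    by (rule meas) (use Suc in \<open>auto simp: tame_def\<close>)
  have "\<exists>K. \<forall>s\<in>{0..T}. \<bar>pic G v (Suc n) s j\<bar> \<le> K" for j
  proof -
    obtain K where K: "\<And>s. 0 \<le> s \<Longrightarrow> s \<le> T \<Longrightarrow> \<bar>G s (pic G v n s) j\<bar> \<le> K"
      using tame_G_bound[OF Suc] by metis
    obtain Kv where Kv: "\<And>s. s \<in> {0..T} \<Longrightarrow> \<bar>v s j\<bar> \<le> Kv"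
      using v unfolding tame_def by metis
    have "\<bar>pic G v (Suc n) s j\<bar> \<le> Kv + \<bar>K\<bar> * T" if s: "s \<in> {0..T}" for s
    proof -
      have "\<bar>LBINT u:{0..s}. G u (pic G v n u) j\<bar> \<le> \<bar>K\<bar> * s - \<bar>K\<bar> * 0"
        by (rule set_integral_abs_le_FTC[where g = "\<lambda>_. \<bar>K\<bar>"])
           (use s K in \<open>auto intro!: derivative_eq_intros intro: order_trans[OF _ abs_ge_self]\<close>)
      moreover have "\<bar>K\<bar> * s \<le> \<bar>K\<bar> * T" using s by (intro mult_left_mono) auto
      ultimately show ?thesis using Kv[OF s] by simp
    qed
    then show ?thesis by blast
  qed
  then show ?case by (auto simp: tame_def)
qed

text \<open>With L = C * (2 * a + 2), the function K w exp (L t) satisfies its integral inequality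
  with equality, so the bound reproduces itself under one Picard step and holds uniformly in the
  order. An induction that passes to the limit thereby replaces Gronwall's inequality.\<close>

lemma pic_stable:
  assumes w: "weight a w" and v: "tame T v" "tame T v'" and K: "0 \<le> K"
    and le: "\<And>s i. 0 \<le> s \<Longrightarrow> s \<le> T \<Longrightarrow> \<bar>v s i - v' s i\<bar> \<le> K * w i"
    and t: "0 \<le> t" "t \<le> T"
  shows "\<bar>pic G v n t i - pic G v' n t i\<bar> \<le> K * w i * exp (C * (2 * a + 2) * t)"
  using t
proof (induction n arbitrary: t i)
  case 0
  then show ?case using w K by (simp add: weight_def less_imp_le)
next
  case (Suc n)
  let ?L = "C * (2 * a + 2)"
  note tm = tame_pic[OF v(1), of n] tame_pic[OF v(2), of n]
  have *: "\<bar>G s (pic G v n s) i - G s (pic G v' n s) i\<bar> \<le> K * w i * (?L * exp (?L * s))" if "0 \<le> s" "s \<le> t" for s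
    using lip_weight[OF w, of "pic G v n s" "pic G v' n s" "K * exp (?L * s)" s i] Suc.IH[of s] that Suc.prems K
    by (simp add: ac_simps)
  have "\<bar>(LBINT s:{0..t}. G s (pic G v n s) i - G s (pic G v' n s) i)\<bar> \<le> K * w i * exp (?L * t) - K * w i * exp (?L * 0)"
    by (rule set_integral_abs_le_FTC[OF _ _ *])
       (use Suc.prems tm in \<open>auto intro!: borel_measurable_diff meas derivative_eq_intros continuous_intros simp: tame_def\<close>)
  also have "(LBINT s:{0..t}. G s (pic G v n s) i - G s (pic G v' n s) i)
      = (LBINT s:{0..t}. G s (pic G v n s) i) - (LBINT s:{0..t}. G s (pic G v' n s) i)"
    using tame_integrable[OF tm(1)] tame_integrable[OF tm(2)] Suc.prems by (intro set_integral_diff) auto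
  finally show ?case using le[of t i] Suc.prems by (simp add: algebra_simps)
qed

lemma pic_zero: "pic G (\<lambda>_ _. 0) n t i = 0"
proof (induction n arbitrary: t i)
  case (Suc n)
  then have "pic G (\<lambda>_ _. 0) n s = (\<lambda>_. 0)" for s by (simp add: fun_eq_iff)
  then show ?case by (simp add: zero)
qed simp

lemma pic_bound:
  assumes w: "weight a w" and v: "tame T v" and K: "0 \<le> K"
    and le: "\<And>s i. 0 \<le> s \<Longrightarrow> s \<le> T \<Longrightarrow> \<bar>v s i\<bar> \<le> K * w i"
    and t: "0 \<le> t" "t \<le> T"
  shows "\<bar>pic G v n t i\<bar> \<le> K * w i * exp (C * (2 * a + 2) * t)"
  using pic_stable[OF w v, of "\<lambda>_ _. 0" K t n i] tame_mono[OF v] le K t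
  by (auto simp: pic_zero tame_def)

text \<open>Each Picard step integrates the Lipschitz estimate once, which turns one term of the
  exponential series into the next. The bound on \<open>x\<close> enters at order 0, where the
  iterate is 0.\<close>

lemma pic_error:
  assumes w: "weight a w" and v: "tame T v" and x: "solves G v T x" and K: "0 \<le> K"
    and le: "\<And>s i. 0 \<le> s \<Longrightarrow> s \<le> T \<Longrightarrow> \<bar>x s i\<bar> \<le> K * w i"
    and t: "0 \<le> t" "t \<le> T"
  shows "\<bar>x t i - pic G v n t i\<bar> \<le> K * w i * ((C * (2 * a + 2) * t) ^ n / fact n)"
  using t
proof (induction n arbitrary: t i)
  case 0
  then show ?case using le by simp
next
  case (Suc n)
  let ?L = "C * (2 * a + 2)"
  have L: "0 \<le> ?L" using C_nonneg weight_nonneg[OF w] by simp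
  have tx: "tame T x" using x by (simp add: solves_def)
  note tm = tame_pic[OF v, of n]
  have *: "\<bar>G s (x s) i - G s (pic G v n s) i\<bar> \<le> K * w i * (?L * ((?L * s) ^ n / fact n))" if "0 \<le> s" "s \<le> t" for s
  proof -
    have "0 \<le> K * ((?L * s) ^ n / fact n)" using K L that by (intro mult_nonneg_nonneg divide_nonneg_nonneg) auto
    then show ?thesis
      using lip_weight[OF w, of "x s" "pic G v n s" "K * ((?L * s) ^ n / fact n)" s i] Suc.IH[of s] that Suc.prems
      by (simp add: ac_simps del: pic.simps distrib_left_numeral)
  qed
  have "\<bar>(LBINT s:{0..t}. G s (x s) i - G s (pic G v n s) i)\<bar>
     \<le> K * w i * ((?L * t) ^ Suc n / fact (Suc n)) - K * w i * ((?L * 0) ^ Suc n / fact (Suc n))"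
    by (rule set_integral_abs_le_FTC[OF _ _ *])
       (use Suc.prems tm tx in \<open>auto intro!: borel_measurable_diff meas DERIV_cmult[OF has_real_derivative_power_fact, simplified times_divide_eq_right] continuous_intros simp: tame_def simp del: power_Suc fact_Suc\<close>)
  also have "(LBINT s:{0..t}. G s (x s) i - G s (pic G v n s) i)
      = (LBINT s:{0..t}. G s (x s) i) - (LBINT s:{0..t}. G s (pic G v n s) i)"
    using tame_integrable[OF tx] tame_integrable[OF tm] Suc.prems by (intro set_integral_diff) auto
  also have "\<dots> = x t i - pic G v (Suc n) t i"
    using x Suc.prems by (simp add: solves_def)
  finally show ?case by simp
qed

lemma pic_diff_Suc:
  assumes w: "weight a w" and v: "tame T v" and K: "0 \<le> K"
    and le: "\<And>s i. 0 \<le> s \<Longrightarrow> s \<le> T \<Longrightarrow> \<bar>v s i\<bar> \<le> K * w i"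
    and t: "0 \<le> t" "t \<le> T"
  shows "\<bar>pic G v (Suc n) t i - pic G v n t i\<bar> \<le> K * w i * ((C * (2 * a + 2) * t) ^ n / fact n)"
  using t
proof (induction n arbitrary: t i)
  case 0
  have "pic G v 0 s = (\<lambda>_. 0)" for s by (simp add: fun_eq_iff)
  then show ?case using 0 le by (simp add: zero)
next
  case (Suc n)
  let ?L = "C * (2 * a + 2)"
  have L: "0 \<le> ?L" using C_nonneg weight_nonneg[OF w] by simp
  note tm = tame_pic[OF v, of n] and tx = tame_pic[OF v, of "Suc n"]
  have *: "\<bar>G s (pic G v (Suc n) s) i - G s (pic G v n s) i\<bar> \<le> K * w i * (?L * ((?L * s) ^ n / fact n))" if "0 \<le> s" "s \<le> t" for s
  proof -
    have "0 \<le> K * ((?L * s) ^ n / fact n)" using K L that by (intro mult_nonneg_nonneg divide_nonneg_nonneg) auto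
    then show ?thesis
      using lip_weight[OF w, of "pic G v (Suc n) s" "pic G v n s" "K * ((?L * s) ^ n / fact n)" s i] Suc.IH[of s] that Suc.prems
      by (simp add: ac_simps del: pic.simps distrib_left_numeral)
  qed
  have "\<bar>(LBINT s:{0..t}. G s (pic G v (Suc n) s) i - G s (pic G v n s) i)\<bar>
     \<le> K * w i * ((?L * t) ^ Suc n / fact (Suc n)) - K * w i * ((?L * 0) ^ Suc n / fact (Suc n))"
    by (rule set_integral_abs_le_FTC[OF _ _ *])
       (use Suc.prems tm tx in \<open>auto intro!: borel_measurable_diff meas DERIV_cmult[OF has_real_derivative_power_fact, simplified times_divide_eq_right] continuous_intros simp: tame_def simp del: power_Suc fact_Suc pic.simps\<close>)
  also have "(LBINT s:{0..t}. G s (pic G v (Suc n) s) i - G s (pic G v n s) i)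
      = (LBINT s:{0..t}. G s (pic G v (Suc n) s) i) - (LBINT s:{0..t}. G s (pic G v n s) i)"
    using tame_integrable[OF tx] tame_integrable[OF tm] Suc.prems by (intro set_integral_diff) auto
  also have "\<dots> = pic G v (Suc (Suc n)) t i - pic G v (Suc n) t i"
    by simp
  finally show ?case by simp
qed

end

text \<open>A bare limit, with an unspecified value where the iterates diverge, is defined for every
  configuration and every noise, and it inherits joint measurability from the iterates. Convergence
  is only claimed where a weighted bound is available.\<close>

definition flow :: "(real \<Rightarrow> (int \<Rightarrow> real) \<Rightarrow> int \<Rightarrow> real) \<Rightarrow> (real \<Rightarrow> int \<Rightarrow> real) \<Rightarrow> real \<Rightarrow> int \<Rightarrow> real"
  where "flow G v t i = lim (\<lambda>n. pic G v n t i)"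

section \<open>Existence and uniqueness of solutions with a weighted bound\<close>

context near_drift
begin

lemma pic_tendsto_flow:
  assumes w: "weight a w" and v: "tame T v" and K: "0 \<le> K"
    and le: "\<And>s i. 0 \<le> s \<Longrightarrow> s \<le> T \<Longrightarrow> \<bar>v s i\<bar> \<le> K * w i"
    and t: "0 \<le> t" "t \<le> T"
  shows "(\<lambda>n. pic G v n t i) \<longlonglongrightarrow> flow G v t i"
proof -
  let ?L = "C * (2 * a + 2)"
  have "summable (\<lambda>n. K * w i * ((?L * t) ^ n / fact n))"
    using summable_exp[of "?L * t"] by (intro summable_mult) (simp add: field_simps)
  then have "summable (\<lambda>n. pic G v (Suc n) t i - pic G v n t i)"
    by (rule summable_comparison_test'[of _ 0]) (use pic_diff_Suc[OF w v K le t] in \<open>auto simp del: pic.simps\<close>)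
  then have "convergent (\<lambda>n. \<Sum>k<n. pic G v (Suc k) t i - pic G v k t i)"
    by (simp add: summable_iff_convergent)
  then have "convergent (\<lambda>n. pic G v n t i)"
    by (simp add: sum_lessThan_telescope[of "\<lambda>n. pic G v n t i"] del: pic.simps(2))
  then show ?thesis by (simp add: flow_def convergent_LIMSEQ_iff)
qed

lemma flow_bound:
  assumes "weight a w" "tame T v" "0 \<le> K"
    "\<And>s i. 0 \<le> s \<Longrightarrow> s \<le> T \<Longrightarrow> \<bar>v s i\<bar> \<le> K * w i" "0 \<le> t" "t \<le> T"
  shows "\<bar>flow G v t i\<bar> \<le> K * w i * exp (C * (2 * a + 2) * t)"
  by (rule LIMSEQ_le_const2[OF tendsto_rabs[OF pic_tendsto_flow[OF assms]]])
    (use pic_bound[OF assms] in \<open>auto simp del: distrib_left_numeral\<close>)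

lemma flow_measurable:
  assumes "tame T v" shows "(\<lambda>t. flow G v t i) \<in> borel_measurable borel"
  using tame_pic[OF assms] unfolding flow_def tame_def
  by (intro borel_measurable_lim_metric) auto

lemma flow_solves:
  assumes w: "weight a w" and v: "tame T v" and K: "0 \<le> K"
    and le: "\<And>s i. 0 \<le> s \<Longrightarrow> s \<le> T \<Longrightarrow> \<bar>v s i\<bar> \<le> K * w i"
  shows "solves G v T (flow G v)"
  unfolding solves_def
proof (intro conjI ballI allI)
  let ?L = "C * (2 * a + 2)"
  have L: "0 \<le> ?L" using C_nonneg weight_nonneg[OF w] by simp
  have wpos: "0 < w i" for i using w by (simp add: weight_def)
  show tf: "tame T (flow G v)"
    unfolding tame_def
  proof (intro conjI allI exI ballI)
    fix j s assume "s \<in> {0..T}"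
    then have s: "0 \<le> s" "s \<le> T" by auto
    have ee: "exp (?L * s) \<le> exp (?L * T)" unfolding exp_le_cancel_iff by (rule mult_left_mono[OF s(2) L])
    have "\<bar>flow G v s j\<bar> \<le> K * w j * exp (?L * s)" by (rule flow_bound[OF w v K le s])
    also have "\<dots> \<le> K * w j * exp (?L * T)"
      by (intro mult_left_mono ee mult_nonneg_nonneg K less_imp_le wpos)
    finally show "\<bar>flow G v s j\<bar> \<le> K * w j * exp (?L * T)" .
  qed (use flow_measurable[OF v] in auto)
  fix t i assume "t \<in> {0..T}"
  then have t: "0 \<le> t" "t \<le> T" by auto
  have "(\<lambda>n. LBINT s:{0..t}. G s (pic G v n s) i) \<longlonglongrightarrow> (LBINT s:{0..t}. G s (flow G v s) i)"
  proof -
    have m: "(\<lambda>s. G s (flow G v s) i) \<in> borel_measurable lborel" "(\<lambda>s. G s (pic G v n s) i) \<in> borel_measurable lborel" for n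
      using tf tame_pic[OF v, of n] by (simp_all add: meas tame_def)
    show "(\<lambda>n. LBINT s:{0..t}. G s (pic G v n s) i) \<longlonglongrightarrow> (LBINT s:{0..t}. G s (flow G v s) i)"
    unfolding set_lebesgue_integral_def
  \<comment> \<open>The majorant is the Lipschitz estimate against the zero configuration, applied
    to the bound of \<open>pic_bound\<close> at the final time \<open>t\<close>.\<close>
  proof (rule integral_dominated_convergence[where w = "\<lambda>s. indicator {0..t} s *\<^sub>R (?L * (K * exp (?L * t) * w i))"])
    show "(\<lambda>s. indicator {0..t} s *\<^sub>R G s (flow G v s) i) \<in> borel_measurable lborel"
      "(\<lambda>s. indicator {0..t} s *\<^sub>R G s (pic G v n s) i) \<in> borel_measurable lborel" for n
      by (intro borel_measurable_scaleR m borel_measurable_indicator; simp)+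
    show "AE s in lborel. (\<lambda>n. indicator {0..t} s *\<^sub>R G s (pic G v n s) i) \<longlonglongrightarrow> indicator {0..t} s *\<^sub>R G s (flow G v s) i"
    proof (intro AE_I2)
      fix s :: real
      show "(\<lambda>n. indicator {0..t} s *\<^sub>R G s (pic G v n s) i) \<longlonglongrightarrow> indicator {0..t} s *\<^sub>R G s (flow G v s) i"
      proof (cases "s \<in> {0..t}")
        case True
        then have s: "0 \<le> s" "s \<le> T" using t by auto
        note lm = pic_tendsto_flow[OF w v K le s]
        have z: "(\<lambda>n. \<bar>pic G v n s j - flow G v s j\<bar>) \<longlonglongrightarrow> 0" for j
          by (rule tendsto_rabs_zero[OF LIM_zero[OF lm]])
        have lim0: "(\<lambda>n. C * (\<bar>pic G v n s (i + 1) - flow G v s (i + 1)\<bar> + \<bar>pic G v n s (i - 1) - flow G v s (i - 1)\<bar>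
              + 2 * \<bar>pic G v n s i - flow G v s i\<bar>)) \<longlonglongrightarrow> 0"
          by (intro tendsto_mult_right_zero tendsto_add_zero z)
        have "(\<lambda>n. G s (pic G v n s) i - G s (flow G v s) i) \<longlonglongrightarrow> 0"
          by (rule Lim_null_comparison[OF always_eventually[OF allI] lim0]) (unfold real_norm_def, rule lip)
        then show ?thesis using True by (simp add: LIM_zero_iff)
      qed simp
    qed
    show "AE s in lborel. norm (indicator {0..t} s *\<^sub>R G s (pic G v n s) i) \<le> indicator {0..t} s *\<^sub>R (?L * (K * exp (?L * t) * w i))" for n
    proof (intro AE_I2)
      fix s :: real
      show "norm (indicator {0..t} s *\<^sub>R G s (pic G v n s) i) \<le> indicator {0..t} s *\<^sub>R (?L * (K * exp (?L * t) * w i))"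
      proof (cases "s \<in> {0..t}")
        case True
        then have s: "0 \<le> s" "s \<le> T" "s \<le> t" using t by auto
        have ee: "exp (?L * s) \<le> exp (?L * t)" unfolding exp_le_cancel_iff by (rule mult_left_mono[OF s(3) L])
        have "\<bar>pic G v n s j - 0\<bar> \<le> (K * exp (?L * t)) * w j" for j
        proof -
          have "\<bar>pic G v n s j\<bar> \<le> K * w j * exp (?L * s)" by (rule pic_bound[OF w v K le s(1,2)])
          also have "\<dots> \<le> K * w j * exp (?L * t)"
            by (intro mult_left_mono ee mult_nonneg_nonneg K less_imp_le wpos)
          finally show ?thesis by (simp only: diff_zero ac_simps)
        qed
        from lip_weight[OF w this, of s i] K True show ?thesis by (simp add: zero del: distrib_left_numeral)
      qed simp
    qed
    show "integrable lborel (\<lambda>s. indicator {0..t} s *\<^sub>R (?L * (K * exp (?L * t) * w i)))"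
      by (intro integrable_scaleR_left) (simp add: integrable_indicator_iff emeasure_lborel_Icc_eq)
  qed
  qed
  then have "(\<lambda>n. v t i + (LBINT s:{0..t}. G s (pic G v n s) i)) \<longlonglongrightarrow> v t i + (LBINT s:{0..t}. G s (flow G v s) i)"
    by (intro tendsto_intros)
  moreover have "(\<lambda>n. pic G v (Suc n) t i) \<longlonglongrightarrow> flow G v t i"
    by (rule LIMSEQ_Suc) (rule pic_tendsto_flow[OF w v K le t])
  ultimately show "flow G v t i = v t i + (LBINT s:{0..t}. G s (flow G v s) i)"
    by (simp add: LIMSEQ_unique)
qed

text \<open>The iterates depend on the drift and on \<open>v\<close> alone, so all solutions with a
  weighted bound are limits of one sequence. The bound has to be uniform in time for the error to
  tend to 0; for the dynamics this is what \<open>weighted_bound_uniform\<close> provides.\<close>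

lemma solves_eq_flow:
  assumes w: "weight a w" and v: "tame T v" and x: "solves G v T x"
    and le: "\<And>s i. 0 \<le> s \<Longrightarrow> s \<le> T \<Longrightarrow> \<bar>x s i\<bar> \<le> K * w i"
    and t: "0 \<le> t" "t \<le> T"
  shows "x t i = flow G v t i"
proof -
  have "(\<lambda>n. \<bar>K\<bar> * w i * ((C * (2 * a + 2) * t) ^ n / fact n)) \<longlonglongrightarrow> 0"
    by (rule tendsto_mult_right_zero[OF power_fact_tendsto_0])
  note lim0 = this
  have bd: "\<bar>x s j\<bar> \<le> \<bar>K\<bar> * w j" if "0 \<le> s" "s \<le> T" for s j
    using order_trans[OF le[OF that, of j] mult_right_mono[OF abs_ge_self]] w
    by (simp add: weight_def less_imp_le)
  have "\<bar>pic G v n t i - x t i\<bar> \<le> \<bar>K\<bar> * w i * ((C * (2 * a + 2) * t) ^ n / fact n)" for n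
    using pic_error[OF w v x abs_ge_zero bd t, of i n] by (subst abs_minus_commute)
  then have "(\<lambda>n. pic G v n t i - x t i) \<longlonglongrightarrow> 0"
    by (intro Lim_null_comparison[OF always_eventually lim0]) simp
  then have "(\<lambda>n. pic G v n t i) \<longlonglongrightarrow> x t i" by (rule LIM_zero_cancel)
  then show ?thesis by (simp add: flow_def limI)
qed

end

section \<open>Uniform weighted bounds\<close>

lemma set_integral_Icc_increment_le:
  fixes g :: "real \<Rightarrow> real"
  assumes g: "set_integrable lborel {0..T} g" and c: "0 \<le> c" "c \<le> u" "u \<le> T"
    and le: "\<And>s. c \<le> s \<Longrightarrow> s \<le> u \<Longrightarrow> \<bar>g s\<bar> \<le> B"
  shows "\<bar>(LBINT s:{0..u}. g s) - (LBINT s:{0..c}. g s)\<bar> \<le> B * (u - c)"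
proof -
  have i1: "set_integrable lborel {0..c} g" and i2: "set_integrable lborel {c<..u} g"
    by (rule set_integrable_subset[OF g]; use c in auto)+
  have eq: "{0..u} = {0..c} \<union> {c<..u}" using c by auto
  have "(LBINT s:{0..u}. g s) = (LBINT s:{0..c}. g s) + (LBINT s:{c<..u}. g s)"
    unfolding eq by (rule set_integral_Un[OF _ i1 i2]) auto
  moreover have "\<bar>LBINT s:{c<..u}. g s\<bar> \<le> B * (u - c)"
  proof -
    have "\<bar>LBINT s:{c<..u}. g s\<bar> \<le> (LINT s|lborel. indicator {c<..u} s * B)"
      unfolding set_lebesgue_integral_def
    proof (rule integral_abs_bound_integral)
      show "integrable lborel (\<lambda>s. indicator {c<..u} s *\<^sub>R g s)"
        using i2 by (simp add: set_integrable_def)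
      show "integrable lborel (\<lambda>s. indicator {c<..u} s * B)"
        using c by (intro integrable_mult_left) (simp add: integrable_indicator_iff)
      show "\<bar>indicator {c<..u} s *\<^sub>R g s\<bar> \<le> indicator {c<..u} s * B" for s
      proof (cases "s \<in> {c<..u}")
        case True
        then show ?thesis using le[of s] by simp
      qed simp
    qed
    also have "\<dots> = B * (u - c)"
      using c by simp
    finally show ?thesis .
  qed
  ultimately show ?thesis by simp
qed

text \<open>Finiteness of the weighted norm is only known at each single time. A Baire category argument on
  the closed set of times with no bounded neighbourhood makes the bound locally uniform; the
  short-time estimate runs both forwards and backwards in time because the drift is Lipschitz.\<close>

lemma (in near_drift) weighted_bound_uniform:
  assumes w: "weight a w" and Tn: "0 \<le> T" and S: "0 \<le> S"
    and v: "\<And>s i. 0 \<le> s \<Longrightarrow> s \<le> T \<Longrightarrow> \<bar>v s i\<bar> \<le> S * w i"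
    and xm: "\<And>i. (\<lambda>s. x s i) \<in> borel_measurable borel"
    and xc: "\<And>i. continuous_on {0..T} (\<lambda>s. x s i)"
    and eq: "\<And>t i. 0 \<le> t \<Longrightarrow> t \<le> T \<Longrightarrow> x t i = v t i + (LBINT s:{0..t}. G s (x s) i)"
    and fin: "\<And>s. 0 \<le> s \<Longrightarrow> s \<le> T \<Longrightarrow> \<exists>K. \<forall>i. \<bar>x s i\<bar> \<le> K * w i"
  shows "solves G v T x \<and> (\<exists>K. \<forall>s\<in>{0..T}. \<forall>i. \<bar>x s i\<bar> \<le> K * w i)"
proof -
  define L where "L = C * (2 * a + 2)"
  have L0: "0 \<le> L" using C_nonneg weight_nonneg[OF w] by (simp add: L_def)
  have wpos: "0 < w i" for i using w by (simp add: weight_def)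
  have tx: "tame T x"
    unfolding tame_def
  proof (intro conjI allI xm)
    fix j
    have "bounded ((\<lambda>s. x s j) ` {0..T})"
      by (intro compact_imp_bounded compact_continuous_image xc) simp
    then show "\<exists>K. \<forall>s\<in>{0..T}. \<bar>x s j\<bar> \<le> K" by (auto simp: bounded_iff)
  qed
  define bd where "bd A \<longleftrightarrow> (\<exists>K. \<forall>s\<in>A. \<forall>i. \<bar>x s i\<bar> \<le> K * w i)" for A
  have bd_mono: "bd A" if "bd B" "A \<subseteq> B" for A B using that unfolding bd_def by blast
  have mono_K: "\<bar>x s i\<bar> \<le> K' * w i" if "\<bar>x s i\<bar> \<le> K * w i" "K \<le> K'" for s i K K'
    using that(1) mult_right_mono[OF that(2) less_imp_le[OF wpos[of i]]] by linarith
  have bd_Un: "bd (A \<union> B)" if "bd A" "bd B" for A B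
  proof -
    obtain K1 K2 where "\<forall>s\<in>A. \<forall>i. \<bar>x s i\<bar> \<le> K1 * w i" "\<forall>s\<in>B. \<forall>i. \<bar>x s i\<bar> \<le> K2 * w i"
      using \<open>bd A\<close> \<open>bd B\<close> unfolding bd_def by blast
    then have "\<bar>x s i\<bar> \<le> max K1 K2 * w i" if "s \<in> A \<union> B" for s i
      using that mono_K[of s i K1 "max K1 K2"] mono_K[of s i K2 "max K1 K2"] by auto
    then show ?thesis unfolding bd_def by blast
  qed
  \<comment> \<open>With L * \<tau> at most 1/2, one application of the integral equation halves the
    unknown part of a bound.\<close>
  define \<tau> where "\<tau> = 1 / (2 * (L + 1))"
  have \<tau>: "0 < \<tau>" "L * \<tau> \<le> 1 / 2" using L0 by (auto simp: \<tau>_def field_simps)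
  \<comment> \<open>Bootstrap: finiteness on the interval is assumed, but the resulting bound
    depends only on the bound \<open>m\<close> at one time \<open>c\<close>. The value 2 * (m + 2 *
    S) is the fixed point of B = m + 2 S + B / 2, where 2 S comes from subtracting the forcing at
    two times.\<close>
  have est: "\<bar>x u i\<bar> \<le> 2 * (m + 2 * S) * w i"
    if pq: "0 \<le> p" "p \<le> q" "q \<le> T" "q - p \<le> \<tau>" and b: "bd {p..q}" and c: "p \<le> c" "c \<le> q"
      and m: "0 \<le> m" "\<And>i. \<bar>x c i\<bar> \<le> m * w i" and u: "p \<le> u" "u \<le> q" for p q c m u i
  proof -
    obtain K0 where K0: "\<And>s i. s \<in> {p..q} \<Longrightarrow> \<bar>x s i\<bar> \<le> K0 * w i" using b unfolding bd_def by blast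
    define K where "K = max K0 0"
    have K: "0 \<le> K" "\<And>s i. s \<in> {p..q} \<Longrightarrow> \<bar>x s i\<bar> \<le> K * w i"
      using mono_K[OF K0] by (auto simp: K_def)
    have step: "\<bar>x u i\<bar> \<le> (2 * (m + 2 * S) + K / 2 ^ n) * w i" if "p \<le> u" "u \<le> q" for u i n
      using that
    proof (induction n arbitrary: u i)
      case 0
      show ?case by (rule mono_K[OF K(2)]) (use 0 S m in auto)
    next
      case (Suc n)
      define B where "B = 2 * (m + 2 * S) + K / 2 ^ n"
      have B: "0 \<le> B" using S m K by (simp add: B_def)
      have Gb: "\<bar>G s (x s) i\<bar> \<le> L * (B * w i)" if "p \<le> s" "s \<le> q" for s
        using lip_weight[OF w, of "x s" "\<lambda>_. 0" B s i] Suc.IH[OF that] B by (simp add: zero L_def B_def)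
      note int = tame_integrable[OF tx order_refl, of i]
      have "\<bar>(LBINT s:{0..u}. G s (x s) i) - (LBINT s:{0..c}. G s (x s) i)\<bar> \<le> L * (B * w i) * \<bar>u - c\<bar>"
      proof (cases "c \<le> u")
        case True
        then show ?thesis
          using set_integral_Icc_increment_le[OF int, of c u "L * (B * w i)"] Gb Suc.prems pq c by auto
      next
        case False
        then show ?thesis
          using set_integral_Icc_increment_le[OF int, of u c "L * (B * w i)"] Gb Suc.prems pq c
          by (auto simp: abs_minus_commute)
      qed
      also have "\<dots> \<le> L * (B * w i) * \<tau>"
        using Suc.prems pq c B wpos[of i] L0 by (intro mult_left_mono mult_nonneg_nonneg) auto
      also have "\<dots> = (L * \<tau>) * (B * w i)" by simp
      also have "\<dots> \<le> 1 / 2 * (B * w i)"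
        using B wpos[of i] by (intro mult_right_mono \<tau>) auto
      finally have "\<bar>(LBINT s:{0..u}. G s (x s) i) - (LBINT s:{0..c}. G s (x s) i)\<bar> \<le> B * w i / 2" by simp
      moreover have "x u i - x c i = v u i - v c i
          + ((LBINT s:{0..u}. G s (x s) i) - (LBINT s:{0..c}. G s (x s) i))"
        using eq[of u i] eq[of c i] Suc.prems pq c by simp
      moreover have "\<bar>v u i\<bar> \<le> S * w i" "\<bar>v c i\<bar> \<le> S * w i" using v Suc.prems pq c by auto
      ultimately have "\<bar>x u i\<bar> \<le> m * w i + 2 * (S * w i) + B * w i / 2"
        using m(2)[of i] by linarith
      also have "\<dots> = (2 * (m + 2 * S) + K / 2 ^ Suc n) * w i"
        by (simp add: B_def field_simps)
      finally show ?case .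
    qed
    have "(\<lambda>n. (2 * (m + 2 * S) + K * (1 / 2) ^ n) * w i) \<longlonglongrightarrow> (2 * (m + 2 * S) + K * 0) * w i"
      by (intro tendsto_mult_right tendsto_add tendsto_mult_left tendsto_const LIMSEQ_power_zero) simp
    moreover have "\<bar>x u i\<bar> \<le> (2 * (m + 2 * S) + K * (1 / 2) ^ n) * w i" for n
      using step[OF u, of i n] by (simp add: power_one_over)
    ultimately have "\<bar>x u i\<bar> \<le> (2 * (m + 2 * S) + K * 0) * w i"
      by (intro LIMSEQ_le_const) auto
    then show ?thesis by simp
  qed
  define U where "U = \<Union>{A. open A \<and> bd (A \<inter> {0..T})}"
  define Bad where "Bad = {0..T} - U"
  have "open U" unfolding U_def by blast
  then have closed_Bad: "closed Bad" unfolding Bad_def by (intro closed_Diff) auto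
  have bd_good: "bd {p..q}" if pq: "0 \<le> p" "p \<le> q" "q \<le> T" and disj: "{p..q} \<inter> Bad = {}" for p q
  proof -
    have "bd ({p..q} \<inter> {p..q})"
      using pq(2)
    \<comment> \<open>Each point of the interval has a neighbourhood with a bound; bisection glues
      finitely many of them.\<close>
    proof (induction rule: Bolzano[where P = "\<lambda>a b. bd ({a..b} \<inter> {p..q})"])
      case (trans a b c)
      show ?case by (rule bd_mono[OF bd_Un[OF trans(1,2)]]) auto
    next
      case (local y)
      then have "y \<in> U" using disj pq by (auto simp: Bad_def)
      then obtain A where A: "open A" "bd (A \<inter> {0..T})" "y \<in> A" unfolding U_def by blast
      then obtain d where d: "0 < d" "ball y d \<subseteq> A" using open_contains_ball by blast
      have "bd ({a..b} \<inter> {p..q})" if "a \<le> y" "y \<le> b" "b - a < d" for a b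
      proof (rule bd_mono[OF A(2)])
        show "{a..b} \<inter> {p..q} \<subseteq> A \<inter> {0..T}"
          using that d(2) pq by (auto simp: subset_eq dist_real_def)
      qed
      then show ?case using d(1) by blast
    qed
    then show ?thesis by simp
  qed
  have "Bad = {}"
  proof (rule ccontr)
    assume ne: "Bad \<noteq> {}"
    define E where "E m = {s \<in> {0..T}. \<forall>i. \<bar>x s i\<bar> \<le> real m * w i}" for m :: nat
    have closed_E: "closed (E m)" for m
    proof -
      have "E m = (\<Inter>i. {s \<in> {0..T}. \<bar>x s i\<bar> \<le> real m * w i})" by (auto simp: E_def)
      moreover have "closed {s \<in> {0..T}. \<bar>x s i\<bar> \<le> real m * w i}" for i
        by (intro continuous_on_closed_Collect_le continuous_on_rabs xc continuous_on_const) simp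
      ultimately show ?thesis by (simp add: closed_INT)
    qed
    \<comment> \<open>If every \<open>Bad - E m\<close> were dense in \<open>Bad\<close>, Baire's
      theorem would make their intersection dense; it is empty because the weighted norm is finite
      at each time. Hence some \<open>E m\<close> contains all bad times near some
      \<open>s0\<close>, and these share the bound \<open>m\<close>.\<close>
    have "\<not> (\<forall>m. Bad \<subseteq> closure (Bad - E m))"
    proof
      assume dense: "\<forall>m. Bad \<subseteq> closure (Bad - E m)"
      have "Bad \<subseteq> closure (\<Inter>(range (\<lambda>m. Bad - E m)))"
      proof (rule Baire[OF closed_Bad])
        show "openin (top_of_set Bad) A \<and> Bad \<subseteq> closure A" if "A \<in> range (\<lambda>m. Bad - E m)" for A
          using that dense closed_E by (auto simp: openin_open Diff_eq intro!: exI[of _ "- E _"] open_Compl)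
      qed simp
      moreover have "\<Inter>(range (\<lambda>m. Bad - E m)) = {}"
      proof (rule ccontr)
        assume "\<Inter>(range (\<lambda>m. Bad - E m)) \<noteq> {}"
        then obtain s where s: "s \<in> Bad" "\<And>m. s \<notin> E m" by auto
        then have "0 \<le> s" "s \<le> T" by (auto simp: Bad_def)
        then obtain K where K: "\<And>i. \<bar>x s i\<bar> \<le> K * w i" using fin by blast
        have "s \<in> E (nat \<lceil>K\<rceil>)"
          using mono_K[OF K] \<open>0 \<le> s\<close> \<open>s \<le> T\<close> by (auto simp: E_def of_nat_ceiling)
        then show False using s by blast
      qed
      ultimately have "Bad \<subseteq> {}" by (simp only: closure_empty)
      then show False using ne by simp
    qed
    then obtain m s0 where s0: "s0 \<in> Bad" "s0 \<notin> closure (Bad - E m)" by blast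
    then obtain e where e: "0 < e" "ball s0 e \<subseteq> - closure (Bad - E m)"
      using open_contains_ball[of "- closure (Bad - E m)"] by auto
    \<comment> \<open>Half of \<open>e\<close> keeps the bad time nearest to a point of the ball
      inside the ball of radius \<open>e\<close>, where the bound \<open>m\<close> is valid; \<tau>
      allows one short-time estimate to bridge the two.\<close>
    define d where "d = min (e / 2) \<tau>"
    have d: "0 < d" "2 * d \<le> e" "d \<le> \<tau>" using e \<tau> by (auto simp: d_def)
    have bound: "\<bar>x s i\<bar> \<le> 2 * (real m + 2 * S) * w i" if s: "s \<in> ball s0 d \<inter> {0..T}" for s i
    proof -
      \<comment> \<open>No bad time lies strictly between \<open>s\<close> and its nearest bad time
        \<open>p\<close>, so the solution is bounded on every closed interval reaching from
        \<open>s\<close> towards \<open>p\<close> and stopping short of it.\<close>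
      obtain p where p: "p \<in> Bad" "\<And>y. y \<in> Bad \<Longrightarrow> dist s p \<le> dist s y"
        using distance_attains_inf[OF closed_Bad ne] by blast
      have sp: "\<bar>s - p\<bar> < d" using p(2)[OF s0(1)] s by (simp add: dist_real_def abs_minus_commute)
      have "p \<in> ball s0 e" using sp s d by (auto simp: dist_real_def)
      then have "p \<in> E m" using e(2) p(1) closure_subset[of "Bad - E m"] by blast
      then have pm: "\<And>i. \<bar>x p i\<bar> \<le> real m * w i" by (auto simp: E_def)
      have pT: "0 \<le> p" "p \<le> T" and sT: "0 \<le> s" "s \<le> T" using p(1) s by (auto simp: Bad_def)
      obtain K0 where K0: "\<And>i. \<bar>x s i\<bar> \<le> K0 * w i" using fin sT by blast
      define K where "K = max K0 0"
      have K: "0 \<le> K" "\<And>i. \<bar>x s i\<bar> \<le> K * w i" using mono_K[OF K0] by (auto simp: K_def)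
      \<comment> \<open>Two passes. The estimate started at \<open>s\<close> bounds the solution up
        to, but not including, \<open>p\<close> by an amount depending on \<open>K\<close> and hence
        on \<open>s\<close>; with the bound at \<open>p\<close> this proves finiteness on the closed
        interval. The estimate restarted at \<open>p\<close> then gives a bound in terms of
        \<open>m\<close>, uniform in \<open>s\<close>.\<close>
      define b where "b = max (real m) (2 * (K + 2 * S))"
      consider "p = s" | "p < s" | "s < p" by linarith
      then show ?thesis
      proof cases
        case 1
        then show ?thesis using mono_K[OF pm] S by auto
      next
        case 2
        have "\<bar>x u j\<bar> \<le> 2 * (K + 2 * S) * w j" if u: "p < u" "u \<le> s" for u j
        proof (rule est[of u s s K u j])
          have "{u..s} \<inter> Bad = {}"
          proof (rule equals0I)
            fix z assume z: "z \<in> {u..s} \<inter> Bad"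
            then have "dist s p \<le> dist s z" using p(2) by blast
            then show False using z u by (auto simp: dist_real_def)
          qed
          then show "bd {u..s}" using u pT sT by (intro bd_good) auto
        qed (use u sp d pT sT K in auto)
        note near = this
        have "\<bar>x u j\<bar> \<le> b * w j" if u: "p \<le> u" "u \<le> s" for u j
        proof (cases "u = p")
          case True
          then show ?thesis using mono_K[OF pm, of b j] by (simp add: b_def)
        next
          case False
          then have "\<bar>x u j\<bar> \<le> 2 * (K + 2 * S) * w j" using u by (intro near) auto
          then show ?thesis by (rule mono_K) (simp add: b_def)
        qed
        then have bd: "bd {p..s}" unfolding bd_def by (intro exI[of _ b]) auto
        show ?thesis
          by (rule est[OF _ _ _ _ bd, of p "real m"]) (use 2 sp d pT sT pm in auto)
      next
        case 3
        have "\<bar>x u j\<bar> \<le> 2 * (K + 2 * S) * w j" if u: "s \<le> u" "u < p" for u j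
        proof (rule est[of s u s K u j])
          have "{s..u} \<inter> Bad = {}"
          proof (rule equals0I)
            fix z assume z: "z \<in> {s..u} \<inter> Bad"
            then have "dist s p \<le> dist s z" using p(2) by blast
            then show False using z u by (auto simp: dist_real_def)
          qed
          then show "bd {s..u}" using u pT sT by (intro bd_good) auto
        qed (use u sp d pT sT K in auto)
        note near = this
        have "\<bar>x u j\<bar> \<le> b * w j" if u: "s \<le> u" "u \<le> p" for u j
        proof (cases "u = p")
          case True
          then show ?thesis using mono_K[OF pm, of b j] by (simp add: b_def)
        next
          case False
          then have "\<bar>x u j\<bar> \<le> 2 * (K + 2 * S) * w j" using u by (intro near) auto
          then show ?thesis by (rule mono_K) (simp add: b_def)
        qed
        then have bd: "bd {s..p}" unfolding bd_def by (intro exI[of _ b]) auto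
        show ?thesis
          by (rule est[OF _ _ _ _ bd, of p "real m"]) (use 3 sp d pT sT pm in auto)
      qed
    qed
    then have "bd (ball s0 d \<inter> {0..T})" unfolding bd_def by blast
    then have "s0 \<in> U" using d(1) by (auto simp: U_def intro!: exI[of _ "ball s0 d"])
    then show False using s0(1) by (simp add: Bad_def)
  qed
  then have "bd {0..T}" using bd_good[of 0 T] Tn by simp
  then show ?thesis using tx eq by (auto simp: solves_def bd_def)
qed

section \<open>The single-site measure\<close>

text \<open>Integrated over two independent copies of the variable, the nonnegative product becomes
  twice the covariance of \<open>u\<close> and \<open>f\<close>.\<close>

lemma (in prob_space) expectation_mult_ge_if_comonotone:
  fixes u f :: "'a \<Rightarrow> real"
  assumes mono: "\<And>x y. x \<in> space M \<Longrightarrow> y \<in> space M \<Longrightarrow> 0 \<le> (u x - u y) * (f x - f y)"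
    and [simp]: "integrable M u" "integrable M f" "integrable M (\<lambda>x. u x * f x)"
  shows "expectation u * expectation f \<le> expectation (\<lambda>x. u x * f x)"
proof -
  have inner: "(LINT y|M. (u x - u y) * (f x - f y))
      = u x * f x - u x * expectation f - f x * expectation u + expectation (\<lambda>x. u x * f x)" for x
  proof -
    have "(LINT y|M. (u x - u y) * (f x - f y))
      = (LINT y|M. u x * f x - u x * f y - f x * u y + u y * f y)"
      by (rule Bochner_Integration.integral_cong) (auto simp: algebra_simps)
    then show ?thesis by (simp add: prob_space)
  qed
  have "0 \<le> (LINT x|M. LINT y|M. (u x - u y) * (f x - f y))"
    by (intro integral_nonneg_AE AE_I2 mono) auto
  also have "\<dots> = 2 * (expectation (\<lambda>x. u x * f x) - expectation u * expectation f)"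
  proof -
    have "(LINT x|M. LINT y|M. (u x - u y) * (f x - f y))
      = expectation (\<lambda>x. u x * f x) - expectation u * expectation f - expectation f * expectation u + expectation (\<lambda>x. u x * f x)"
      unfolding inner by (simp add: prob_space)
    then show ?thesis by simp
  qed
  finally show ?thesis by simp
qed

locale convex_potential =
  fixes V :: "real \<Rightarrow> real" and Cm Cp :: real
  assumes V_diff: "\<And>x. V differentiable (at x)"
    and V'_diff: "\<And>x. deriv V differentiable (at x)"
    and Cm_pos: "0 < Cm"
    and V''_lower: "\<And>x. Cm \<le> deriv (deriv V) x"
    and V''_upper: "\<And>x. deriv (deriv V) x \<le> Cp"
begin

lemma Cp_pos: "0 < Cp"
  using V''_lower[of 0] V''_upper[of 0] Cm_pos by linarith

lemma DERIV_V: "(V has_real_derivative deriv V x) (at x)"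
  using V_diff by (simp add: DERIV_deriv_iff_real_differentiable)

lemma DERIV_V': "(deriv V has_real_derivative deriv (deriv V) x) (at x)"
  using V'_diff by (simp add: DERIV_deriv_iff_real_differentiable)

lemma V'_increment:
  assumes "x \<le> y"
  shows "Cm * (y - x) \<le> deriv V y - deriv V x" and "deriv V y - deriv V x \<le> Cp * (y - x)"
proof -
  show "Cm * (y - x) \<le> deriv V y - deriv V x"
  proof (cases "x = y")
    case False
    then obtain z where "deriv V y - deriv V x = (y - x) * deriv (deriv V) z"
      using MVT2[of x y "deriv V" "deriv (deriv V)"] DERIV_V' assms by (metis less_le)
    then show ?thesis using mult_left_mono[OF V''_lower[of z], of "y - x"] assms by (simp add: mult.commute)
  qed simp
  show "deriv V y - deriv V x \<le> Cp * (y - x)"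
  proof (cases "x = y")
    case False
    then obtain z where "deriv V y - deriv V x = (y - x) * deriv (deriv V) z"
      using MVT2[of x y "deriv V" "deriv (deriv V)"] DERIV_V' assms by (metis less_le)
    then show ?thesis using mult_left_mono[OF V''_upper[of z], of "y - x"] assms by (simp add: mult.commute)
  qed simp
qed

lemma V'_lipschitz: "\<bar>deriv V x - deriv V y\<bar> \<le> Cp * \<bar>x - y\<bar>"
proof (cases "x \<le> y")
  case True
  then have "0 \<le> Cm * (y - x)" using Cm_pos by simp
  then show ?thesis using V'_increment[OF True] True by (simp add: abs_if)
next
  case False
  then have le: "y \<le> x" by simp
  then have "0 \<le> Cm * (x - y)" using Cm_pos by simp
  then show ?thesis using V'_increment[OF le] le by (simp add: abs_if)
qed

lemma V_measurable [measurable]: "V \<in> borel_measurable borel"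
  using DERIV_V by (intro borel_measurable_continuous_onI continuous_at_imp_continuous_on ballI DERIV_isCont)

lemma V'_measurable [measurable]: "deriv V \<in> borel_measurable borel"
  using DERIV_V' by (intro borel_measurable_continuous_onI continuous_at_imp_continuous_on ballI DERIV_isCont)

text \<open>\<open>V''\<close> is a pointwise limit of difference quotients of the continuous
  function \<open>V'\<close>; it need not be continuous itself.\<close>

lemma V''_measurable [measurable]: "deriv (deriv V) \<in> borel_measurable borel"
proof (rule borel_measurable_LIMSEQ_real)
  fix x :: real
  have "((\<lambda>h. (deriv V (x + h) - deriv V x) / h) \<longlongrightarrow> deriv (deriv V) x) (at 0)"
    using DERIV_V' by (simp add: DERIV_def)
  moreover have "filterlim (\<lambda>n. 1 / real (Suc n)) (at 0) sequentially"
    unfolding filterlim_at using LIMSEQ_Suc[OF lim_const_over_n[of 1]] by (auto intro: always_eventually)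
  ultimately show "(\<lambda>n. (deriv V (x + 1 / real (Suc n)) - deriv V x) / (1 / real (Suc n))) \<longlonglongrightarrow> deriv (deriv V) x"
    by (rule filterlim_compose)
next
  fix n
  show "(\<lambda>x. (deriv V (x + 1 / real (Suc n)) - deriv V x) / (1 / real (Suc n))) \<in> borel_measurable borel"
    by measurable
qed

text \<open>The remainder \<open>h\<close> vanishes at 0, with nonnegative slope to the right and
  nonpositive slope to the left, by strong monotonicity of \<open>V'\<close>. The quadratic term is
  the source of the Gaussian tails of the single-site density.\<close>

lemma V_quadratic_lower: "V 0 + deriv V 0 * x + Cm / 2 * x\<^sup>2 \<le> V x"
proof -
  define h where "h y = V y - V 0 - deriv V 0 * y - Cm / 2 * y\<^sup>2" for y
  have dh: "(h has_real_derivative deriv V y - deriv V 0 - Cm * y) (at y)" for y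
    unfolding h_def by (auto intro!: derivative_eq_intros DERIV_V)
  have "0 \<le> h x"
  proof (rule linorder_cases[of x 0])
    assume x: "0 < x"
    then obtain z where z: "0 < z" "h x - h 0 = (x - 0) * (deriv V z - deriv V 0 - Cm * z)"
      using MVT2[of 0 x h "\<lambda>y. deriv V y - deriv V 0 - Cm * y"] dh by blast
    have "0 \<le> (x - 0) * (deriv V z - deriv V 0 - Cm * z)"
      using V'_increment(1)[of 0 z] z x by (intro mult_nonneg_nonneg) auto
    then show ?thesis using z by (simp add: h_def)
  next
    assume x: "x < 0"
    then obtain z where z: "z < 0" "h 0 - h x = (0 - x) * (deriv V z - deriv V 0 - Cm * z)"
      using MVT2[of x 0 h "\<lambda>y. deriv V y - deriv V 0 - Cm * y"] dh by blast
    have "(0 - x) * (deriv V z - deriv V 0 - Cm * z) \<le> 0"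
      using V'_increment(1)[of z 0] z x by (intro mult_nonneg_nonpos) auto
    then show ?thesis using z by (simp add: h_def)
  qed (simp add: h_def)
  then show ?thesis by (simp add: h_def)
qed

lemma weight_gaussian_bound:
  obtains A where "0 \<le> A" "\<And>x. exp (- V x + l * x) \<le> A * exp (- (Cm / 4) * x\<^sup>2)"
proof -
  define b where "b = l - deriv V 0"
  have "- V x + l * x \<le> (- V 0 + b\<^sup>2 / Cm) + (- (Cm / 4) * x\<^sup>2)" for x
  proof -
    \<comment> \<open>Completing the square: half of the quadratic coefficient Cm / 2 absorbs the
      linear term, the other half survives as Cm / 4.\<close>
    have "0 \<le> (sqrt Cm / 2 * x - b / sqrt Cm)\<^sup>2" by simp
    also have "\<dots> = Cm / 4 * x\<^sup>2 - b * x + b\<^sup>2 / Cm"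
      using Cm_pos by (simp add: power2_diff power_mult_distrib power_divide)
    finally show ?thesis using V_quadratic_lower[of x] by (simp add: b_def algebra_simps)
  qed
  then have "exp (- V x + l * x) \<le> exp (- V 0 + b\<^sup>2 / Cm) * exp (- (Cm / 4) * x\<^sup>2)" for x
    unfolding exp_add[symmetric] exp_le_cancel_iff .
  then show ?thesis using that by (meson exp_ge_zero)
qed

end

lemma lipschitz_measurable:
  fixes f :: "real \<Rightarrow> real"
  assumes "\<And>x y. \<bar>f x - f y\<bar> \<le> K * \<bar>x - y\<bar>" shows "f \<in> borel_measurable borel"
proof -
  have "0 \<le> K" using assms[of 1 0] by simp
  then have "K-lipschitz_on UNIV f" using assms by (intro lipschitz_onI) (auto simp: dist_real_def)
  then show ?thesis by (intro borel_measurable_continuous_onI lipschitz_on_continuous_on)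
qed

lemma linear_growth_mult:
  fixes u f x :: real
  assumes "\<bar>u\<bar> \<le> a * (1 + \<bar>x\<bar>)" "\<bar>f\<bar> \<le> b * (1 + \<bar>x\<bar>)"
  shows "\<bar>u * f\<bar> \<le> (2 * a * b) * (1 + x\<^sup>2)"
proof -
  have nn: "0 \<le> a" "0 \<le> b" using assms by (smt (verit) mult_neg_pos)+
  have "\<bar>u * f\<bar> \<le> (a * (1 + \<bar>x\<bar>)) * (b * (1 + \<bar>x\<bar>))"
    unfolding abs_mult using assms nn by (intro mult_mono) auto
  also have "\<dots> = (a * b) * (1 + \<bar>x\<bar>)\<^sup>2" by (simp add: power2_eq_square)
  also have "\<dots> \<le> (a * b) * (2 * (1 + x\<^sup>2))"
  proof (intro mult_left_mono)
    have "0 \<le> (\<bar>x\<bar> - 1)\<^sup>2" by simp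
    then show "(1 + \<bar>x\<bar>)\<^sup>2 \<le> 2 * (1 + x\<^sup>2)" by (simp add: power2_eq_square algebra_simps)
  qed (use nn in auto)
  finally show ?thesis by (simp only: ac_simps)
qed

lemma lipschitz_linear_growth:
  fixes f :: "real \<Rightarrow> real"
  assumes "\<And>x y. \<bar>f x - f y\<bar> \<le> K * \<bar>x - y\<bar>" shows "\<bar>f x\<bar> \<le> (\<bar>f 0\<bar> + K) * (1 + \<bar>x\<bar>)"
proof -
  have "\<bar>f x\<bar> \<le> \<bar>f 0\<bar> + K * \<bar>x\<bar>" using assms[of x 0] by simp
  moreover have "0 \<le> \<bar>f 0\<bar> * \<bar>x\<bar>" "0 \<le> K" using assms[of 1 0] by auto
  ultimately show ?thesis by (simp only: distrib_left distrib_right mult_1_right mult_1)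
qed

text \<open>One fixed sequence of steps in (0, 1] serves both the integration by parts and the
  differentiation of the flow, so that the two limits are taken along the very same difference
  quotients.\<close>

definition ibp_step :: "nat \<Rightarrow> real" where "ibp_step n = 1 / real (Suc n)"

lemma ibp_step: "0 < ibp_step n" "ibp_step n \<le> 1" "ibp_step \<longlonglongrightarrow> 0"
  using LIMSEQ_Suc[OF lim_const_over_n[of 1]] by (auto simp: ibp_step_def[abs_def])

lemma integrable_quadratic_gaussian:
  fixes c :: real assumes c: "0 < c"
  shows "integrable lborel (\<lambda>x. (1 + x\<^sup>2) * exp (- c * x\<^sup>2))"
proof -
  define \<sigma> where "\<sigma> = 1 / sqrt (2 * c)"
  have \<sigma>: "0 < \<sigma>" using c by (simp add: \<sigma>_def)
  have e: "exp (- c * x\<^sup>2) = sqrt (2 * pi * \<sigma>\<^sup>2) * normal_density 0 \<sigma> x" for x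
    using c \<sigma> by (simp add: normal_density_def \<sigma>_def power_divide field_simps)
  have eq: "(1 + x\<^sup>2) * exp (- c * x\<^sup>2) = sqrt (2 * pi * \<sigma>\<^sup>2) * (normal_density 0 \<sigma> x * (x - 0) ^ 0)
      + sqrt (2 * pi * \<sigma>\<^sup>2) * (normal_density 0 \<sigma> x * (x - 0) ^ 2)" for x
    unfolding e by (simp add: algebra_simps)
  have "integrable lborel (\<lambda>x. sqrt (2 * pi * \<sigma>\<^sup>2) * (normal_density 0 \<sigma> x * (x - 0) ^ 0)
      + sqrt (2 * pi * \<sigma>\<^sup>2) * (normal_density 0 \<sigma> x * (x - 0) ^ 2))"
    by (intro Bochner_Integration.integrable_add integrable_mult_right integrable_normal_moment \<sigma>)
  then show ?thesis unfolding eq .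
qed

section \<open>Integration by parts and covariance inequalities at one site\<close>

context convex_potential
begin

lemma integrable_weight:
  assumes [measurable]: "f \<in> borel_measurable borel" and f: "\<And>x. \<bar>f x\<bar> \<le> K * (1 + x\<^sup>2)"
  shows "integrable lborel (\<lambda>x. f x * exp (- V x + l * x))"
proof -
  obtain A where A: "0 \<le> A" "\<And>x. exp (- V x + l * x) \<le> A * exp (- (Cm / 4) * x\<^sup>2)"
    using weight_gaussian_bound by blast
  show ?thesis
  proof (rule Bochner_Integration.integrable_bound)
    show "integrable lborel (\<lambda>x. (K * A) * ((1 + x\<^sup>2) * exp (- (Cm / 4) * x\<^sup>2)))"
      using Cm_pos by (intro integrable_mult_right integrable_quadratic_gaussian) simp
    show "AE x in lborel. norm (f x * exp (- V x + l * x)) \<le> norm ((K * A) * ((1 + x\<^sup>2) * exp (- (Cm / 4) * x\<^sup>2)))"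
    proof (rule AE_I2)
      fix x
      have "\<bar>f x\<bar> * exp (- V x + l * x) \<le> (K * (1 + x\<^sup>2)) * (A * exp (- (Cm / 4) * x\<^sup>2))"
        using f[of x] A(2)[of x] by (intro mult_mono) (auto intro: order_trans[OF abs_ge_zero])
      also have "\<dots> \<le> norm ((K * A) * ((1 + x\<^sup>2) * exp (- (Cm / 4) * x\<^sup>2)))"
        unfolding real_norm_def by (rule order_trans[OF eq_refl abs_ge_self]) (simp only: ac_simps)
      finally show "norm (f x * exp (- V x + l * x)) \<le> norm ((K * A) * ((1 + x\<^sup>2) * exp (- (Cm / 4) * x\<^sup>2)))"
        by (simp add: abs_mult)
    qed
  qed measurable
qed

definition partition :: "real \<Rightarrow> real" where
  "partition l = (LINT y|lborel. exp (- V y + l * y))"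

lemma partition_pos: "0 < partition l"
proof -
  have int: "integrable lborel (\<lambda>x. exp (- V x + l * x))"
    using integrable_weight[of "\<lambda>_. 1" 1 l] by simp
  have "\<not> (AE x in lborel. exp (- V x + l * x) = 0)"
    using AE_iff_measurable[of UNIV lborel "\<lambda>_. False"] by simp
  then have "partition l \<noteq> 0"
    unfolding partition_def by (subst integral_nonneg_eq_0_iff_AE[OF int]) auto
  moreover have "0 \<le> partition l" unfolding partition_def by (intro integral_nonneg_AE AE_I2) simp
  ultimately show ?thesis by simp
qed

lemma site_measure_eq: "site_measure V l = density lborel (\<lambda>x. ennreal (exp (- V x + l * x) / partition l))"
  by (simp add: site_measure_def partition_def)

lemma sets_site [measurable_cong, simp]: "sets (site_measure V l) = sets borel"
  and space_site [simp]: "space (site_measure V l) = UNIV"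
  by (simp_all add: site_measure_def)

lemma integral_site:
  assumes [measurable]: "f \<in> borel_measurable borel"
  shows "(LINT x|site_measure V l. f x) = (LINT x|lborel. f x * exp (- V x + l * x)) / partition l"
proof -
  have "(LINT x|site_measure V l. f x) = (LINT x|lborel. (exp (- V x + l * x) / partition l) *\<^sub>R f x)"
    unfolding site_measure_eq using partition_pos[of l] by (subst integral_density) auto
  also have "\<dots> = (LINT x|lborel. f x * exp (- V x + l * x) / partition l)"
    by (rule Bochner_Integration.integral_cong) auto
  finally show ?thesis by simp
qed

lemma integrable_site:
  assumes [measurable]: "f \<in> borel_measurable borel" and f: "\<And>x. \<bar>f x\<bar> \<le> K * (1 + x\<^sup>2)"
  shows "integrable (site_measure V l) f"
proof -
  have "integrable lborel (\<lambda>x. f x * exp (- V x + l * x) / partition l)"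
    using integrable_weight[OF assms, of l] by (rule integrable_divide)
  then show ?thesis
    unfolding site_measure_eq using partition_pos[of l]
    by (subst integrable_density) (auto simp: mult.commute)
qed

sublocale site: prob_space "site_measure V l" for l
proof
  have "emeasure (site_measure V l) UNIV = (\<integral>\<^sup>+x. ennreal (exp (- V x + l * x) / partition l) \<partial>lborel)"
    unfolding site_measure_eq by (subst emeasure_density) auto
  also have "\<dots> = ennreal (LINT x|lborel. exp (- V x + l * x) / partition l)"
    using integrable_weight[of "\<lambda>_. 1" 1 l] partition_pos[of l] by (intro nn_integral_eq_integral) auto
  also have "(LINT x|lborel. exp (- V x + l * x) / partition l) = 1"
    using partition_pos[of l] by (simp add: partition_def)
  finally show "emeasure (site_measure V l) (space (site_measure V l)) = 1" by simp
qed

lemma prob_site_UNIV [simp]: "measure (site_measure V l) UNIV = 1"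
  using site.prob_space[of l] by simp

text \<open>Majorant for the difference quotients of the density, uniform over steps
  \<open>h\<close> at most 1. The mean value point lies within distance 1 of \<open>x\<close>;
  trading it for \<open>x\<close> halves the Gaussian rate, from Cm / 4 to Cm / 8, and costs a
  constant factor.\<close>

lemma weight_quotient_bound:
  obtains A where "\<And>x h. 0 < h \<Longrightarrow> h \<le> 1 \<Longrightarrow>
    \<bar>(exp (- V x + l * x) - exp (- V (x + h) + l * (x + h))) / h\<bar> \<le> A * ((1 + \<bar>x\<bar>) * exp (- (Cm / 8) * x\<^sup>2))"
proof -
  obtain A where A: "0 \<le> A" "\<And>x. exp (- V x + l * x) \<le> A * exp (- (Cm / 4) * x\<^sup>2)"
    using weight_gaussian_bound by blast
  define b where "b = \<bar>deriv V 0\<bar> + \<bar>l\<bar> + 2 * Cp"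
  have "\<bar>(exp (- V x + l * x) - exp (- V (x + h) + l * (x + h))) / h\<bar>
      \<le> (b * A * exp (Cm / 4)) * ((1 + \<bar>x\<bar>) * exp (- (Cm / 8) * x\<^sup>2))" if h: "0 < h" "h \<le> 1" for x h
  proof -
    have "((\<lambda>y. exp (- V y + l * y)) has_real_derivative exp (- V y + l * y) * (- deriv V y + l)) (at y)" for y
      by (auto intro!: derivative_eq_intros DERIV_V)
    then obtain y where y: "x < y" "y < x + h" and
      e: "exp (- V (x + h) + l * (x + h)) - exp (- V x + l * x) = ((x + h) - x) * (exp (- V y + l * y) * (- deriv V y + l))"
      using MVT2[of x "x + h" "\<lambda>y. exp (- V y + l * y)" "\<lambda>y. exp (- V y + l * y) * (- deriv V y + l)"] h by auto
    have "(exp (- V x + l * x) - exp (- V (x + h) + l * (x + h))) / h = - (exp (- V y + l * y) * (- deriv V y + l))"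
      using e h by (simp add: field_simps)
    then have "\<bar>(exp (- V x + l * x) - exp (- V (x + h) + l * (x + h))) / h\<bar> = \<bar>l - deriv V y\<bar> * exp (- V y + l * y)"
      by (simp add: abs_mult)
    also have "\<dots> \<le> (b * (1 + \<bar>x\<bar>)) * (A * (exp (Cm / 4) * exp (- (Cm / 8) * x\<^sup>2)))"
    proof (intro mult_mono)
      have "\<bar>l - deriv V y\<bar> \<le> \<bar>l\<bar> + \<bar>deriv V 0\<bar> + Cp * \<bar>y\<bar>"
        using V'_lipschitz[of y 0] by auto
      moreover have "Cp * \<bar>y\<bar> \<le> Cp * (1 + \<bar>x\<bar>)"
        using y h Cp_pos by (intro mult_left_mono) auto
      moreover have "0 \<le> (\<bar>l\<bar> + \<bar>deriv V 0\<bar>) * \<bar>x\<bar>" "0 \<le> Cp * (1 + \<bar>x\<bar>)" using Cp_pos by auto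
      moreover have "b * (1 + \<bar>x\<bar>) = (\<bar>l\<bar> + \<bar>deriv V 0\<bar>) + (\<bar>l\<bar> + \<bar>deriv V 0\<bar>) * \<bar>x\<bar> + 2 * (Cp * (1 + \<bar>x\<bar>))"
        by (simp add: b_def algebra_simps)
      ultimately show "\<bar>l - deriv V y\<bar> \<le> b * (1 + \<bar>x\<bar>)" by linarith
      have "x\<^sup>2 \<le> 2 * y\<^sup>2 + 2"
      proof -
        have "(x - y)\<^sup>2 \<le> 1" unfolding abs_square_le_1 using y h by auto
        moreover have "0 \<le> (x - 2 * y)\<^sup>2" by simp
        ultimately show ?thesis by (simp add: power2_eq_square algebra_simps)
      qed
      then have "Cm / 8 * x\<^sup>2 \<le> Cm / 8 * (2 * y\<^sup>2 + 2)" using Cm_pos by (intro mult_left_mono) auto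
      then have "exp (- (Cm / 4) * y\<^sup>2) \<le> exp (Cm / 4 + (- (Cm / 8) * x\<^sup>2))"
        by (simp add: algebra_simps)
      then show "exp (- V y + l * y) \<le> A * (exp (Cm / 4) * exp (- (Cm / 8) * x\<^sup>2))"
        unfolding exp_add[symmetric] by (rule order_trans[OF A(2) mult_left_mono[OF _ A(1)]])
    qed (use Cp_pos in \<open>auto simp: b_def\<close>)
    finally show ?thesis by (simp add: ac_simps)
  qed
  then show ?thesis using that by blast
qed

text \<open>Integration by parts against the density, with the derivative replaced by difference quotients:
  translation invariance moves the quotient onto the density.\<close>

lemma site_ibp:
  assumes f: "\<And>x y. \<bar>f x - f y\<bar> \<le> K * \<bar>x - y\<bar>"
  shows "(\<lambda>n. LINT x|site_measure V l. (f x - f (x - ibp_step n)) / ibp_step n)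
    \<longlonglongrightarrow> (LINT x|site_measure V l. (deriv V x - l) * f x)"
proof -
  have [measurable]: "f \<in> borel_measurable borel" by (rule lipschitz_measurable[OF f])
  have K: "0 \<le> K" using f[of 1 0] by simp
  define p where "p x = exp (- V x + l * x)" for x
  have [measurable]: "p \<in> borel_measurable borel" unfolding p_def by measurable
  have fb: "\<bar>f x\<bar> \<le> (\<bar>f 0\<bar> + K) * (1 + \<bar>x\<bar>)" for x
  proof -
    have "\<bar>f x\<bar> \<le> \<bar>f 0\<bar> + K * \<bar>x\<bar>" using f[of x 0] by simp
    moreover have "0 \<le> \<bar>f 0\<bar> * \<bar>x\<bar>" by simp
    ultimately show ?thesis using K by (simp only: distrib_left distrib_right mult_1_right mult_1)
  qed
  have sq: "(1 + \<bar>x\<bar>) \<le> 2 * (1 + x\<^sup>2)" "(1 + \<bar>x\<bar>) * (1 + \<bar>x\<bar>) \<le> 2 * (1 + x\<^sup>2)" for x :: real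
  proof -
    have "0 \<le> (\<bar>x\<bar> - 1)\<^sup>2" by simp
    then show "(1 + \<bar>x\<bar>) * (1 + \<bar>x\<bar>) \<le> 2 * (1 + x\<^sup>2)" by (simp add: power2_eq_square algebra_simps)
    then show "(1 + \<bar>x\<bar>) \<le> 2 * (1 + x\<^sup>2)" 
      using mult_left_mono[of 1 "1 + \<bar>x\<bar>" "1 + \<bar>x\<bar>"] by simp
  qed
  obtain A where A: "\<And>x h. 0 < h \<Longrightarrow> h \<le> 1 \<Longrightarrow> \<bar>(p x - p (x + h)) / h\<bar> \<le> A * ((1 + \<bar>x\<bar>) * exp (- (Cm / 8) * x\<^sup>2))"
    using weight_quotient_bound[of l] unfolding p_def by blast
  have fp: "integrable lborel (\<lambda>x. f x * p x)"
    unfolding p_def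
  proof (rule integrable_weight[where K = "(\<bar>f 0\<bar> + K) * 2"])
    show "\<bar>f x\<bar> \<le> (\<bar>f 0\<bar> + K) * 2 * (1 + x\<^sup>2)" for x
      unfolding mult.assoc using K by (intro order_trans[OF fb] mult_left_mono sq) auto
  qed simp
  have shift: "integrable lborel (\<lambda>x. f (x - h) * p x)" "integrable lborel (\<lambda>x. f x * p (x + h))"
    "(LINT x|lborel. f (x - h) * p x) = (LINT x|lborel. f x * p (x + h))" if "0 < h" for h
  proof -
    show 1: "integrable lborel (\<lambda>x. f (x - h) * p x)"
      unfolding p_def
    proof (rule integrable_weight[where K = "\<bar>K * h\<bar> + (\<bar>f 0\<bar> + K) * 2"])
      fix x
      have "\<bar>f (x - h)\<bar> \<le> K * h + \<bar>f x\<bar>" using f[of "x - h" x] that by auto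
      moreover have "\<bar>K * h\<bar> * 1 \<le> \<bar>K * h\<bar> * (1 + x\<^sup>2)" by (intro mult_left_mono) auto
      ultimately show "\<bar>f (x - h)\<bar> \<le> (\<bar>K * h\<bar> + (\<bar>f 0\<bar> + K) * 2) * (1 + x\<^sup>2)"
        using fb[of x] mult_left_mono[OF sq(1)[of x], of "\<bar>f 0\<bar> + K"] K
        by (simp only: distrib_right[of "\<bar>K * h\<bar>"]) linarith
    qed simp
    show "integrable lborel (\<lambda>x. f x * p (x + h))"
      using lborel_integrable_real_affine[OF 1, of 1 h] by (simp add: add.commute)
    show "(LINT x|lborel. f (x - h) * p x) = (LINT x|lborel. f x * p (x + h))"
      using lborel_integral_real_affine[of 1 "\<lambda>x. f (x - h) * p x" h] by (simp add: add.commute)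
  qed
  have q: "(LINT x|site_measure V l. (f x - f (x - ibp_step n)) / ibp_step n)
      = (LINT x|lborel. f x * ((p x - p (x + ibp_step n)) / ibp_step n)) / partition l" for n
  proof -
    let ?h = "ibp_step n"
    have h: "0 < ?h" by (rule ibp_step)
    have "(LINT x|lborel. (f x - f (x - ?h)) / ?h * p x) = (LINT x|lborel. (f x * p x - f (x - ?h) * p x) / ?h)"
      by (rule Bochner_Integration.integral_cong) (auto simp: field_simps)
    also have "\<dots> = ((LINT x|lborel. f x * p x) - (LINT x|lborel. f x * p (x + ?h))) / ?h"
      using fp shift[OF h] by simp
    also have "\<dots> = (LINT x|lborel. (f x * p x - f x * p (x + ?h)) / ?h)"
      using fp shift[OF h] by simp
    also have "\<dots> = (LINT x|lborel. f x * ((p x - p (x + ?h)) / ?h))"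
      by (rule Bochner_Integration.integral_cong) (auto simp: field_simps)
    finally show ?thesis by (subst integral_site) (auto simp: p_def)
  qed
  have "(\<lambda>n. LINT x|lborel. f x * ((p x - p (x + ibp_step n)) / ibp_step n))
      \<longlonglongrightarrow> (LINT x|lborel. f x * ((deriv V x - l) * p x))"
  proof (rule integral_dominated_convergence[where w = "\<lambda>x. ((\<bar>f 0\<bar> + K) * \<bar>A\<bar> * 2) * ((1 + x\<^sup>2) * exp (- (Cm / 8) * x\<^sup>2))"])
    show "integrable lborel (\<lambda>x. ((\<bar>f 0\<bar> + K) * \<bar>A\<bar> * 2) * ((1 + x\<^sup>2) * exp (- (Cm / 8) * x\<^sup>2)))"
      using Cm_pos by (intro integrable_mult_right integrable_quadratic_gaussian) simp
    show "AE x in lborel. (\<lambda>n. f x * ((p x - p (x + ibp_step n)) / ibp_step n)) \<longlonglongrightarrow> f x * ((deriv V x - l) * p x)"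
    proof (intro AE_I2 tendsto_mult_left)
      fix x
      have "(p has_real_derivative p x * (- deriv V x + l)) (at x)"
        unfolding p_def by (auto intro!: derivative_eq_intros DERIV_V)
      then have "((\<lambda>h. (p (x + h) - p x) / h) \<longlongrightarrow> p x * (- deriv V x + l)) (at 0)"
        by (simp add: DERIV_def)
      moreover have "filterlim ibp_step (at 0) sequentially"
        unfolding filterlim_at using ibp_step by (auto intro!: always_eventually simp: less_imp_neq[THEN not_sym])
      ultimately have "(\<lambda>n. (p (x + ibp_step n) - p x) / ibp_step n) \<longlonglongrightarrow> p x * (- deriv V x + l)"
        by (rule filterlim_compose)
      from tendsto_minus[OF this]
      show "(\<lambda>n. (p x - p (x + ibp_step n)) / ibp_step n) \<longlonglongrightarrow> (deriv V x - l) * p x"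
        by (simp add: minus_divide_left algebra_simps)
    qed
    show "AE x in lborel. norm (f x * ((p x - p (x + ibp_step n)) / ibp_step n))
        \<le> ((\<bar>f 0\<bar> + K) * \<bar>A\<bar> * 2) * ((1 + x\<^sup>2) * exp (- (Cm / 8) * x\<^sup>2))" for n
    proof (rule AE_I2)
      fix x
      have "\<bar>f x\<bar> * \<bar>(p x - p (x + ibp_step n)) / ibp_step n\<bar>
          \<le> ((\<bar>f 0\<bar> + K) * (1 + \<bar>x\<bar>)) * (\<bar>A\<bar> * ((1 + \<bar>x\<bar>) * exp (- (Cm / 8) * x\<^sup>2)))"
      proof (intro mult_mono fb)
        show "\<bar>(p x - p (x + ibp_step n)) / ibp_step n\<bar> \<le> \<bar>A\<bar> * ((1 + \<bar>x\<bar>) * exp (- (Cm / 8) * x\<^sup>2))"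
          by (rule order_trans[OF A[OF ibp_step(1,2)]]) (intro mult_right_mono, auto)
      qed (use K in auto)
      also have "\<dots> = ((\<bar>f 0\<bar> + K) * \<bar>A\<bar>) * exp (- (Cm / 8) * x\<^sup>2) * ((1 + \<bar>x\<bar>) * (1 + \<bar>x\<bar>))"
        by (simp only: ac_simps)
      also have "\<dots> \<le> ((\<bar>f 0\<bar> + K) * \<bar>A\<bar>) * exp (- (Cm / 8) * x\<^sup>2) * (2 * (1 + x\<^sup>2))"
        using K by (intro mult_left_mono sq) auto
      also have "\<dots> = ((\<bar>f 0\<bar> + K) * \<bar>A\<bar> * 2) * ((1 + x\<^sup>2) * exp (- (Cm / 8) * x\<^sup>2))"
        by (simp only: ac_simps)
      finally show "norm (f x * ((p x - p (x + ibp_step n)) / ibp_step n))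
        \<le> ((\<bar>f 0\<bar> + K) * \<bar>A\<bar> * 2) * ((1 + x\<^sup>2) * exp (- (Cm / 8) * x\<^sup>2))"
        by (simp only: real_norm_def abs_mult)
    qed
  qed measurable
  then have "(\<lambda>n. (LINT x|lborel. f x * ((p x - p (x + ibp_step n)) / ibp_step n)) / partition l)
      \<longlonglongrightarrow> (LINT x|lborel. f x * ((deriv V x - l) * p x)) / partition l"
    by (rule tendsto_divide) (use partition_pos[of l] in auto)
  moreover have "(LINT x|lborel. f x * ((deriv V x - l) * p x)) / partition l = (LINT x|site_measure V l. (deriv V x - l) * f x)"
    by (subst integral_site) (auto simp: p_def ac_simps)
  ultimately show ?thesis by (simp only: q)
qed

lemma integrable_site_lipschitz_mult:
  fixes u f :: "real \<Rightarrow> real"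
  assumes u: "\<And>x y. \<bar>u x - u y\<bar> \<le> K' * \<bar>x - y\<bar>" and f: "\<And>x y. \<bar>f x - f y\<bar> \<le> K * \<bar>x - y\<bar>"
  shows "integrable (site_measure V l) (\<lambda>x. u x * f x)"
  using lipschitz_measurable[OF u] lipschitz_measurable[OF f]
    linear_growth_mult[OF lipschitz_linear_growth[OF u] lipschitz_linear_growth[OF f]]
  by (intro integrable_site) auto

lemma integrable_site_lipschitz:
  fixes f :: "real \<Rightarrow> real"
  assumes f: "\<And>x y. \<bar>f x - f y\<bar> \<le> K * \<bar>x - y\<bar>"
  shows "integrable (site_measure V l) f"
  using integrable_site_lipschitz_mult[of "\<lambda>_. 1" 0 f K l] f by simp

text \<open>Integration by parts against a constant function. The identity is what centres
  \<open>V'\<close> in the covariance comparison.\<close>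

lemma site_mean_V': "(LINT x|site_measure V l. deriv V x) = l"
proof -
  have "(\<lambda>n::nat. 0::real) \<longlonglongrightarrow> (LINT x|site_measure V l. (deriv V x - l))"
    using site_ibp[of "\<lambda>_. 1" 0 l] by simp
  then have "(LINT x|site_measure V l. (deriv V x - l)) = 0"
    using LIMSEQ_unique tendsto_const by metis
  then show ?thesis
    using integrable_site_lipschitz[OF V'_lipschitz, of l] by (simp add: site.prob_space)
qed

text \<open>Both \<open>x - V' x / C\<^sub>+\<close> and \<open>V' x / C\<^sub>- - x\<close> are nondecreasing, so Chebyshev's association
  inequality compares the covariance with \<open>x\<close> to the covariance with \<open>V'\<close>.\<close>

lemma site_covariance_bounds:
  fixes f :: "real \<Rightarrow> real" and l :: real
  assumes mono: "\<And>x y. x \<le> y \<Longrightarrow> f x \<le> f y" and f: "\<And>x y. \<bar>f x - f y\<bar> \<le> K * \<bar>x - y\<bar>"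
  defines "m \<equiv> (LINT x|site_measure V l. x)"
  shows "1 / Cp * (LINT x|site_measure V l. (deriv V x - l) * f x) \<le> (LINT x|site_measure V l. (x - m) * f x)"
    and "(LINT x|site_measure V l. (x - m) * f x) \<le> 1 / Cm * (LINT x|site_measure V l. (deriv V x - l) * f x)"
proof -
  have x: "\<And>x y :: real. \<bar>x - y\<bar> \<le> 1 * \<bar>x - y\<bar>" by simp
  note [simp] = integrable_site_lipschitz[OF f, of l] integrable_site_lipschitz[OF x, of l]
    integrable_site_lipschitz[OF V'_lipschitz, of l] integrable_site_lipschitz_mult[OF x f, of l]
    integrable_site_lipschitz_mult[OF V'_lipschitz f, of l]
  let ?E = "\<lambda>g. LINT x|site_measure V l. g x"
  have split: "?E (\<lambda>x. (deriv V x - l) * f x) = ?E (\<lambda>x. deriv V x * f x) - l * ?E f"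
    "?E (\<lambda>x. (x - m) * f x) = ?E (\<lambda>x. x * f x) - m * ?E f"
    by (simp_all add: left_diff_distrib)
  have comono: "0 \<le> (u x - u y) * (f x - f y)" if "\<And>x y. x \<le> y \<Longrightarrow> u x \<le> u y" for u :: "real \<Rightarrow> real" and x y
  proof (cases "x \<le> y")
    case True
    then show ?thesis using that mono by (intro mult_nonpos_nonpos) auto
  next
    case False
    then show ?thesis using that[of y x] mono[of y x] by (intro mult_nonneg_nonneg) auto
  qed
  have 1: "(m - l / Cp) * ?E f \<le> ?E (\<lambda>x. x * f x) - ?E (\<lambda>x. deriv V x * f x) / Cp"
  proof -
    have "?E (\<lambda>x. x - deriv V x / Cp) * ?E f \<le> ?E (\<lambda>x. (x - deriv V x / Cp) * f x)"
    proof (rule site.expectation_mult_ge_if_comonotone[OF comono])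
      show "x - deriv V x / Cp \<le> y - deriv V y / Cp" if "x \<le> y" for x y
      proof -
        have "(deriv V y - deriv V x) / Cp \<le> y - x"
          using V'_increment(2)[OF that] Cp_pos by (simp add: pos_divide_le_eq mult.commute)
        then show ?thesis by (simp add: diff_divide_distrib)
      qed
    qed (simp_all add: left_diff_distrib)
    then show ?thesis by (simp add: left_diff_distrib site_mean_V' m_def)
  qed
  have 2: "(l / Cm - m) * ?E f \<le> ?E (\<lambda>x. deriv V x * f x) / Cm - ?E (\<lambda>x. x * f x)"
  proof -
    have "?E (\<lambda>x. deriv V x / Cm - x) * ?E f \<le> ?E (\<lambda>x. (deriv V x / Cm - x) * f x)"
    proof (rule site.expectation_mult_ge_if_comonotone[OF comono])
      show "deriv V x / Cm - x \<le> deriv V y / Cm - y" if "x \<le> y" for x y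
      proof -
        have "y - x \<le> (deriv V y - deriv V x) / Cm"
          using V'_increment(1)[OF that] Cm_pos by (simp add: pos_le_divide_eq mult.commute)
        then show ?thesis by (simp add: diff_divide_distrib)
      qed
    qed (simp_all add: left_diff_distrib)
    then show ?thesis by (simp add: left_diff_distrib site_mean_V' m_def)
  qed
  show "1 / Cp * ?E (\<lambda>x. (deriv V x - l) * f x) \<le> ?E (\<lambda>x. (x - m) * f x)"
    using 1 unfolding split by (simp add: algebra_simps diff_divide_distrib)
  show "?E (\<lambda>x. (x - m) * f x) \<le> 1 / Cm * ?E (\<lambda>x. (deriv V x - l) * f x)"
    using 2 unfolding split by (simp add: algebra_simps diff_divide_distrib)
qed

end

section \<open>The walk in a given environment\<close>

text \<open>The added 1 places the dyadic approximation strictly above \<open>t\<close>, so a path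
  with jumps is read through its limits from the right.\<close>

lemma filterlim_dyadic_at_right:
  fixes t :: real
  shows "filterlim (\<lambda>n. (real_of_int \<lfloor>t * 2 ^ n\<rfloor> + 1) / 2 ^ n) (at_right t) sequentially"
proof (rule tendsto_imp_filterlim_at_right)
  have lo: "t < (real_of_int \<lfloor>t * 2 ^ n\<rfloor> + 1) / 2 ^ n" for n :: nat
    by (simp add: pos_less_divide_eq)
  have hi: "(real_of_int \<lfloor>t * 2 ^ n\<rfloor> + 1) / 2 ^ n \<le> t + (1 / 2) ^ n" for n :: nat
  proof -
    have "(real_of_int \<lfloor>t * 2 ^ n\<rfloor> + 1) / 2 ^ n \<le> (t * 2 ^ n + 1) / 2 ^ n"
      by (intro divide_right_mono) auto
    also have "\<dots> = t + (1 / 2) ^ n" by (simp add: add_divide_distrib power_one_over)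
    finally show ?thesis .
  qed
  show "\<forall>\<^sub>F n in sequentially. t < (real_of_int \<lfloor>t * 2 ^ n\<rfloor> + 1) / 2 ^ n"
    using lo by simp
  have lim: "(\<lambda>n. t + (1 / 2) ^ n) \<longlonglongrightarrow> t + 0"
    by (intro tendsto_add tendsto_const LIMSEQ_power_zero) simp
  show "(\<lambda>n. (real_of_int \<lfloor>t * 2 ^ n\<rfloor> + 1) / 2 ^ n) \<longlonglongrightarrow> t"
    by (rule tendsto_sandwich[OF always_eventually always_eventually tendsto_const lim[simplified]])
      (use lo hi less_imp_le in blast)+
qed

text \<open>For each dyadic level the approximation takes countably many times, and right continuity
  passes to the limit. Negative times are folded to 0, so that the second coordinate ranges over the
  whole line; integrals over {0..t} are unaffected.\<close>

lemma right_continuous_jointly_measurable: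
  fixes Y :: "real \<Rightarrow> 'a \<Rightarrow> real"
  assumes meas: "\<And>t. 0 \<le> t \<Longrightarrow> Y t \<in> borel_measurable M"
    and rc: "\<And>\<omega> t. \<omega> \<in> space M \<Longrightarrow> 0 \<le> t \<Longrightarrow> ((\<lambda>s. Y s \<omega>) \<longlongrightarrow> Y t \<omega>) (at_right t)"
  shows "(\<lambda>(\<omega>, s). Y (max 0 s) \<omega>) \<in> borel_measurable (M \<Otimes>\<^sub>M borel)"
proof (rule borel_measurable_LIMSEQ_real)
  fix n :: nat
  have "(\<lambda>x. Y (max 0 ((real_of_int k + 1) / 2 ^ n)) (fst x)) \<in> borel_measurable (M \<Otimes>\<^sub>M (borel :: real measure))" for k
    by (rule measurable_compose[OF measurable_fst meas]) simp
  moreover have "(\<lambda>x. \<lfloor>max 0 (snd x) * 2 ^ n\<rfloor>) \<in> measurable (M \<Otimes>\<^sub>M (borel :: real measure)) (count_space UNIV)"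
    by measurable
  ultimately have "(\<lambda>x. Y (max 0 ((real_of_int \<lfloor>max 0 (snd x) * 2 ^ n\<rfloor> + 1) / 2 ^ n)) (fst x)) \<in> borel_measurable (M \<Otimes>\<^sub>M (borel :: real measure))"
    by (rule measurable_compose_countable)
  then show "(\<lambda>(\<omega>, s :: real). Y (max 0 ((real_of_int \<lfloor>max 0 s * 2 ^ n\<rfloor> + 1) / 2 ^ n)) \<omega>) \<in> borel_measurable (M \<Otimes>\<^sub>M borel)"
    by (simp add: case_prod_beta')
next
  fix x :: "'a \<times> real" assume x: "x \<in> space (M \<Otimes>\<^sub>M borel)"
  obtain \<omega> s where [simp]: "x = (\<omega>, s)" by (cases x)
  have w: "\<omega> \<in> space M" using x by (simp add: space_pair_measure)
  have "(\<lambda>n. Y ((real_of_int \<lfloor>max 0 s * 2 ^ n\<rfloor> + 1) / 2 ^ n) \<omega>) \<longlonglongrightarrow> Y (max 0 s) \<omega>"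
    by (rule filterlim_compose[OF rc[OF w] filterlim_dyadic_at_right]) simp
  moreover have "max 0 ((real_of_int \<lfloor>max 0 s * 2 ^ n\<rfloor> + 1) / 2 ^ n) = (real_of_int \<lfloor>max 0 s * 2 ^ n\<rfloor> + 1) / 2 ^ n" for n :: nat
    by (intro max_absorb2 divide_nonneg_nonneg add_nonneg_nonneg) auto
  ultimately show "(\<lambda>n. case x of (\<omega>, s) \<Rightarrow> Y (max 0 ((real_of_int \<lfloor>max 0 s * 2 ^ n\<rfloor> + 1) / 2 ^ n)) \<omega>)
      \<longlonglongrightarrow> (case x of (\<omega>, s) \<Rightarrow> Y (max 0 s) \<omega>)"
    by simp
qed

text \<open>Measurability in the random parameter is proved for the iterates and inherited by their
  limits; this is one reason why the flow and its derivative are built as limits of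
  \<open>pic\<close>.\<close>

lemma pic_jointly_measurable:
  assumes G: "\<And>x i. (\<And>j. (\<lambda>(\<omega>, s). x \<omega> s j) \<in> borel_measurable (N \<Otimes>\<^sub>M borel)) \<Longrightarrow>
      (\<lambda>(\<omega>, s). G \<omega> s (x \<omega> s) i) \<in> borel_measurable (N \<Otimes>\<^sub>M borel)"
    and v: "\<And>i. (\<lambda>(\<omega>, s). v \<omega> s i) \<in> borel_measurable (N \<Otimes>\<^sub>M borel)"
  shows "(\<lambda>(\<omega>, t). pic (G \<omega>) (v \<omega>) n t i) \<in> borel_measurable (N \<Otimes>\<^sub>M borel)"
proof (induction n arbitrary: i)
  case (Suc n)
  note [measurable] = v
  have g: "(\<lambda>(\<omega>, s). G \<omega> s (pic (G \<omega>) (v \<omega>) n s) i) \<in> borel_measurable (N \<Otimes>\<^sub>M borel)"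
    by (rule G[OF Suc])
  have "(\<lambda>z. (fst (fst z), snd z)) \<in> ((N \<Otimes>\<^sub>M borel) \<Otimes>\<^sub>M borel) \<rightarrow>\<^sub>M (N \<Otimes>\<^sub>M borel)" by measurable
  from measurable_compose[OF this g]
  have "(\<lambda>(z, s). G (fst z) s (pic (G (fst z)) (v (fst z)) n s) i) \<in> borel_measurable ((N \<Otimes>\<^sub>M borel) \<Otimes>\<^sub>M borel)"
    by (simp add: case_prod_beta')
  then have "(\<lambda>z. LBINT s:{0..snd z}. G (fst z) s (pic (G (fst z)) (v (fst z)) n s) i) \<in> borel_measurable (N \<Otimes>\<^sub>M borel)"
    by (rule borel_measurable_set_integral_Icc) simp
  then have "(\<lambda>z. v (fst z) (snd z) i + (LBINT s:{0..snd z}. G (fst z) s (pic (G (fst z)) (v (fst z)) n s) i))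
      \<in> borel_measurable (N \<Otimes>\<^sub>M borel)"
    using v[of i] by (intro borel_measurable_add) (simp_all add: case_prod_beta')
  then show ?case by (simp add: case_prod_beta')
qed simp

lemma pic_cong:
  assumes "\<And>s. 0 \<le> s \<Longrightarrow> s \<le> T \<Longrightarrow> G s = G' s" "\<And>s. 0 \<le> s \<Longrightarrow> s \<le> T \<Longrightarrow> v s = v' s"
    and "0 \<le> t" "t \<le> T"
  shows "pic G v n t i = pic G' v' n t i"
  using assms(3,4)
proof (induction n arbitrary: t i)
  case (Suc n)
  have "pic G v n s = pic G' v' n s" if "0 \<le> s" "s \<le> t" for s
    using Suc.IH[of s] Suc.prems that by (intro ext) auto
  then have "(LBINT s:{0..t}. G s (pic G v n s) i) = (LBINT s:{0..t}. G' s (pic G' v' n s) i)"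
    using assms(1) Suc.prems by (intro set_lebesgue_integral_cong) auto
  then show ?case using assms(2)[of t] Suc.prems by simp
qed simp

text \<open>Linearisation of the Ginzburg-Landau drift: the discrete Laplacian of A x, where
  \<open>A\<close> stands for \<open>V''\<close> along a path or for secant slopes of
  \<open>V'\<close>.\<close>

definition site_drift :: "(real \<Rightarrow> int \<Rightarrow> real) \<Rightarrow> real \<Rightarrow> (int \<Rightarrow> real) \<Rightarrow> int \<Rightarrow> real" where
  "site_drift A s x i = A s (i + 1) * x (i + 1) + A s (i - 1) * x (i - 1) - 2 * (A s i * x i)"

text \<open>The walk crosses site i + 1 at rate \<open>A s (i + 1)\<close> in either direction, so
  its generator is symmetric and the forward equation for its law has the generator itself as drift.
  Iterates started from \<open>unit_at a\<close> approximate the transition probabilities out of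
  bond \<open>a\<close>.\<close>

definition bond_drift :: "(real \<Rightarrow> int \<Rightarrow> real) \<Rightarrow> real \<Rightarrow> (int \<Rightarrow> real) \<Rightarrow> int \<Rightarrow> real" where
  "bond_drift A s x i = A s (i + 1) * (x (i + 1) - x i) + A s i * (x (i - 1) - x i)"

lemma near_drift_site:
  assumes C: "0 \<le> C" and A: "\<And>s i. 0 \<le> A s i" "\<And>s i. A s i \<le> C" and m: "\<And>i. (\<lambda>s. A s i) \<in> borel_measurable borel"
  shows "near_drift C (site_drift A)"
proof
  fix s x y i
  have b: "\<bar>A s j * z\<bar> \<le> C * \<bar>z\<bar>" for j z
    unfolding abs_mult using A[of s j] by (intro mult_right_mono) auto
  have "site_drift A s x i - site_drift A s y i
      = A s (i + 1) * (x (i + 1) - y (i + 1)) + A s (i - 1) * (x (i - 1) - y (i - 1)) - 2 * (A s i * (x i - y i))"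
    by (simp add: site_drift_def algebra_simps)
  then show "\<bar>site_drift A s x i - site_drift A s y i\<bar>
      \<le> C * (\<bar>x (i + 1) - y (i + 1)\<bar> + \<bar>x (i - 1) - y (i - 1)\<bar> + 2 * \<bar>x i - y i\<bar>)"
    using b[of "i + 1" "x (i + 1) - y (i + 1)"] b[of "i - 1" "x (i - 1) - y (i - 1)"] b[of i "x i - y i"]
    unfolding distrib_left by linarith
qed (use C m in \<open>auto simp: site_drift_def intro!: borel_measurable_diff borel_measurable_add borel_measurable_times\<close>)

lemma near_drift_bond:
  assumes C: "0 \<le> C" and A: "\<And>s i. 0 \<le> A s i" "\<And>s i. A s i \<le> C" and m: "\<And>i. (\<lambda>s. A s i) \<in> borel_measurable borel"
  shows "near_drift C (bond_drift A)"
proof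
  fix s x y i
  have b: "\<bar>A s j * z\<bar> \<le> C * \<bar>z\<bar>" for j z
    unfolding abs_mult using A[of s j] by (intro mult_right_mono) auto
  have "bond_drift A s x i - bond_drift A s y i
      = A s (i + 1) * (x (i + 1) - y (i + 1)) - A s (i + 1) * (x i - y i)
        + A s i * (x (i - 1) - y (i - 1)) - A s i * (x i - y i)"
    by (simp add: bond_drift_def algebra_simps)
  then show "\<bar>bond_drift A s x i - bond_drift A s y i\<bar>
      \<le> C * (\<bar>x (i + 1) - y (i + 1)\<bar> + \<bar>x (i - 1) - y (i - 1)\<bar> + 2 * \<bar>x i - y i\<bar>)"
    using b[of "i + 1" "x (i + 1) - y (i + 1)"] b[of i "x (i - 1) - y (i - 1)"] b[of i "x i - y i"]
      b[of "i + 1" "x i - y i"]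
    unfolding distrib_left by linarith
qed (use C m in \<open>auto simp: bond_drift_def intro!: borel_measurable_diff borel_measurable_add borel_measurable_times\<close>)

definition unit_at :: "int \<Rightarrow> real \<Rightarrow> int \<Rightarrow> real" where
  "unit_at a s j = (if j = a then 1 else 0)"

lemma tame_unit_at: "tame T (unit_at a)"
  by (auto simp: tame_def unit_at_def[abs_def])


text \<open>The discrete gradient intertwines the two drifts: if q i = p (i - 1) - p i, then the
  site drift of q is the gradient of the bond drift of p. The forcings obey the same relation, two
  neighbouring unit masses against one, so every Picard step preserves it exactly.\<close>

lemma pic_site_bond_gradient:
  fixes A :: "real \<Rightarrow> int \<Rightarrow> real"
  assumes C: "0 \<le> C" and A: "\<And>s i. 0 \<le> A s i" "\<And>s i. A s i \<le> C" and m: "\<And>i. (\<lambda>s. A s i) \<in> borel_measurable borel"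
  shows "pic (site_drift A) (unit_at (a + 1)) n t i - pic (site_drift A) (unit_at a) n t i
    = pic (bond_drift A) (unit_at a) n t (i - 1) - pic (bond_drift A) (unit_at a) n t i"
proof (induction n arbitrary: t i)
  case (Suc n)
  interpret s: near_drift C "site_drift A" by (rule near_drift_site[OF assms])
  interpret b: near_drift C "bond_drift A" by (rule near_drift_bond[OF assms])
  let ?s = "\<lambda>a s. pic (site_drift A) (unit_at a) n s" and ?b = "\<lambda>s. pic (bond_drift A) (unit_at a) n s"
  have int_s: "set_integrable lborel {0..t} (\<lambda>s. site_drift A s (?s a s) i)" for a i
    by (rule s.tame_integrable[OF s.tame_pic[OF tame_unit_at] order_refl])
  have int_b: "set_integrable lborel {0..t} (\<lambda>s. bond_drift A s (?b s) i)" for i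
    by (rule b.tame_integrable[OF b.tame_pic[OF tame_unit_at] order_refl])
  have "site_drift A s (?s (a + 1) s) i - site_drift A s (?s a s) i
      = bond_drift A s (?b s) (i - 1) - bond_drift A s (?b s) i" for s
  proof -
    have "site_drift A s (?s (a + 1) s) i - site_drift A s (?s a s) i
      = A s (i + 1) * (?s (a + 1) s (i + 1) - ?s a s (i + 1)) + A s (i - 1) * (?s (a + 1) s (i - 1) - ?s a s (i - 1))
        - 2 * (A s i * (?s (a + 1) s i - ?s a s i))"
      by (simp add: site_drift_def algebra_simps)
    then show ?thesis
      unfolding Suc by (simp add: bond_drift_def algebra_simps)
  qed
  then have "(LBINT s:{0..t}. site_drift A s (?s (a + 1) s) i) - (LBINT s:{0..t}. site_drift A s (?s a s) i)
      = (LBINT s:{0..t}. bond_drift A s (?b s) (i - 1)) - (LBINT s:{0..t}. bond_drift A s (?b s) i)"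
    by (simp add: set_integral_diff(2)[OF int_s int_s, symmetric] set_integral_diff(2)[OF int_b int_b, symmetric])
  moreover have "unit_at (a + 1) t i - unit_at a t i = unit_at a t (i - 1) - unit_at a t i"
    by (simp add: unit_at_def)
  ultimately show ?case by simp
qed simp

text \<open>One Picard step lets information travel one site, beginning with the zero iterate. This
  finite range removes the boundary term when the gradient identity is telescoped.\<close>

lemma pic_site_finite_support: "n \<le> \<bar>i - a\<bar> \<Longrightarrow> pic (site_drift A) (unit_at a) n t i = 0"
proof (induction n arbitrary: t i)
  case (Suc n)
  have "pic (site_drift A) (unit_at a) n s k = 0" if "\<bar>k - i\<bar> \<le> 1" for s k
    by (rule Suc.IH) (use that Suc.prems in linarith)
  then have "site_drift A s (pic (site_drift A) (unit_at a) n s) i = 0" for s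
    unfolding site_drift_def by simp
  moreover have "unit_at a t i = 0" using Suc.prems by (auto simp: unit_at_def)
  ultimately show ?case by simp
qed simp

lemma pic_bond_finite_support: "n \<le> \<bar>i - a\<bar> \<Longrightarrow> pic (bond_drift A) (unit_at a) n t i = 0"
proof (induction n arbitrary: t i)
  case (Suc n)
  have "pic (bond_drift A) (unit_at a) n s k = 0" if "\<bar>k - i\<bar> \<le> 1" for s k
    by (rule Suc.IH) (use that Suc.prems in linarith)
  then have "bond_drift A s (pic (bond_drift A) (unit_at a) n s) i = 0" for s
    unfolding bond_drift_def by simp
  moreover have "unit_at a t i = 0" using Suc.prems by (auto simp: unit_at_def)
  ultimately show ?case by simp
qed simp

lemma (in prob_space) expectation_set_integral_swap:
  fixes g :: "'a \<Rightarrow> real \<Rightarrow> real"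
  assumes [measurable]: "(\<lambda>(\<omega>, s). g \<omega> s) \<in> borel_measurable (M \<Otimes>\<^sub>M borel)"
    and le: "\<And>\<omega> s. \<omega> \<in> space M \<Longrightarrow> 0 \<le> s \<Longrightarrow> s \<le> t \<Longrightarrow> \<bar>g \<omega> s\<bar> \<le> K" and t: "0 \<le> t"
  shows "expectation (\<lambda>\<omega>. LBINT s:{0..t}. g \<omega> s) = (LBINT s:{0..t}. expectation (\<lambda>\<omega>. g \<omega> s))"
proof -
  interpret pair_sigma_finite M lborel ..
  have K: "0 \<le> K" using le[of _ 0] t not_empty by fastforce
  have "integrable (M \<Otimes>\<^sub>M lborel) (\<lambda>(\<omega>, s). indicator {0..t} s *\<^sub>R g \<omega> s)"
  proof (rule Bochner_Integration.integrable_bound)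
    have "emeasure (M \<Otimes>\<^sub>M lborel) (space M \<times> {0..t}) < \<infinity>"
      using t by (subst lborel.emeasure_pair_measure_Times) (auto simp: emeasure_space_1)
    then show "integrable (M \<Otimes>\<^sub>M lborel) (\<lambda>x. K * indicator (space M \<times> {0..t}) x)"
      by (intro integrable_mult_right) (simp add: integrable_indicator_iff)
    show "(\<lambda>(\<omega>, s). indicator {0..t} s *\<^sub>R g \<omega> s) \<in> borel_measurable (M \<Otimes>\<^sub>M lborel)"
      by measurable
    show "AE x in M \<Otimes>\<^sub>M lborel. norm (case x of (\<omega>, s) \<Rightarrow> indicator {0..t} s *\<^sub>R g \<omega> s) \<le> norm (K * indicator (space M \<times> {0..t}) x)"
      using le K by (intro AE_I2) (auto simp: space_pair_measure indicator_def)
  qed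
  from Fubini_integral[OF this]
  have "(LINT s|lborel. LINT \<omega>|M. indicator {0..t} s *\<^sub>R g \<omega> s) = (LINT \<omega>|M. LINT s|lborel. indicator {0..t} s *\<^sub>R g \<omega> s)" .
  then show ?thesis unfolding set_lebesgue_integral_def by simp
qed

lemma environment_jointly_measurable:
  fixes \<xi> :: "real \<Rightarrow> 'b \<Rightarrow> int \<Rightarrow> real"
  assumes meas: "\<And>t j. 0 \<le> t \<Longrightarrow> (\<lambda>\<omega>. \<xi> t \<omega> j) \<in> borel_measurable P"
    and cont: "\<And>\<omega> j. \<omega> \<in> space P \<Longrightarrow> continuous_on {0..} (\<lambda>t. \<xi> t \<omega> j)"
  shows "(\<lambda>(\<omega>, s). \<xi> (max 0 s) \<omega> j) \<in> borel_measurable (P \<Otimes>\<^sub>M borel)"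
proof (rule right_continuous_jointly_measurable)
  fix \<omega> and s :: real assume "\<omega> \<in> space P" "0 \<le> s"
  then have "((\<lambda>t. \<xi> t \<omega> j) \<longlongrightarrow> \<xi> s \<omega> j) (at s within {0..})"
    using cont[of \<omega> j] by (auto simp: continuous_on_def)
  then show "((\<lambda>t. \<xi> t \<omega> j) \<longlongrightarrow> \<xi> s \<omega> j) (at_right s)"
    by (rule tendsto_within_subset) (use \<open>0 \<le> s\<close> in auto)
qed (rule meas)

section \<open>The law of the walk given the environment\<close>

context convex_potential
begin

definition stiffness :: "(real \<Rightarrow> int \<Rightarrow> real) \<Rightarrow> real \<Rightarrow> int \<Rightarrow> real" where
  "stiffness x s j = deriv (deriv V) (x s j)"

lemma stiffness_bounds: "0 \<le> stiffness x s j" "stiffness x s j \<le> Cp"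
  using V''_lower[of "x s j"] V''_upper[of "x s j"] Cm_pos by (auto simp: stiffness_def)

lemma
  fixes \<xi> :: "real \<Rightarrow> 'b \<Rightarrow> int \<Rightarrow> real"
  assumes meas: "\<And>t j. 0 \<le> t \<Longrightarrow> (\<lambda>\<omega>. \<xi> t \<omega> j) \<in> borel_measurable P"
    and cont: "\<And>\<omega> j. \<omega> \<in> space P \<Longrightarrow> continuous_on {0..} (\<lambda>t. \<xi> t \<omega> j)"
  shows stiffness_environment_measurable:
      "(\<lambda>(\<omega>, s). stiffness (\<lambda>s. \<xi> (max 0 s) \<omega>) s j) \<in> borel_measurable (P \<Otimes>\<^sub>M borel)"
    and walk_pic_measurable:
      "(\<lambda>(\<omega>, s). pic (bond_drift (stiffness (\<lambda>s. \<xi> (max 0 s) \<omega>))) (unit_at a) n s j) \<in> borel_measurable (P \<Otimes>\<^sub>M borel)"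
proof -
  show stiff: "(\<lambda>(\<omega>, s). stiffness (\<lambda>s. \<xi> (max 0 s) \<omega>) s j) \<in> borel_measurable (P \<Otimes>\<^sub>M borel)" for j
    using measurable_compose[OF environment_jointly_measurable[where \<xi> = \<xi>, OF meas cont] V''_measurable]
    by (simp add: stiffness_def case_prod_beta')
  show "(\<lambda>(\<omega>, s). pic (bond_drift (stiffness (\<lambda>s. \<xi> (max 0 s) \<omega>))) (unit_at a) n s j) \<in> borel_measurable (P \<Otimes>\<^sub>M borel)"
  proof (rule pic_jointly_measurable[where G = "\<lambda>\<omega>. bond_drift (stiffness (\<lambda>s. \<xi> (max 0 s) \<omega>))" and v = "\<lambda>_. unit_at a"])
    fix x :: "'b \<Rightarrow> real \<Rightarrow> int \<Rightarrow> real" and i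
    assume [measurable]: "\<And>j. (\<lambda>(\<omega>, s). x \<omega> s j) \<in> borel_measurable (P \<Otimes>\<^sub>M borel)"
    note [measurable] = stiff
    show "(\<lambda>(\<omega>, s). bond_drift (stiffness (\<lambda>s. \<xi> (max 0 s) \<omega>)) s (x \<omega> s) i) \<in> borel_measurable (P \<Otimes>\<^sub>M borel)"
      by (simp only: bond_drift_def) measurable
  qed (simp add: unit_at_def)
qed

text \<open>Testing the martingale problem against functionals of the whole environment gives the forward
  equation for the conditional law of the walk; the Picard error is tracked uniformly in the
  test functional.\<close>

lemma bond_walk_forward:
  assumes prob: "prob_space P" and walk: "bond_walk V P \<xi> X"
    and meas: "\<And>t j. 0 \<le> t \<Longrightarrow> (\<lambda>\<omega>. \<xi> t \<omega> j) \<in> borel_measurable P"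
    and cont: "\<And>\<omega> j. \<omega> \<in> space P \<Longrightarrow> continuous_on {0..} (\<lambda>t. \<xi> t \<omega> j)"
    and start: "AE \<omega> in P. X 0 \<omega> = a" and t: "0 \<le> t"
  shows "\<bar>(LINT \<omega>|P. indicator {i} (X t \<omega>))
    - (LINT \<omega>|P. pic (bond_drift (stiffness (\<lambda>s. \<xi> (max 0 s) \<omega>))) (unit_at a) n t i)\<bar> \<le> (4 * Cp * t) ^ n / fact n"
proof -
  interpret prob_space P by (rule prob)
  define A where "A \<omega> = stiffness (\<lambda>s. \<xi> (max 0 s) \<omega>)" for \<omega>
  define y where "y s \<omega> j = indicat_real {j} (X (max 0 s) \<omega>)" for s \<omega> j
  define p where "p n \<omega> = pic (bond_drift (A \<omega>)) (unit_at a) n" for n \<omega>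
  \<comment> \<open>The filtration at time 0 already contains the whole path of the environment, so
    the random rates are \<open>F\<close>-measurable and may be multiplied into test
    variables.\<close>
  define F where "F = walk_filtration P \<xi> X 0"
  have A: "0 \<le> A \<omega> s j" "A \<omega> s j \<le> Cp" for \<omega> s j by (simp_all add: A_def stiffness_bounds)
  have A_joint[measurable]: "(\<lambda>(\<omega>, s). A \<omega> s j) \<in> borel_measurable (P \<Otimes>\<^sub>M borel)" for j
    unfolding A_def by (rule stiffness_environment_measurable[OF meas cont])
  have A_sec: "(\<lambda>s. A \<omega> s j) \<in> borel_measurable borel" if "\<omega> \<in> space P" for \<omega> j
    using measurable_compose[OF measurable_Pair1'[OF that] A_joint[of j]] by simp
  have X_meas: "X s \<in> measurable P (count_space UNIV)" if "0 \<le> s" for s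
    using walk that by (simp add: bond_walk_def)
  have y_joint[measurable]: "(\<lambda>(\<omega>, s). y s \<omega> j) \<in> borel_measurable (P \<Otimes>\<^sub>M borel)" for j
    unfolding y_def
  proof (rule right_continuous_jointly_measurable[where Y = "\<lambda>s \<omega>. indicat_real {j} (X s \<omega>)"])
    fix s :: real assume "0 \<le> s"
    show "(\<lambda>\<omega>. indicat_real {j} (X s \<omega>)) \<in> borel_measurable P"
      by (rule measurable_compose[OF X_meas[OF \<open>0 \<le> s\<close>]]) simp
  next
    fix \<omega> and s :: real assume w: "\<omega> \<in> space P" "0 \<le> s"
    then have "((\<lambda>t. X t \<omega>) \<longlongrightarrow> X s \<omega>) (at_right s)"
      using walk by (simp add: bond_walk_def continuous_within)
    then have "\<forall>\<^sub>F t in at_right s. X t \<omega> = X s \<omega>" by (simp add: tendsto_discrete)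
    then have "\<forall>\<^sub>F t in at_right s. indicat_real {j} (X t \<omega>) = indicat_real {j} (X s \<omega>)"
      by (rule eventually_mono) simp
    then show "((\<lambda>t. indicat_real {j} (X t \<omega>)) \<longlongrightarrow> indicat_real {j} (X s \<omega>)) (at_right s)"
      by (rule tendsto_eventually)
  qed
  have p_joint[measurable]: "(\<lambda>(\<omega>, s). p n \<omega> s j) \<in> borel_measurable (P \<Otimes>\<^sub>M borel)" for n j
    unfolding p_def A_def by (rule walk_pic_measurable[OF meas cont])
  have nd: "near_drift Cp (bond_drift (A \<omega>))" if "\<omega> \<in> space P" for \<omega>
    by (rule near_drift_bond) (use A A_sec[OF that] Cp_pos in auto)
  have pb: "\<bar>p n \<omega> s j\<bar> \<le> exp (4 * Cp * s)" if "\<omega> \<in> space P" "0 \<le> s" for n \<omega> s j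
  proof -
    have "\<bar>p n \<omega> s j\<bar> \<le> 1 * 1 * exp (Cp * (2 * 1 + 2) * s)"
      unfolding p_def
      by (rule near_drift.pic_bound[OF nd[OF that(1)] weight_one tame_unit_at[of s]])
        (use that in \<open>auto simp: unit_at_def\<close>)
    then show ?thesis by (simp add: ac_simps)
  qed
  have yb: "\<bar>y s \<omega> j\<bar> \<le> 1" for s \<omega> j by (simp add: y_def indicator_def)
  have sec: "(\<lambda>\<omega>. f (\<omega>, s)) \<in> borel_measurable P" if "f \<in> borel_measurable (P \<Otimes>\<^sub>M borel)" for f :: "'a \<times> real \<Rightarrow> real" and s
    using measurable_compose[OF measurable_Pair2' that] by simp
  have y_m[measurable]: "(\<lambda>\<omega>. y s \<omega> j) \<in> borel_measurable P" and p_m[measurable]: "(\<lambda>\<omega>. p n \<omega> s j) \<in> borel_measurable P" for s j n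
    using sec[OF y_joint[of j], of s] sec[OF p_joint[of n j], of s] by simp_all
  have mart: "martingale P (walk_filtration P \<xi> X) (\<lambda>t \<omega>. f (X t \<omega>) - f (X 0 \<omega>)
                  - (LBINT s:{0..t}. walk_generator V (\<xi> s \<omega>) f (X s \<omega>)))"
    if "bounded (range f)" for f :: "int \<Rightarrow> real"
    using walk that by (simp add: bond_walk_def)
  have bdd: "bounded (range (indicat_real {j}))" for j :: int
    by (rule bounded_subset[of "{0..1}"]) (auto simp: indicator_def)
  have sub: "subalgebra P F"
    using mart[OF bdd] by (auto simp: martingale_def F_def)
  interpret fms: finite_measure_subalgebra P F
    by unfold_locales (rule sub)
  have F_env: "(\<lambda>\<omega>. A \<omega> s j) \<in> borel_measurable F" for s j
  proof -
    have "(\<lambda>\<omega>. \<xi> (max 0 s) \<omega> j) \<in> borel_measurable F"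
    proof (rule measurableI)
      fix B :: "real set" assume "B \<in> sets borel"
      then show "(\<lambda>\<omega>. \<xi> (max 0 s) \<omega> j) -` B \<inter> space F \<in> sets F"
        unfolding F_def walk_filtration_def
        by (subst sets_measure_of) (auto simp: space_measure_of_conv intro!: sigma_sets.Basic exI[of _ "max 0 s"])
    qed simp
    then show ?thesis unfolding A_def stiffness_def by (rule measurable_compose[OF _ V''_measurable])
  qed
  \<comment> \<open>Martingale property from time 0 to \<open>t\<close>: the increment is orthogonal
    to every bounded variable known at time 0.\<close>
  have increment: "expectation (\<lambda>\<omega>. Z \<omega> * (y t \<omega> j - y 0 \<omega> j - (LBINT s:{0..t}. bond_drift (A \<omega>) s (y s \<omega>) j))) = 0"
    if Z: "Z \<in> borel_measurable F" "\<And>\<omega>. \<omega> \<in> space P \<Longrightarrow> \<bar>Z \<omega>\<bar> \<le> c" and t: "0 \<le> t" for Z c t j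
  proof -
    define N where "N t \<omega> = indicat_real {j} (X t \<omega>) - indicat_real {j} (X 0 \<omega>)
                  - (LBINT s:{0..t}. walk_generator V (\<xi> s \<omega>) (indicat_real {j}) (X s \<omega>))" for t \<omega>
    have N: "y t \<omega> j - y 0 \<omega> j - (LBINT s:{0..t}. bond_drift (A \<omega>) s (y s \<omega>) j) = N t \<omega>" for \<omega>
    proof -
      \<comment> \<open>Symmetry of the jump rates: the generator applied to the indicator of
        \<open>j\<close> and read at the position of the walk equals the bond drift at
        \<open>j\<close> of the unit mass sitting at that position.\<close>
      have "(LBINT s:{0..t}. bond_drift (A \<omega>) s (y s \<omega>) j) = (LBINT s:{0..t}. walk_generator V (\<xi> s \<omega>) (indicat_real {j}) (X s \<omega>))"
        by (rule set_lebesgue_integral_cong)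
          (auto simp: bond_drift_def walk_generator_def A_def stiffness_def y_def indicator_def)
      then show ?thesis using t by (simp add: N_def y_def)
    qed
    have m: "integrable P (N t)" "AE \<omega> in P. real_cond_exp P F (N t) \<omega> = N 0 \<omega>"
      using mart[OF bdd[of j], folded N_def[abs_def]] t unfolding martingale_def F_def by auto
    have [measurable]: "Z \<in> borel_measurable P" by (rule measurable_from_subalg[OF sub Z(1)])
    have iZ: "integrable P (\<lambda>\<omega>. Z \<omega> * N t \<omega>)"
      by (rule Bochner_Integration.integrable_bound[OF integrable_mult_right[OF integrable_norm[OF m(1)], of c]])
        (use Z(2) m(1) in \<open>auto simp: abs_mult intro!: AE_I2 mult_right_mono intro: order_trans[OF _ abs_ge_self]\<close>)
    have "expectation (\<lambda>\<omega>. Z \<omega> * N t \<omega>) = expectation (\<lambda>\<omega>. Z \<omega> * real_cond_exp P F (N t) \<omega>)"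
      by (rule fms.real_cond_exp_intg(2)[symmetric]) (use iZ Z m in auto)
    also have "\<dots> = expectation (\<lambda>\<omega>. 0)"
    proof (rule integral_cong_AE)
      show "AE \<omega> in P. Z \<omega> * real_cond_exp P F (N t) \<omega> = 0"
        using m(2)
      proof eventually_elim
        case (elim \<omega>)
        have "N 0 \<omega> = 0" by (simp add: N_def set_integral_singleton)
        then show ?case using elim by simp
      qed
    qed auto
    finally show ?thesis unfolding N by simp
  qed
  \<comment> \<open>The induction needs an arbitrary test variable \<open>Z\<close>: the drift
    multiplies the errors by random rates, and these are absorbed into \<open>Z\<close> at the price
    of a factor Cp on its bound. The four terms of the drift produce the factor 4.\<close>
  have main: "\<bar>expectation (\<lambda>\<omega>. Z \<omega> * (y t \<omega> j - p n \<omega> t j))\<bar> \<le> c * ((4 * Cp * t) ^ n / fact n)"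
    if "Z \<in> borel_measurable F" "\<And>\<omega>. \<omega> \<in> space P \<Longrightarrow> \<bar>Z \<omega>\<bar> \<le> c" "0 \<le> c" "0 \<le> t" for Z c t j
    using that
  proof (induction n arbitrary: Z c t j)
    case 0
    have "\<bar>expectation (\<lambda>\<omega>. Z \<omega> * (y t \<omega> j - p 0 \<omega> t j))\<bar> \<le> expectation (\<lambda>\<omega>. c)"
    proof (rule order_trans[OF integral_abs_bound integral_mono'])
      show "\<bar>Z \<omega> * (y t \<omega> j - p 0 \<omega> t j)\<bar> \<le> c" if "\<omega> \<in> space P" for \<omega>
        using mult_mono[OF 0(2)[OF that] yb[of t \<omega> j]] 0 by (simp add: p_def abs_mult)
    qed (use 0 in auto)
    then show ?case by (simp add: prob_space)
  next
    case (Suc n)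
    note Z = Suc.prems
    have ZP[measurable]: "Z \<in> borel_measurable P" by (rule measurable_from_subalg[OF sub Z(1)])
    define D where "D \<omega> s j = y s \<omega> j - p n \<omega> s j" for \<omega> s j
    have D_joint[measurable]: "(\<lambda>(\<omega>, s). D \<omega> s j) \<in> borel_measurable (P \<Otimes>\<^sub>M borel)" for j
      unfolding D_def by measurable
    define K where "K = 1 + exp (4 * Cp * t)"
    have K: "0 \<le> K" by (simp add: K_def)
    have Db: "\<bar>D \<omega> s j\<bar> \<le> K" if "\<omega> \<in> space P" "0 \<le> s" "s \<le> t" for \<omega> s j
    proof -
      have "exp (4 * Cp * s) \<le> exp (4 * Cp * t)" using that Cp_pos by simp
      then show ?thesis unfolding D_def K_def using yb[of s \<omega> j] pb[OF that(1,2), of n j] by linarith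
    qed
    define H where "H \<omega> s = bond_drift (A \<omega>) s (D \<omega> s) j" for \<omega> s
    have H_joint[measurable]: "(\<lambda>(\<omega>, s). H \<omega> s) \<in> borel_measurable (P \<Otimes>\<^sub>M borel)"
      unfolding H_def bond_drift_def by measurable
    have AZb: "\<bar>Z \<omega> * A \<omega> s k\<bar> \<le> c * Cp" if "\<omega> \<in> space P" for \<omega> s k
      unfolding abs_mult using A[of \<omega> s k] Z(2)[OF that] Z(3) by (intro mult_mono) auto
    have Hb: "\<bar>Z \<omega> * H \<omega> s\<bar> \<le> c * Cp * (4 * K)" if w: "\<omega> \<in> space P" "0 \<le> s" "s \<le> t" for \<omega> s
    proof -
      have "\<bar>Z \<omega> * A \<omega> s k * D \<omega> s k'\<bar> \<le> c * Cp * K" for k k'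
        unfolding abs_mult[of "Z \<omega> * A \<omega> s k"] using AZb[OF w(1)] Db[OF w] Z(3) Cp_pos by (intro mult_mono) auto
      from this[of "j + 1" "j + 1"] this[of "j + 1" j] this[of j "j - 1"] this[of j j]
      show ?thesis by (simp add: H_def bond_drift_def algebra_simps)
    qed
    have BY: "(\<lambda>(\<omega>, s). bond_drift (A \<omega>) s (y s \<omega>) j) \<in> borel_measurable (P \<Otimes>\<^sub>M borel)"
      unfolding bond_drift_def by measurable
    have ZH[measurable]: "(\<lambda>(\<omega>, s). Z \<omega> * H \<omega> s) \<in> borel_measurable (P \<Otimes>\<^sub>M borel)"
      by measurable
    have IY[measurable]: "(\<lambda>\<omega>. LBINT s:{0..t}. bond_drift (A \<omega>) s (y s \<omega>) j) \<in> borel_measurable P"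
      by (rule borel_measurable_set_integral_Icc[OF BY]) simp
    have IZ[measurable]: "(\<lambda>\<omega>. LBINT s:{0..t}. Z \<omega> * H \<omega> s) \<in> borel_measurable P"
      by (rule borel_measurable_set_integral_Icc[OF ZH]) simp
    have "expectation (\<lambda>\<omega>. Z \<omega> * (y t \<omega> j - p (Suc n) \<omega> t j))
        = expectation (\<lambda>\<omega>. Z \<omega> * (y t \<omega> j - y 0 \<omega> j - (LBINT s:{0..t}. bond_drift (A \<omega>) s (y s \<omega>) j))
            + (LBINT s:{0..t}. Z \<omega> * H \<omega> s))"
    proof (rule integral_cong_AE)
      show "AE \<omega> in P. Z \<omega> * (y t \<omega> j - p (Suc n) \<omega> t j)
        = Z \<omega> * (y t \<omega> j - y 0 \<omega> j - (LBINT s:{0..t}. bond_drift (A \<omega>) s (y s \<omega>) j))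
            + (LBINT s:{0..t}. Z \<omega> * H \<omega> s)"
        using start AE_space
      proof eventually_elim
        case (elim \<omega>)
        interpret b: near_drift Cp "bond_drift (A \<omega>)" by (rule nd[OF elim(2)])
        have "(\<lambda>s. y s \<omega> k) \<in> borel_measurable borel" for k
          using measurable_compose[OF measurable_Pair1'[OF elim(2)] y_joint[of k]] by simp
        then have ty: "tame t (\<lambda>s. y s \<omega>)" by (rule tame_weightI[where K = 1 and w = "\<lambda>_. 1"]) (simp add: yb)
        have tp: "tame t (p n \<omega>)" unfolding p_def by (rule b.tame_pic[OF tame_unit_at])
        have "H \<omega> s = bond_drift (A \<omega>) s (y s \<omega>) j - bond_drift (A \<omega>) s (p n \<omega> s) j" for s
          by (simp add: H_def D_def bond_drift_def algebra_simps)
        then have e: "(LBINT s:{0..t}. bond_drift (A \<omega>) s (y s \<omega>) j)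
            = (LBINT s:{0..t}. H \<omega> s) + (LBINT s:{0..t}. bond_drift (A \<omega>) s (p n \<omega> s) j)"
          using b.tame_integrable[OF ty order_refl] b.tame_integrable[OF tp order_refl]
          by (simp add: set_integral_diff(2))
        have "y 0 \<omega> j = unit_at a t j" using elim by (simp add: y_def unit_at_def indicator_def)
        then have "y t \<omega> j - p (Suc n) \<omega> t j
            = (y t \<omega> j - y 0 \<omega> j - (LBINT s:{0..t}. bond_drift (A \<omega>) s (y s \<omega>) j)) + (LBINT s:{0..t}. H \<omega> s)"
          unfolding e by (simp add: p_def)
        then show ?case by (simp only: distrib_left set_integral_mult_right)
      qed
    qed measurable
    also have "\<dots> = expectation (\<lambda>\<omega>. Z \<omega> * (y t \<omega> j - y 0 \<omega> j - (LBINT s:{0..t}. bond_drift (A \<omega>) s (y s \<omega>) j)))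
            + expectation (\<lambda>\<omega>. LBINT s:{0..t}. Z \<omega> * H \<omega> s)"
    proof (rule Bochner_Integration.integral_add)
      have iH: "\<bar>LBINT s:{0..t}. g s\<bar> \<le> B * t" if "g \<in> borel_measurable borel" "\<And>s. 0 \<le> s \<Longrightarrow> s \<le> t \<Longrightarrow> \<bar>g s\<bar> \<le> B" for g B
        using set_integral_abs_le_FTC[OF that(1) Z(4), of "\<lambda>_. B" "\<lambda>s. B * s"] that(2)
        by (auto intro!: derivative_eq_intros)
      show "integrable P (\<lambda>\<omega>. LBINT s:{0..t}. Z \<omega> * H \<omega> s)"
      proof (rule integrable_const_bound[where B = "c * Cp * (4 * K) * t"])
        show "AE \<omega> in P. norm (LBINT s:{0..t}. Z \<omega> * H \<omega> s) \<le> c * Cp * (4 * K) * t"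
        proof (rule AE_I2)
          fix \<omega> assume w: "\<omega> \<in> space P"
          have "(\<lambda>s. H \<omega> s) \<in> borel_measurable borel"
            using measurable_compose[OF measurable_Pair1'[OF w] H_joint] by simp
          then show "norm (LBINT s:{0..t}. Z \<omega> * H \<omega> s) \<le> c * Cp * (4 * K) * t"
            unfolding real_norm_def using Hb[OF w] by (intro iH) auto
        qed
      qed measurable
      show "integrable P (\<lambda>\<omega>. Z \<omega> * (y t \<omega> j - y 0 \<omega> j - (LBINT s:{0..t}. bond_drift (A \<omega>) s (y s \<omega>) j)))"
      proof (rule integrable_const_bound[where B = "c * (2 + 4 * Cp * t)"])
        show "AE \<omega> in P. norm (Z \<omega> * (y t \<omega> j - y 0 \<omega> j - (LBINT s:{0..t}. bond_drift (A \<omega>) s (y s \<omega>) j))) \<le> c * (2 + 4 * Cp * t)"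
        proof (rule AE_I2)
          fix \<omega> assume w: "\<omega> \<in> space P"
          interpret b: near_drift Cp "bond_drift (A \<omega>)" by (rule nd[OF w])
          have "(\<lambda>s. y s \<omega> k) \<in> borel_measurable borel" for k
            using measurable_compose[OF measurable_Pair1'[OF w] y_joint[of k]] by simp
          then have "(\<lambda>s. bond_drift (A \<omega>) s (y s \<omega>) j) \<in> borel_measurable borel" by (rule b.meas)
          moreover have "\<bar>bond_drift (A \<omega>) s (y s \<omega>) j\<bar> \<le> 4 * Cp" for s
            using b.lip_weight[OF weight_one, of "y s \<omega>" "\<lambda>_. 0" 1 s j] yb by (simp add: b.zero)
          ultimately have "\<bar>LBINT s:{0..t}. bond_drift (A \<omega>) s (y s \<omega>) j\<bar> \<le> 4 * Cp * t" by (intro iH) auto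
          then have "\<bar>y t \<omega> j - y 0 \<omega> j - (LBINT s:{0..t}. bond_drift (A \<omega>) s (y s \<omega>) j)\<bar> \<le> 2 + 4 * Cp * t"
            using yb[of t \<omega> j] yb[of 0 \<omega> j] by linarith
          then show "norm (Z \<omega> * (y t \<omega> j - y 0 \<omega> j - (LBINT s:{0..t}. bond_drift (A \<omega>) s (y s \<omega>) j))) \<le> c * (2 + 4 * Cp * t)"
            unfolding real_norm_def abs_mult using Z(2)[OF w] Z(3) by (intro mult_mono) auto
        qed
        show "(\<lambda>\<omega>. Z \<omega> * (y t \<omega> j - y 0 \<omega> j - (LBINT s:{0..t}. bond_drift (A \<omega>) s (y s \<omega>) j))) \<in> borel_measurable P"
          by measurable
      qed
    qed
    also have "\<dots> = expectation (\<lambda>\<omega>. LBINT s:{0..t}. Z \<omega> * H \<omega> s)"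
      by (simp add: increment[OF Z(1,2,4)])
    also have "\<dots> = (LBINT s:{0..t}. expectation (\<lambda>\<omega>. Z \<omega> * H \<omega> s))"
      by (rule expectation_set_integral_swap[where K = "c * Cp * (4 * K)"]) (use Hb Z(4) in auto)
    finally have eq: "expectation (\<lambda>\<omega>. Z \<omega> * (y t \<omega> j - p (Suc n) \<omega> t j)) = (LBINT s:{0..t}. expectation (\<lambda>\<omega>. Z \<omega> * H \<omega> s))" .
    have EH: "\<bar>expectation (\<lambda>\<omega>. Z \<omega> * H \<omega> s)\<bar> \<le> c * (4 * Cp * ((4 * Cp * s) ^ n / fact n))" if s: "0 \<le> s" "s \<le> t" for s
    proof -
      let ?T = "\<lambda>k k' \<omega>. (Z \<omega> * A \<omega> s k) * (y s \<omega> k' - p n \<omega> s k')"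
      have A_m[measurable]: "(\<lambda>\<omega>. A \<omega> s k) \<in> borel_measurable P" for k
        by (rule measurable_from_subalg[OF sub F_env])
      have four: "\<bar>e1 - e2 + e3 - e4\<bar> \<le> 4 * q" if "\<bar>e1\<bar> \<le> q" "\<bar>e2\<bar> \<le> q" "\<bar>e3\<bar> \<le> q" "\<bar>e4\<bar> \<le> q" for e1 e2 e3 e4 q :: real
        using that by linarith
      have int: "integrable P (?T k k')" for k k'
      proof (rule integrable_const_bound[where B = "c * Cp * K"])
        show "AE \<omega> in P. norm (?T k k' \<omega>) \<le> c * Cp * K"
          unfolding real_norm_def abs_mult[of "_ * A _ s k"] D_def[symmetric]
          using AZb Db s Z(3) Cp_pos by (intro AE_I2 mult_mono) auto
      qed measurable
      have b: "\<bar>expectation (?T k k')\<bar> \<le> c * Cp * ((4 * Cp * s) ^ n / fact n)" for k k'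
        by (rule Suc.IH) (use F_env[of s k] Z AZb Cp_pos s in \<open>auto intro!: borel_measurable_times\<close>)
      have "expectation (\<lambda>\<omega>. Z \<omega> * H \<omega> s) = expectation (\<lambda>\<omega>. ?T (j + 1) (j + 1) \<omega> - ?T (j + 1) j \<omega> + ?T j (j - 1) \<omega> - ?T j j \<omega>)"
        by (rule Bochner_Integration.integral_cong) (auto simp: H_def D_def bond_drift_def algebra_simps)
      also have "\<dots> = expectation (?T (j + 1) (j + 1)) - expectation (?T (j + 1) j) + expectation (?T j (j - 1)) - expectation (?T j j)"
        using int by simp
      finally have "\<bar>expectation (\<lambda>\<omega>. Z \<omega> * H \<omega> s)\<bar> \<le> 4 * (c * Cp * ((4 * Cp * s) ^ n / fact n))"
        using four[OF b[of "j + 1" "j + 1"] b[of "j + 1" j] b[of j "j - 1"] b[of j j]] by simp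
      also have "\<dots> = c * (4 * Cp * ((4 * Cp * s) ^ n / fact n))" by (simp only: ac_simps)
      finally show ?thesis .
    qed
    have [measurable]: "(\<lambda>(s, \<omega>). Z \<omega> * H \<omega> s) \<in> borel_measurable (borel \<Otimes>\<^sub>M P)"
      using measurable_pair_swap[OF H_joint] by (auto simp: case_prod_beta')
    have "\<bar>LBINT s:{0..t}. expectation (\<lambda>\<omega>. Z \<omega> * H \<omega> s)\<bar> \<le> c * ((4 * Cp * t) ^ Suc n / fact (Suc n)) - c * ((4 * Cp * 0) ^ Suc n / fact (Suc n))"
    proof (rule set_integral_abs_le_FTC[OF _ Z(4) EH])
      show "(\<lambda>s. expectation (\<lambda>\<omega>. Z \<omega> * H \<omega> s)) \<in> borel_measurable borel"
        by (rule borel_measurable_lebesgue_integral) measurable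
      show "((\<lambda>s. c * ((4 * Cp * s) ^ Suc n / fact (Suc n))) has_real_derivative c * (4 * Cp * ((4 * Cp * s) ^ n / fact n))) (at s)" for s
        by (rule DERIV_cmult[OF has_real_derivative_power_fact])
    qed (auto intro!: continuous_intros)
    then show ?case unfolding eq by simp
  qed
  have "\<bar>expectation (\<lambda>\<omega>. 1 * (y t \<omega> i - p n \<omega> t i))\<bar> \<le> 1 * ((4 * Cp * t) ^ n / fact n)"
    by (rule main) (use t in auto)
  moreover have "expectation (\<lambda>\<omega>. y t \<omega> i - p n \<omega> t i) = expectation (\<lambda>\<omega>. y t \<omega> i) - expectation (\<lambda>\<omega>. p n \<omega> t i)"
  proof (rule Bochner_Integration.integral_diff)
    show "integrable P (\<lambda>\<omega>. y t \<omega> i)"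
      by (rule integrable_const_bound[where B = 1]) (use yb in auto)
    show "integrable P (\<lambda>\<omega>. p n \<omega> t i)"
      by (rule integrable_const_bound[where B = "exp (4 * Cp * t)"]) (use pb t in \<open>auto intro!: AE_I2\<close>)
  qed
  ultimately show ?thesis using t by (simp add: y_def p_def A_def)
qed

end

section \<open>Brownian paths\<close>

abbreviation path_space :: "(real \<Rightarrow> real) measure" where
  "path_space \<equiv> (\<Pi>\<^sub>M t\<in>{0..}. borel)"

abbreviation bm_path :: "(real \<Rightarrow> 'w \<Rightarrow> real) \<Rightarrow> 'w \<Rightarrow> real \<Rightarrow> real" where
  "bm_path W \<omega> \<equiv> (\<lambda>t\<in>{0..}. W t \<omega>)"

lemma bm_path_measurable:
  "brownian_motion M W \<Longrightarrow> bm_path W \<in> M \<rightarrow>\<^sub>M path_space"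
  by (intro measurable_restrict) (auto simp: brownian_motion_def)

text \<open>The definition of Brownian motion prescribes increments, so values on a time grid are
  written as partial sums of independent Gaussians. The right-hand side no longer mentions
  \<open>M\<close> or \<open>W\<close>, which makes laws on different spaces comparable.\<close>

lemma (in prob_space) brownian_fdd:
  assumes W: "brownian_motion M W" and \<tau>: "\<tau> 0 = 0" "mono \<tau>" "\<And>k. k < n \<Longrightarrow> \<tau> k < \<tau> (Suc k)" and n: "0 < n"
    and J: "J \<subseteq> \<tau> ` {..n}" and A: "\<And>t. t \<in> J \<Longrightarrow> A t \<in> sets borel"
  shows "emeasure M {\<omega> \<in> space M. \<forall>t\<in>J. W t \<omega> \<in> A t}
    = emeasure (\<Pi>\<^sub>M k\<in>{..<n}. density lborel (\<lambda>x. ennreal (normal_density 0 (sqrt (\<tau> (Suc k) - \<tau> k)) x)))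
        {d \<in> space (\<Pi>\<^sub>M k\<in>{..<n}. borel). \<forall>m\<in>{m\<in>{..n}. \<tau> m \<in> J}. (\<Sum>k<m. d k) \<in> A (\<tau> m)}"
proof -
  let ?D = "\<lambda>k \<omega>. W (\<tau> (Suc k)) \<omega> - W (\<tau> k) \<omega>"
  have \<tau>0: "0 \<le> \<tau> k" for k using \<tau>(1) monoD[OF \<tau>(2), of 0 k] by simp
  have W_meas[measurable]: "W (\<tau> k) \<in> borel_measurable M" for k
    using W \<tau>0 by (simp add: brownian_motion_def)
  have W0: "AE \<omega> in M. W 0 \<omega> = 0" using W by (simp add: brownian_motion_def)
  have ind: "indep_vars (\<lambda>_. borel) ?D {..<n}"
    using W \<tau> by (simp add: brownian_motion_def)
  have law: "distr M borel (?D k) = density lborel (\<lambda>x. ennreal (normal_density 0 (sqrt (\<tau> (Suc k) - \<tau> k)) x))" if "k < n" for k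
  proof -
    have "distributed M lborel (?D k) (\<lambda>x. ennreal (normal_density 0 (sqrt (\<tau> (Suc k) - \<tau> k)) x))"
      using W \<tau>0[of k] \<tau>(3)[OF that] by (simp add: brownian_motion_def)
    then have "distr M lborel (?D k) = density lborel (\<lambda>x. ennreal (normal_density 0 (sqrt (\<tau> (Suc k) - \<tau> k)) x))"
      by (simp add: distributed_def)
    moreover have "distr M lborel (?D k) = distr M borel (?D k)" by (rule distr_cong) auto
    ultimately show ?thesis by simp
  qed
  have joint: "distr M (\<Pi>\<^sub>M k\<in>{..<n}. borel) (\<lambda>\<omega>. \<lambda>k\<in>{..<n}. ?D k \<omega>)
      = (\<Pi>\<^sub>M k\<in>{..<n}. density lborel (\<lambda>x. ennreal (normal_density 0 (sqrt (\<tau> (Suc k) - \<tau> k)) x)))"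
  proof -
    have "distr M (\<Pi>\<^sub>M k\<in>{..<n}. borel) (\<lambda>\<omega>. \<lambda>k\<in>{..<n}. ?D k \<omega>) = (\<Pi>\<^sub>M k\<in>{..<n}. distr M borel (?D k))"
      by (rule indep_vars_iff_distr_eq_PiM[THEN iffD1, OF _ _ ind]) (use n in auto)
    also have "\<dots> = (\<Pi>\<^sub>M k\<in>{..<n}. density lborel (\<lambda>x. ennreal (normal_density 0 (sqrt (\<tau> (Suc k) - \<tau> k)) x)))"
      by (rule PiM_cong) (auto simp: law)
    finally show ?thesis .
  qed
  let ?B = "{d \<in> space (\<Pi>\<^sub>M k\<in>{..<n}. borel). \<forall>m\<in>{m\<in>{..n}. \<tau> m \<in> J}. (\<Sum>k<m. d k) \<in> A (\<tau> m)}"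
  have B: "?B \<in> sets (\<Pi>\<^sub>M k\<in>{..<n}. (borel :: real measure))"
  proof (rule sets.sets_Collect_finite_All)
    fix m assume m: "m \<in> {m \<in> {..n}. \<tau> m \<in> J}"
    have "(\<lambda>d. \<Sum>k<m. d k) \<in> borel_measurable (\<Pi>\<^sub>M k\<in>{..<n}. (borel :: real measure))"
      by (intro borel_measurable_sum measurable_component_singleton) (use m in auto)
    then show "{d \<in> space (\<Pi>\<^sub>M k\<in>{..<n}. (borel :: real measure)). (\<Sum>k<m. d k) \<in> A (\<tau> m)} \<in> sets (\<Pi>\<^sub>M k\<in>{..<n}. borel)"
      using A m by (auto simp: vimage_def Int_def conj_commute dest: measurable_sets)
  qed simp
  have "emeasure M {\<omega> \<in> space M. \<forall>t\<in>J. W t \<omega> \<in> A t}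
      = emeasure M ((\<lambda>\<omega>. \<lambda>k\<in>{..<n}. ?D k \<omega>) -` ?B \<inter> space M)"
  proof (rule emeasure_eq_AE)
    show "AE \<omega> in M. (\<omega> \<in> {\<omega> \<in> space M. \<forall>t\<in>J. W t \<omega> \<in> A t}) = (\<omega> \<in> (\<lambda>\<omega>. \<lambda>k\<in>{..<n}. ?D k \<omega>) -` ?B \<inter> space M)"
      using W0
    proof eventually_elim
      case (elim \<omega>)
      have "(\<Sum>k<m. (\<lambda>k\<in>{..<n}. ?D k \<omega>) k) = W (\<tau> m) \<omega>" if "m \<le> n" for m
      proof -
        have "(\<Sum>k<m. (\<lambda>k\<in>{..<n}. ?D k \<omega>) k) = (\<Sum>k<m. ?D k \<omega>)"
          using that by (intro sum.cong) auto
        then show ?thesis using elim \<tau>(1) by (simp add: sum_lessThan_telescope[of "\<lambda>k. W (\<tau> k) \<omega>"])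
      qed
      moreover have "(\<forall>t\<in>J. W t \<omega> \<in> A t) \<longleftrightarrow> (\<forall>m\<in>{m\<in>{..n}. \<tau> m \<in> J}. W (\<tau> m) \<omega> \<in> A (\<tau> m))"
        using J by auto
      ultimately show ?case by (auto simp: space_PiM)
    qed
    show "{\<omega> \<in> space M. \<forall>t\<in>J. W t \<omega> \<in> A t} \<in> sets M"
    proof (rule sets.sets_Collect_finite_All)
      show "finite J" using J finite_surj by blast
      fix t assume t: "t \<in> J"
      then obtain m where "t = \<tau> m" using J by auto
      then have "W t \<in> borel_measurable M" using W_meas by simp
      then show "{\<omega> \<in> space M. W t \<omega> \<in> A t} \<in> sets M"
        using A[OF t] by (auto simp: vimage_def Int_def conj_commute dest: measurable_sets)
    qed
    show "(\<lambda>\<omega>. \<lambda>k\<in>{..<n}. ?D k \<omega>) -` ?B \<inter> space M \<in> sets M"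
      by (rule measurable_sets[OF _ B]) measurable
  qed
  also have "\<dots> = emeasure (distr M (\<Pi>\<^sub>M k\<in>{..<n}. borel) (\<lambda>\<omega>. \<lambda>k\<in>{..<n}. ?D k \<omega>)) ?B"
    by (rule emeasure_distr[symmetric, OF _ B]) measurable
  finally show ?thesis unfolding joint .
qed

lemma emeasure_bm_path_cylinder:
  assumes W: "brownian_motion M W" and J: "finite J" "J \<subseteq> {0..}" and A: "\<And>t. t \<in> J \<Longrightarrow> A t \<in> sets borel"
  shows "emeasure (distr M path_space (bm_path W)) (prod_emb {0..} (\<lambda>_. borel) J (Pi\<^sub>E J A))
    = emeasure M {\<omega> \<in> space M. \<forall>t\<in>J. W t \<omega> \<in> A t}"
proof -
  have "prod_emb {0..} (\<lambda>_. borel) J (Pi\<^sub>E J A) \<in> sets path_space"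
    using J A by (intro sets_PiM_I) auto
  then have "emeasure (distr M path_space (bm_path W)) (prod_emb {0..} (\<lambda>_. borel) J (Pi\<^sub>E J A))
    = emeasure M (bm_path W -` prod_emb {0..} (\<lambda>_. borel) J (Pi\<^sub>E J A) \<inter> space M)"
    by (rule emeasure_distr[OF bm_path_measurable[OF W]])
  also have "bm_path W -` prod_emb {0..} (\<lambda>_. borel) J (Pi\<^sub>E J A) \<inter> space M = {\<omega> \<in> space M. \<forall>t\<in>J. W t \<omega> \<in> A t}"
    using J(2) by (auto simp: prod_emb_def restrict_PiE_iff restrict_restrict Int_absorb1)
  finally show ?thesis .
qed

lemma brownian_law_unique:
  assumes M: "prob_space M" "brownian_motion M W" and M': "prob_space M'" "brownian_motion M' W'"
  shows "distr M path_space (bm_path W) = distr M' path_space (bm_path W')"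
proof (rule measure_eqI_PiM_infinite)
  show "finite_measure (distr M path_space (bm_path W))"
    using prob_space.prob_space_distr[OF M(1) bm_path_measurable[OF M(2)]]
    by (simp add: prob_space_def)
  fix J :: "real set" and A :: "real \<Rightarrow> real set"
  assume J: "finite J" "J \<subseteq> {0..}" and A: "\<And>t. t \<in> J \<Longrightarrow> A t \<in> sets borel"
  \<comment> \<open>Time 0 starts the partial sums; time 1 guarantees at least one increment, so
    that the family of increments is not empty.\<close>
  define I where "I = insert 0 (insert 1 J)"
  have I: "finite I" "I \<subseteq> {0..}" "0 \<in> I" "1 \<in> I" "J \<subseteq> I" using J by (auto simp: I_def)
  define xs where "xs = sorted_list_of_set I"
  have xs: "sorted_wrt (<) xs" "set xs = I" using I(1) by (simp_all add: xs_def)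
  define n where "n = length xs - 1"
  have "card I \<ge> card {0::real, 1}" by (rule card_mono) (use I in auto)
  then have len: "length xs = Suc n" "0 < n" using I(1) by (auto simp: n_def xs_def)
  \<comment> \<open>Beyond \<open>n\<close> the grid is frozen, because independence of increments
    is stated for monotone sequences indexed by all naturals.\<close>
  define \<tau> where "\<tau> k = xs ! min k n" for k
  have strict: "\<tau> k < \<tau> (Suc k)" if "k < n" for k
    using sorted_wrt_nth_less[OF xs(1), of k "Suc k"] that len by (simp add: \<tau>_def)
  have mono: "mono \<tau>"
    unfolding mono_iff_le_Suc
  proof
    fix k show "\<tau> k \<le> \<tau> (Suc k)"
      using strict[of k] by (cases "k < n") (auto simp: \<tau>_def)
  qed
  have range: "\<tau> ` {..n} = I"
  proof -
    have "\<tau> ` {..n} = (\<lambda>k. xs ! k) ` {..<length xs}"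
      using len by (intro image_cong) (auto simp: \<tau>_def)
    then show ?thesis using xs(2) by (simp add: set_conv_nth image_def) (auto simp: lessThan_def)
  qed
  have "\<tau> 0 = 0"
  proof (rule antisym)
    obtain m where "m \<le> n" "\<tau> m = 0" using range I(3) by (metis atMost_iff imageE)
    then show "\<tau> 0 \<le> 0" using monoD[OF mono, of 0 m] by simp
    show "0 \<le> \<tau> 0" using range I(2) by (metis atLeast_iff atMost_iff image_eqI subsetD zero_le)
  qed
  note \<tau> = this mono strict len(2)
  have JI: "J \<subseteq> \<tau> ` {..n}" using range I by simp
  have "emeasure (distr M path_space (bm_path W)) (prod_emb {0..} (\<lambda>_. borel) J (Pi\<^sub>E J A)) = emeasure M {\<omega> \<in> space M. \<forall>t\<in>J. W t \<omega> \<in> A t}"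
    by (rule emeasure_bm_path_cylinder[OF M(2) J A])
  also have "\<dots> = emeasure (\<Pi>\<^sub>M k\<in>{..<n}. density lborel (\<lambda>x. ennreal (normal_density 0 (sqrt (\<tau> (Suc k) - \<tau> k)) x)))
        {d \<in> space (\<Pi>\<^sub>M k\<in>{..<n}. borel). \<forall>m\<in>{m\<in>{..n}. \<tau> m \<in> J}. (\<Sum>k<m. d k) \<in> A (\<tau> m)}"
    by (rule prob_space.brownian_fdd[OF M \<tau> JI A])
  also have "\<dots> = emeasure M' {\<omega> \<in> space M'. \<forall>t\<in>J. W' t \<omega> \<in> A t}"
    by (rule prob_space.brownian_fdd[OF M' \<tau> JI A, symmetric])
  also have "\<dots> = emeasure (distr M' path_space (bm_path W')) (prod_emb {0..} (\<lambda>_. borel) J (Pi\<^sub>E J A))"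
    by (rule emeasure_bm_path_cylinder[OF M'(2) J A, symmetric])
  finally show "emeasure (distr M path_space (bm_path W)) (prod_emb {0..} (\<lambda>_. borel) J (Pi\<^sub>E J A))
      = emeasure (distr M' path_space (bm_path W')) (prod_emb {0..} (\<lambda>_. borel) J (Pi\<^sub>E J A))" .
qed simp_all

text \<open>The reference motion \<open>W\<close> on \<open>N\<close> lets the noise of every
  process in the theorem, on whatever space, be compared with one product law.\<close>

lemma bond_brownian_law:
  assumes "prob_space M" "bond_brownian_motions M B" and N: "prob_space N" "brownian_motion N W"
  shows "distr M (\<Pi>\<^sub>M i\<in>UNIV. path_space) (\<lambda>\<omega> i. bm_path (B i) \<omega>)
    = (\<Pi>\<^sub>M i\<in>(UNIV :: int set). distr N path_space (bm_path W))"
proof -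
  interpret prob_space M by fact
  have B: "brownian_motion M (B i)" for i using assms by (simp add: bond_brownian_motions_def)
  have "distr M (\<Pi>\<^sub>M i\<in>UNIV. path_space) (\<lambda>\<omega>. \<lambda>i\<in>UNIV. bm_path (B i) \<omega>)
      = (\<Pi>\<^sub>M i\<in>(UNIV :: int set). distr M path_space (bm_path (B i)))"
    by (rule indep_vars_iff_distr_eq_PiM[THEN iffD1])
      (use assms bm_path_measurable[OF B] in \<open>auto simp: bond_brownian_motions_def\<close>)
  then show ?thesis
    by (simp add: brownian_law_unique[OF assms(1) B N] restrict_UNIV)
qed

text \<open>Chaining: the supremum over dyadic times is controlled by \<open>|x| \<le> c + x^4 / c^3\<close> applied to the
  increments at level \<open>m\<close> with \<open>c = (9/10)^m\<close>; the fourth moments contribute \<open>(500/729)^m\<close>.\<close>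

definition incr_bound :: "nat \<Rightarrow> nat \<Rightarrow> (real \<Rightarrow> real) \<Rightarrow> real" where
  "incr_bound N m b = (9 / 10) ^ m
    + (\<Sum>k<N * 2 ^ m. (b ((real k + 1) / 2 ^ m) - b (real k / 2 ^ m)) ^ 4) / ((9 / 10) ^ m) ^ 3"

definition path_sup :: "nat \<Rightarrow> (real \<Rightarrow> real) \<Rightarrow> ennreal" where
  "path_sup N b = (\<Sum>m. ennreal (incr_bound N m b))"

lemma abs_le_quartic:
  fixes x c :: real assumes c: "0 < c" shows "\<bar>x\<bar> \<le> c + x ^ 4 / c ^ 3"
proof (cases "\<bar>x\<bar> \<le> c")
  case True
  moreover have "0 \<le> x ^ 4 / c ^ 3" using c by (intro divide_nonneg_nonneg) (auto simp: zero_le_even_power)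
  ultimately show ?thesis by linarith
next
  case False
  then have "c ^ 3 \<le> \<bar>x\<bar> ^ 3" using c by (intro power_mono) auto
  then have "\<bar>x\<bar> * c ^ 3 \<le> \<bar>x\<bar> * \<bar>x\<bar> ^ 3" by (intro mult_left_mono) auto
  also have "\<dots> = x ^ 4" by (simp add: power_Suc[symmetric] power_even_abs del: power_Suc)
  finally have "\<bar>x\<bar> \<le> x ^ 4 / c ^ 3" using c by (simp add: pos_le_divide_eq)
  then show ?thesis using c by simp
qed

lemma incr_bound_nonneg: "0 \<le> incr_bound N m b"
  unfolding incr_bound_def by (intro add_nonneg_nonneg divide_nonneg_nonneg sum_nonneg) (auto simp: zero_le_even_power)

lemma dyadic_increment_le:
  assumes "k < N * 2 ^ m" shows "\<bar>b ((real k + 1) / 2 ^ m) - b (real k / 2 ^ m)\<bar> \<le> incr_bound N m b"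
proof -
  let ?d = "\<lambda>k. b ((real k + 1) / 2 ^ m) - b (real k / 2 ^ m)"
  have "?d k ^ 4 \<le> (\<Sum>k<N * 2 ^ m. ?d k ^ 4)"
    by (rule member_le_sum) (use assms in \<open>auto simp: zero_le_even_power\<close>)
  then have "?d k ^ 4 / ((9 / 10) ^ m) ^ 3 \<le> (\<Sum>k<N * 2 ^ m. ?d k ^ 4) / ((9 / 10) ^ m) ^ 3"
    by (intro divide_right_mono) auto
  then show ?thesis
    using abs_le_quartic[of "(9 / 10) ^ m" "?d k"] unfolding incr_bound_def by simp
qed

text \<open>A dyadic point of level n + 1 is either of level n or one step away from such a point,
  so each further level contributes one increment. Level 0 takes up to N unit steps, which is the
  origin of the factor N.\<close>

lemma dyadic_le_incr_bounds:
  assumes b0: "b 0 = 0" and N: "1 \<le> N" and k: "k \<le> N * 2 ^ n"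
  shows "\<bar>b (real k / 2 ^ n)\<bar> \<le> real N * (\<Sum>m\<le>n. incr_bound N m b)"
  using k
proof (induction n arbitrary: k)
  case 0
  have "\<bar>b (real j)\<bar> \<le> real j * incr_bound N 0 b" if "j \<le> N" for j
    using that
  proof (induction j)
    case (Suc j)
    then have "\<bar>b (real j + 1) - b (real j)\<bar> \<le> incr_bound N 0 b"
      using dyadic_increment_le[of j N 0 b] by simp
    then show ?case using Suc by (simp add: algebra_simps)
  qed (simp add: b0)
  from this[of k] have "\<bar>b (real k)\<bar> \<le> real k * incr_bound N 0 b" using 0 by simp
  also have "\<dots> \<le> real N * incr_bound N 0 b"
    using 0 by (intro mult_right_mono incr_bound_nonneg) auto
  finally show ?case by simp
next
  case (Suc n)
  have step: "real N * (\<Sum>m\<le>n. incr_bound N m b) + incr_bound N (Suc n) b \<le> real N * (\<Sum>m\<le>Suc n. incr_bound N m b)"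
    using N mult_right_mono[of 1 "real N" "incr_bound N (Suc n) b"] incr_bound_nonneg[of N "Suc n" b]
    by (simp add: distrib_left)
  obtain j where j: "k = 2 * j \<or> k = 2 * j + 1" by (metis oddE evenE)
  then show ?case
  proof
    assume k2: "k = 2 * j"
    then have "\<bar>b (real j / 2 ^ n)\<bar> \<le> real N * (\<Sum>m\<le>n. incr_bound N m b)"
      using Suc.prems by (intro Suc.IH) simp
    then show ?thesis using step incr_bound_nonneg[of N "Suc n" b] k2 by simp
  next
    assume k2: "k = 2 * j + 1"
    then have "\<bar>b (real j / 2 ^ n)\<bar> \<le> real N * (\<Sum>m\<le>n. incr_bound N m b)"
      using Suc.prems by (intro Suc.IH) simp
    moreover have "\<bar>b ((real (2 * j) + 1) / 2 ^ Suc n) - b (real (2 * j) / 2 ^ Suc n)\<bar> \<le> incr_bound N (Suc n) b"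
      by (rule dyadic_increment_le) (use Suc.prems k2 in simp)
    moreover have "real (2 * j) / 2 ^ Suc n = real j / 2 ^ n" by simp
    moreover have "real k / 2 ^ Suc n = (real (2 * j) + 1) / 2 ^ Suc n" by (simp add: k2)
    ultimately show ?thesis using step by simp
  qed
qed

lemma dyadic_le_path_sup:
  assumes "b 0 = 0" "1 \<le> N" "k \<le> N * 2 ^ n" "path_sup N b \<le> ennreal K" "0 \<le> K"
  shows "\<bar>b (real k / 2 ^ n)\<bar> \<le> real N * K"
proof -
  have "ennreal (\<Sum>m\<le>n. incr_bound N m b) = (\<Sum>m\<le>n. ennreal (incr_bound N m b))"
    by (simp add: incr_bound_nonneg sum_ennreal)
  also have "\<dots> \<le> path_sup N b"
    unfolding path_sup_def by (rule sum_le_suminf) auto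
  finally have "(\<Sum>m\<le>n. incr_bound N m b) \<le> K"
    using assms(4,5) by (metis order_trans ennreal_le_iff)
  then have "real N * (\<Sum>m\<le>n. incr_bound N m b) \<le> real N * K" by (intro mult_left_mono) auto
  then show ?thesis using dyadic_le_incr_bounds[of b N k n] assms(1-3) by linarith
qed

lemma incr_bound_measurable [measurable]: "incr_bound N m \<in> borel_measurable path_space"
  unfolding incr_bound_def[abs_def]
  by (intro borel_measurable_add borel_measurable_divide borel_measurable_sum borel_measurable_power
      borel_measurable_diff measurable_const measurable_component_singleton) auto

lemma path_sup_measurable [measurable]: "path_sup N \<in> borel_measurable path_space"
  unfolding path_sup_def[abs_def] by measurable

lemma normal_fourth_moment:
  assumes "0 < \<sigma>" shows "(\<integral>\<^sup>+x. ennreal (normal_density 0 \<sigma> x) * ennreal (x ^ 4) \<partial>lborel) = ennreal (3 * \<sigma> ^ 4)"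
proof -
  have "has_bochner_integral lborel (\<lambda>x. normal_density 0 \<sigma> x * (x - 0) ^ (2 * 2)) (fact (2 * 2) / ((2 / \<sigma>\<^sup>2) ^ 2 * fact 2))"
    by (rule normal_moment_even[OF assms])
  moreover have "fact (2 * 2) / ((2 / \<sigma>\<^sup>2) ^ 2 * fact 2) = 3 * \<sigma> ^ 4"
    using assms by (simp add: fact_numeral power_divide power_mult[symmetric] field_simps)
  ultimately have hb: "has_bochner_integral lborel (\<lambda>x. normal_density 0 \<sigma> x * x ^ 4) (3 * \<sigma> ^ 4)" by simp
  have "(\<integral>\<^sup>+x. ennreal (normal_density 0 \<sigma> x * x ^ 4) \<partial>lborel) = ennreal (3 * \<sigma> ^ 4)"
    using hb by (subst nn_integral_eq_integral) (auto simp: has_bochner_integral_iff zero_le_even_power)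
  moreover have "ennreal (normal_density 0 \<sigma> x) * ennreal (x ^ 4) = ennreal (normal_density 0 \<sigma> x * x ^ 4)" for x
    by (rule ennreal_mult[symmetric]) (auto simp: zero_le_even_power)
  ultimately show ?thesis by simp
qed

lemma brownian_path_sup_finite:
  assumes "prob_space M" and W: "brownian_motion M W"
  shows "(\<integral>\<^sup>+b. path_sup N b \<partial>distr M path_space (bm_path W)) < \<infinity>"
proof -
  interpret prob_space M by fact
  have [measurable]: "W t \<in> borel_measurable M" if "0 \<le> t" for t
    using W that by (simp add: brownian_motion_def)
  have quartic: "(\<integral>\<^sup>+\<omega>. ennreal ((W t \<omega> - W s \<omega>) ^ 4) \<partial>M) = ennreal (3 * (t - s)\<^sup>2)" if "0 \<le> s" "s < t" for s t
  proof -
    have d: "distributed M lborel (\<lambda>\<omega>. W t \<omega> - W s \<omega>) (\<lambda>x. ennreal (normal_density 0 (sqrt (t - s)) x))"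
      using W that by (simp add: brownian_motion_def)
    have "(\<integral>\<^sup>+\<omega>. ennreal ((W t \<omega> - W s \<omega>) ^ 4) \<partial>M) = (\<integral>\<^sup>+x. ennreal (normal_density 0 (sqrt (t - s)) x) * ennreal (x ^ 4) \<partial>lborel)"
      by (rule distributed_nn_integral[OF d, symmetric]) measurable
    also have "\<dots> = ennreal (3 * sqrt (t - s) ^ 4)" by (rule normal_fourth_moment) (use that in simp)
    also have "sqrt (t - s) ^ 4 = (t - s)\<^sup>2"
      using that power_mult[of "sqrt (t - s)" 2 2] by simp
    finally show ?thesis .
  qed
  \<comment> \<open>There are N * 2^m increments with fourth moment 3 / 4^m, divided by (9 / 10)^(3
    m); this leaves 3 N (500 / 729)^m. Any base c < 1 with 2 c^3 > 1 would serve in place of 9 / 10: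
    both series are then geometric.\<close>
  have incr: "(\<integral>\<^sup>+\<omega>. ennreal (incr_bound N m (bm_path W \<omega>)) \<partial>M) = ennreal ((9 / 10) ^ m + real N * 3 * (500 / 729) ^ m)" for m
  proof -
    let ?c = "((9 / 10) ^ m) ^ 3 :: real"
    have c: "0 < ?c" by simp
    let ?D = "\<lambda>k \<omega>. W ((real k + 1) / 2 ^ m) \<omega> - W (real k / 2 ^ m) \<omega>"
    have "(\<integral>\<^sup>+\<omega>. ennreal (incr_bound N m (bm_path W \<omega>)) \<partial>M)
        = (\<integral>\<^sup>+\<omega>. ennreal ((9 / 10) ^ m) + (\<Sum>k<N * 2 ^ m. ennreal (?D k \<omega> ^ 4)) * ennreal (1 / ?c) \<partial>M)"
    proof (rule nn_integral_cong)
      fix \<omega>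
      have "incr_bound N m (bm_path W \<omega>) = (9 / 10) ^ m + (\<Sum>k<N * 2 ^ m. ?D k \<omega> ^ 4) * (1 / ?c)"
        unfolding incr_bound_def by simp
      then show "ennreal (incr_bound N m (bm_path W \<omega>)) = ennreal ((9 / 10) ^ m) + (\<Sum>k<N * 2 ^ m. ennreal (?D k \<omega> ^ 4)) * ennreal (1 / ?c)"
        by (simp add: sum_nonneg zero_le_even_power sum_ennreal ennreal_mult[symmetric] del: times_divide_eq_right)
    qed
    also have "\<dots> = ennreal ((9 / 10) ^ m) + (\<Sum>k<N * 2 ^ m. (\<integral>\<^sup>+\<omega>. ennreal (?D k \<omega> ^ 4) \<partial>M)) * ennreal (1 / ?c)"
      by (simp add: nn_integral_add nn_integral_multc nn_integral_sum emeasure_space_1 del: sum_ennreal)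
    also have "(\<Sum>k<N * 2 ^ m. (\<integral>\<^sup>+\<omega>. ennreal (?D k \<omega> ^ 4) \<partial>M)) = (\<Sum>k<N * 2 ^ m. ennreal (3 * (1 / 2 ^ m)\<^sup>2))"
    proof (rule sum.cong[OF refl])
      fix k
      have "real k / 2 ^ m < (real k + 1) / 2 ^ m" by (intro divide_strict_right_mono) auto
      moreover have "(real k + 1) / 2 ^ m - real k / 2 ^ m = 1 / 2 ^ m" by (simp add: diff_divide_distrib[symmetric])
      ultimately show "(\<integral>\<^sup>+\<omega>. ennreal (?D k \<omega> ^ 4) \<partial>M) = ennreal (3 * (1 / 2 ^ m)\<^sup>2)"
        using quartic[of "real k / 2 ^ m" "(real k + 1) / 2 ^ m"] by simp
    qed
    also have "\<dots> = ennreal (real (N * 2 ^ m) * (3 * (1 / 2 ^ m)\<^sup>2))"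
    proof -
      have "(\<Sum>k<N * 2 ^ m. ennreal (3 * (1 / 2 ^ m)\<^sup>2)) = ennreal (real (N * 2 ^ m)) * ennreal (3 * (1 / 2 ^ m)\<^sup>2)"
        unfolding sum_constant card_lessThan ennreal_of_nat_eq_real_of_nat ..
      then show ?thesis by (simp only:) (rule ennreal_mult[symmetric], auto)
    qed
    also have "ennreal ((9 / 10) ^ m) + ennreal (real (N * 2 ^ m) * (3 * (1 / 2 ^ m)\<^sup>2)) * ennreal (1 / ?c)
        = ennreal ((9 / 10) ^ m + real (N * 2 ^ m) * (3 * (1 / 2 ^ m)\<^sup>2) * (1 / ?c))"
      by (subst ennreal_mult[symmetric], simp, simp, subst ennreal_plus[symmetric]) auto
    also have "real (N * 2 ^ m) * (3 * (1 / 2 ^ m)\<^sup>2) * (1 / ?c) = real N * 3 * (500 / 729) ^ m"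
    proof -
      have "?c = ((9 / 10) ^ 3) ^ m" by (simp only: power_mult[symmetric] mult.commute)
      also have "(9 / 10 :: real) ^ 3 = 729 / 1000" by (simp add: power3_eq_cube)
      finally have c': "?c = (729 / 1000) ^ m" .
      have "real (N * 2 ^ m) * (3 * (1 / 2 ^ m)\<^sup>2) * (1 / ?c) = real N * 3 * (1 / (2 ^ m * ?c))"
        by (simp add: power2_eq_square field_simps)
      also have "1 / (2 ^ m * ?c) = (500 / 729) ^ m"
        unfolding c' by (simp add: power_mult_distrib[symmetric] power_one_over[symmetric])
      finally show ?thesis .
    qed
    finally show ?thesis .
  qed
  have sm: "summable (\<lambda>m. (9 / 10) ^ m + real N * 3 * (500 / 729) ^ m :: real)"
    by (intro summable_add summable_mult summable_geometric) auto
  have "(\<integral>\<^sup>+b. path_sup N b \<partial>distr M path_space (bm_path W)) = (\<integral>\<^sup>+\<omega>. path_sup N (bm_path W \<omega>) \<partial>M)"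
    by (rule nn_integral_distr[OF bm_path_measurable[OF W]]) measurable
  also have "\<dots> = (\<Sum>m. \<integral>\<^sup>+\<omega>. ennreal (incr_bound N m (bm_path W \<omega>)) \<partial>M)"
  proof -
    have "(\<lambda>\<omega>. ennreal (incr_bound N m (bm_path W \<omega>))) \<in> borel_measurable M" for m
      by (rule measurable_compose[OF bm_path_measurable[OF W]]) measurable
    then show ?thesis unfolding path_sup_def by (rule nn_integral_suminf)
  qed
  also have "\<dots> = (\<Sum>m. ennreal ((9 / 10) ^ m + real N * 3 * (500 / 729) ^ m))" by (simp only: incr)
  also have "\<dots> = ennreal (\<Sum>m. (9 / 10) ^ m + real N * 3 * (500 / 729) ^ m)"
    by (rule suminf_ennreal2[OF _ sm]) simp
  finally show ?thesis by simp
qed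

text \<open>Reading a path only at countably many dyadic times, with a limit from the right, makes
  the evaluation jointly measurable in path and time over the product sigma-algebra. On continuous
  paths it is the ordinary value; 0 is the default where the limit fails.\<close>

definition path_eval :: "(real \<Rightarrow> real) \<Rightarrow> real \<Rightarrow> real" where
  "path_eval b t =
    (if convergent (\<lambda>n. b ((real_of_int \<lfloor>max 0 t * 2 ^ n\<rfloor> + 1) / 2 ^ n))
     then lim (\<lambda>n. b ((real_of_int \<lfloor>max 0 t * 2 ^ n\<rfloor> + 1) / 2 ^ n)) else 0)"

lemma path_eval_measurable [measurable]:
  "(\<lambda>(b, t). path_eval b t) \<in> borel_measurable (path_space \<Otimes>\<^sub>M borel)"
proof -
  have m[measurable]: "(\<lambda>x. fst x ((real_of_int \<lfloor>max 0 (snd x) * 2 ^ n\<rfloor> + 1) / 2 ^ n)) \<in> borel_measurable (path_space \<Otimes>\<^sub>M (borel :: real measure))" for n :: nat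
  proof -
    have "(\<lambda>x. fst x (max 0 ((real_of_int k + 1) / 2 ^ n))) \<in> borel_measurable (path_space \<Otimes>\<^sub>M (borel :: real measure))" for k
      by (rule measurable_compose[OF measurable_fst measurable_component_singleton]) simp
    moreover have "(\<lambda>x. \<lfloor>max 0 (snd x) * 2 ^ n\<rfloor>) \<in> measurable (path_space \<Otimes>\<^sub>M (borel :: real measure)) (count_space UNIV)"
      by measurable
    ultimately have "(\<lambda>x. fst x (max 0 ((real_of_int \<lfloor>max 0 (snd x) * 2 ^ n\<rfloor> + 1) / 2 ^ n))) \<in> borel_measurable (path_space \<Otimes>\<^sub>M (borel :: real measure))"
      by (rule measurable_compose_countable)
    moreover have "max 0 ((real_of_int \<lfloor>max 0 (s :: real) * 2 ^ n\<rfloor> + 1) / 2 ^ n) = (real_of_int \<lfloor>max 0 s * 2 ^ n\<rfloor> + 1) / 2 ^ n" for s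
      by (intro max_absorb2 divide_nonneg_nonneg add_nonneg_nonneg) auto
    ultimately show ?thesis by simp
  qed
  have c: "Measurable.pred (path_space \<Otimes>\<^sub>M (borel :: real measure))
      (\<lambda>x. convergent (\<lambda>n. fst x ((real_of_int \<lfloor>max 0 (snd x) * 2 ^ n\<rfloor> + 1) / 2 ^ n)))"
    unfolding Cauchy_convergent_iff[symmetric] pred_def by (rule sets_Collect_Cauchy) (rule m)
  show ?thesis unfolding path_eval_def case_prod_beta'
    by (rule measurable_If[OF _ _ c[unfolded pred_def]]) (auto intro!: borel_measurable_lim_metric m)
qed

lemma path_eval_continuous:
  assumes "continuous_on {0..} f" "0 \<le> t" shows "path_eval (\<lambda>t\<in>{0..}. f t) t = f t"
proof -
  have "(f \<longlongrightarrow> f t) (at t within {0..})" using assms by (auto simp: continuous_on_def)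
  then have "(f \<longlongrightarrow> f t) (at_right t)"
    by (rule tendsto_within_subset) (use assms in auto)
  then have "(\<lambda>n. f ((real_of_int \<lfloor>t * 2 ^ n\<rfloor> + 1) / 2 ^ n)) \<longlonglongrightarrow> f t"
    by (rule filterlim_compose[OF _ filterlim_dyadic_at_right])
  moreover have "0 \<le> (real_of_int \<lfloor>t * 2 ^ n\<rfloor> + 1) / 2 ^ n" for n :: nat
    using assms by (intro divide_nonneg_nonneg add_nonneg_nonneg) auto
  ultimately have "(\<lambda>n. (\<lambda>t\<in>{0..}. f t) ((real_of_int \<lfloor>max 0 t * 2 ^ n\<rfloor> + 1) / 2 ^ n)) \<longlonglongrightarrow> f t"
    using assms(2) by simp
  then show ?thesis unfolding path_eval_def by (auto simp: convergent_def limI)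
qed

text \<open>The dyadic times approximating \<open>t\<close> lie to its right by up to 1, hence the
  supremum has to reach t + 1.\<close>

lemma path_eval_bound:
  assumes b0: "b 0 = 0" and N: "t + 1 \<le> real N" and K: "path_sup N b \<le> ennreal K" "0 \<le> K" and t: "0 \<le> t"
  shows "\<bar>path_eval b t\<bar> \<le> real N * K"
proof -
  have N1: "1 \<le> N" using N t by linarith
  have le: "\<bar>b ((real_of_int \<lfloor>max 0 t * 2 ^ n\<rfloor> + 1) / 2 ^ n)\<bar> \<le> real N * K" for n :: nat
  proof -
    define k where "k = nat (\<lfloor>t * 2 ^ n\<rfloor> + 1)"
    have k: "real k = real_of_int \<lfloor>t * 2 ^ n\<rfloor> + 1" using t by (simp add: k_def)
    have "real k \<le> t * 2 ^ n + 1 * 2 ^ n" using k one_le_power[of "2::real" n] of_int_floor_le[of "t * 2 ^ n"] unfolding mult_1 by linarith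
    also have "\<dots> = (t + 1) * 2 ^ n" by (simp add: distrib_right)
    also have "\<dots> \<le> real N * 2 ^ n" using N by (intro mult_right_mono) auto
    finally have "real k \<le> real (N * 2 ^ n)" by simp
    then have "k \<le> N * 2 ^ n" by (simp only: of_nat_le_iff)
    from dyadic_le_path_sup[OF b0 N1 this K] show ?thesis using k t by simp
  qed
  show ?thesis
  proof (cases "convergent (\<lambda>n. b ((real_of_int \<lfloor>max 0 t * 2 ^ n\<rfloor> + 1) / 2 ^ n))")
    case True
    then have "(\<lambda>n. b ((real_of_int \<lfloor>max 0 t * 2 ^ n\<rfloor> + 1) / 2 ^ n)) \<longlonglongrightarrow> path_eval b t"
      by (simp add: path_eval_def convergent_LIMSEQ_iff)
    then show ?thesis
      by (rule LIMSEQ_le_const2[OF tendsto_rabs]) (use le in blast)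
  next
    case False
    then show ?thesis using K by (simp add: path_eval_def)
  qed
qed

section \<open>Dependence of the flow on the initial configuration\<close>

lemma (in near_drift) solves_weighted_lipschitz:
  assumes x: "solves G (\<lambda>_. u) T x" and w: "weight a w"
    and le: "\<And>s i. 0 \<le> s \<Longrightarrow> s \<le> T \<Longrightarrow> \<bar>x s i\<bar> \<le> K * w i" and K: "0 \<le> K"
  shows "continuous_on {0..T} (\<lambda>s. x s i)"
proof -
  define B where "B = C * (2 * a + 2) * (K * w i)"
  have B0: "0 \<le> B" using C_nonneg weight_nonneg[OF w] K w by (simp add: B_def weight_def less_imp_le)
  have tx: "tame T x" using x by (simp add: solves_def)
  have wpos: "0 < w j" for j using w by (simp add: weight_def)
  have Gb: "\<bar>G s (x s) i\<bar> \<le> B" if "0 \<le> s" "s \<le> T" for s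
    using lip_weight[OF w, of "x s" "\<lambda>_. 0" K s i] le[OF that] K by (simp add: zero B_def)
  have inc: "\<bar>x u i - x c i\<bar> \<le> B * (u - c)" if "0 \<le> c" "c \<le> u" "u \<le> T" for c u
  proof -
    have "x u i - x c i = (LBINT s:{0..u}. G s (x s) i) - (LBINT s:{0..c}. G s (x s) i)"
      using x that by (simp add: solves_def)
    then show ?thesis
      using set_integral_Icc_increment_le[OF tame_integrable[OF tx order_refl, of i] that, of B] Gb that by auto
  qed
  have "B-lipschitz_on {0..T} (\<lambda>s. x s i)"
  proof (rule lipschitz_onI)
    fix s u assume "s \<in> {0..T}" "u \<in> {0..T}"
    then show "dist (x s i) (x u i) \<le> B * dist s u"
      using inc[of s u] inc[of u s] by (cases "s \<le> u") (auto simp: dist_real_def abs_minus_commute)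
  qed (rule B0)
  then show ?thesis by (rule lipschitz_on_continuous_on)
qed

text \<open>At a negative value, follow the trajectory back to the last time it was nonnegative: since then the
  diagonal term only pushes upwards, so the negative part is fed by the neighbours alone.\<close>

lemma site_solution_nonneg:
  fixes A :: "real \<Rightarrow> int \<Rightarrow> real"
  assumes C: "0 \<le> C" and A: "\<And>s i. 0 \<le> A s i" "\<And>s i. A s i \<le> C" and m: "\<And>i. (\<lambda>s. A s i) \<in> borel_measurable borel"
    and u: "\<And>i. 0 \<le> u i" and z: "solves (site_drift A) (\<lambda>_. u) T z"
    and le: "\<And>s i. 0 \<le> s \<Longrightarrow> s \<le> T \<Longrightarrow> \<bar>z s i\<bar> \<le> K" and t: "0 \<le> t" "t \<le> T"
  shows "0 \<le> z t i"
proof -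
  interpret near_drift C "site_drift A" by (rule near_drift_site[OF C A m])
  have K: "0 \<le> K" using le[of t i] t by linarith
  have tz: "tame T z" using z by (simp add: solves_def)
  have cont: "continuous_on {0..T} (\<lambda>s. z s i)" for i
    by (rule solves_weighted_lipschitz[OF z weight_one _ K]) (use le in simp)
  \<comment> \<open>Only the two neighbours feed the negative part, each with a coefficient at most
    \<open>C\<close>; hence 2 * C in place of 4 * C.\<close>
  have "- (K * ((2 * C * t) ^ n / fact n)) \<le> z t i" if "0 \<le> t" "t \<le> T" for n t i
    using that
  proof (induction n arbitrary: t i)
    case 0
    then show ?case using le[of t i] by simp
  next
    case (Suc n)
    let ?q = "\<lambda>s. K * (2 * C * ((2 * C * s) ^ n / fact n))"
    show ?case
    proof (cases "0 \<le> z t i")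
      case True
      have "0 \<le> K * ((2 * C * t) ^ Suc n / fact (Suc n))"
        using K C Suc.prems by (intro mult_nonneg_nonneg divide_nonneg_nonneg zero_le_power) auto
      then show ?thesis using True by linarith
    next
      case False
      define R where "R = {s \<in> {0..t}. 0 \<le> z s i}"
      have "compact R"
      proof -
        have "closed R" unfolding R_def
          by (intro continuous_on_closed_Collect_le continuous_on_const continuous_on_subset[OF cont])
            (use Suc.prems in auto)
        moreover have "R = {0..t} \<inter> R" by (auto simp: R_def)
        ultimately show ?thesis using compact_Int_closed[of "{0..t}" R] by simp
      qed
      moreover have "0 \<in> R"
        using z u[of i] Suc.prems by (simp add: R_def solves_def set_integral_singleton)
      ultimately obtain t0 where t0: "t0 \<in> R" "\<And>s. s \<in> R \<Longrightarrow> s \<le> t0"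
        using compact_attains_sup[of R] by blast
      have t0t: "0 \<le> t0" "t0 \<le> t" "0 \<le> z t0 i" using t0(1) by (auto simp: R_def)
      have neg: "z s i < 0" if "t0 < s" "s \<le> t" for s
      proof (rule ccontr)
        assume "\<not> z s i < 0"
        then have "s \<in> R" using that t0t by (simp add: R_def)
        then show False using t0(2)[of s] that by simp
      qed
      define g where "g s = site_drift A s (z s) i" for s
      have gm[measurable]: "g \<in> borel_measurable borel"
        unfolding g_def by (rule meas) (use tz in \<open>simp add: tame_def\<close>)
      have gi: "set_integrable lborel {0..t} g"
        unfolding g_def using tame_integrable[OF tz Suc.prems(2), of i] .
      \<comment> \<open>The drift is split at the last nonnegative time \<open>t0\<close>: the part
        \<open>g0\<close> up to \<open>t0\<close> is accounted for by the value
        \<open>z t0 i\<close>, which is nonnegative, and \<open>f\<close> is the negative part of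
        the drift after \<open>t0\<close>, the only contribution left to estimate.\<close>
      define g0 where "g0 s = (if s \<le> t0 then g s else 0)" for s
      define f where "f s = (if t0 < s then min 0 (g s) else 0)" for s
      have fm[measurable]: "f \<in> borel_measurable borel" and g0m[measurable]: "g0 \<in> borel_measurable borel"
        unfolding f_def g0_def by measurable
      have abs_min: "\<bar>min 0 y\<bar> \<le> q" if "- q \<le> y" "0 \<le> q" for y q :: real
        using that by (auto simp: min_def)
      have lower: "\<bar>f s\<bar> \<le> ?q s" if s: "0 \<le> s" "s \<le> t" for s
      proof (cases "t0 < s")
        case True
        have zn: "- (K * ((2 * C * s) ^ n / fact n)) \<le> z s j" for j
          using Suc.IH[of s j] s Suc.prems by auto
        have nn: "0 \<le> K * ((2 * C * s) ^ n / fact n)"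
          using K C s by (intro mult_nonneg_nonneg divide_nonneg_nonneg zero_le_power) auto
        have b: "- (C * (K * ((2 * C * s) ^ n / fact n))) \<le> A s j * z s j" for j
        proof -
          have "A s j * - (K * ((2 * C * s) ^ n / fact n)) \<le> A s j * z s j"
            by (intro mult_left_mono zn A)
          moreover have "A s j * (K * ((2 * C * s) ^ n / fact n)) \<le> C * (K * ((2 * C * s) ^ n / fact n))"
            by (intro mult_right_mono A nn)
          ultimately show ?thesis by simp
        qed
        have "A s i * z s i \<le> 0" using neg[OF True s(2)] A[of s i] by (intro mult_nonneg_nonpos) auto
        then have "- (2 * (C * (K * ((2 * C * s) ^ n / fact n)))) \<le> g s"
          using b[of "i + 1"] b[of "i - 1"] unfolding g_def site_drift_def by linarith
        moreover have "2 * (C * (K * ((2 * C * s) ^ n / fact n))) = ?q s" by (simp only: ac_simps)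
        ultimately have "- ?q s \<le> g s" by (simp only:)
        moreover have "0 \<le> ?q s" using K C s by (intro mult_nonneg_nonneg divide_nonneg_nonneg zero_le_power) auto
        ultimately have "\<bar>min 0 (g s)\<bar> \<le> ?q s" by (rule abs_min)
        then show ?thesis using True by (simp only: f_def if_True)
      next
        case False
        have "0 \<le> ?q s" using K C s by (intro mult_nonneg_nonneg divide_nonneg_nonneg zero_le_power) auto
        then show ?thesis using False by (simp add: f_def)
      qed
      have "\<bar>LBINT s:{0..t}. f s\<bar> \<le> K * ((2 * C * t) ^ Suc n / fact (Suc n)) - K * ((2 * C * 0) ^ Suc n / fact (Suc n))"
      proof (rule set_integral_abs_le_FTC[OF fm Suc.prems(1) lower])
        show "((\<lambda>s. K * ((2 * C * s) ^ Suc n / fact (Suc n))) has_real_derivative K * (2 * C * ((2 * C * s) ^ n / fact n))) (at s)" for s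
          by (rule DERIV_cmult[OF has_real_derivative_power_fact])
      qed (auto intro!: continuous_intros)
      then have F: "- (K * ((2 * C * t) ^ Suc n / fact (Suc n))) \<le> (LBINT s:{0..t}. f s)" by simp
      have gi0: "set_integrable lborel {0..t} g0" and fi: "set_integrable lborel {0..t} f"
        by (rule set_integrable_bound[OF gi], simp add: set_borel_measurable_def,
            rule AE_I2, simp add: g0_def f_def min_def)+
      have "(LBINT s:{0..t}. f s) \<le> (LBINT s:{0..t}. g s - g0 s)"
        by (rule set_integral_mono[OF fi set_integral_diff(1)[OF gi gi0]]) (auto simp: f_def g0_def)
      also have "\<dots> = (LBINT s:{0..t}. g s) - (LBINT s:{0..t}. g0 s)"
        by (rule set_integral_diff(2)[OF gi gi0])
      also have "(LBINT s:{0..t}. g0 s) = (LBINT s:{0..t0}. g s)"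
        unfolding set_lebesgue_integral_def
        by (rule Bochner_Integration.integral_cong) (use t0t in \<open>auto simp: g0_def indicator_def\<close>)
      also have "(LBINT s:{0..t}. g s) - (LBINT s:{0..t0}. g s) = z t i - z t0 i"
        using z Suc.prems t0t by (simp add: solves_def g_def)
      finally show ?thesis using F t0t by linarith
    qed
  qed
  note bound = this[OF t, of _ i]
  have "(\<lambda>n. - (K * ((2 * C * t) ^ n / fact n))) \<longlonglongrightarrow> - (K * 0)"
    by (intro tendsto_minus tendsto_mult_left power_fact_tendsto_0)
  from LIMSEQ_le_const2[OF this] bound show ?thesis by auto
qed

text \<open>At a fixed order, pointwise convergence of uniformly bounded coefficients passes through
  each integral by dominated convergence, without any rate. Uniformity over the coefficients is
  later supplied by the factorial error bound.\<close>

lemma pic_site_tendsto: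
  fixes A :: "real \<Rightarrow> int \<Rightarrow> real" and A' :: "nat \<Rightarrow> real \<Rightarrow> int \<Rightarrow> real"
  assumes C: "0 \<le> C" and A: "\<And>s i. 0 \<le> A s i" "\<And>s i. A s i \<le> C" and m: "\<And>i. (\<lambda>s. A s i) \<in> borel_measurable borel"
    and A': "\<And>k s i. 0 \<le> A' k s i" "\<And>k s i. A' k s i \<le> C" and m': "\<And>k i. (\<lambda>s. A' k s i) \<in> borel_measurable borel"
    and lim: "\<And>s i. 0 \<le> s \<Longrightarrow> s \<le> T \<Longrightarrow> (\<lambda>k. A' k s i) \<longlonglongrightarrow> A s i"
    and t: "0 \<le> t" "t \<le> T"
  shows "(\<lambda>k. pic (site_drift (A' k)) (unit_at a) n t i) \<longlonglongrightarrow> pic (site_drift A) (unit_at a) n t i"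
  using t
proof (induction n arbitrary: t i)
  case (Suc n)
  interpret A: near_drift C "site_drift A" by (rule near_drift_site[OF C A m])
  interpret A': near_drift C "site_drift (A' k)" for k by (rule near_drift_site[OF C A' m'])
  let ?p = "pic (site_drift A) (unit_at a) n" and ?p' = "\<lambda>k. pic (site_drift (A' k)) (unit_at a) n"
  have [measurable]: "(\<lambda>s. site_drift A s (?p s) i) \<in> borel_measurable borel"
    by (rule A.meas) (use A.tame_pic[OF tame_unit_at[of 0 a]] in \<open>simp add: tame_def\<close>)
  have [measurable]: "(\<lambda>s. site_drift (A' k) s (?p' k s) i) \<in> borel_measurable borel" for k
    by (rule A'.meas) (use A'.tame_pic[OF tame_unit_at[of 0 a]] in \<open>simp add: tame_def\<close>)
  have "(\<lambda>k. LBINT s:{0..t}. site_drift (A' k) s (?p' k s) i) \<longlonglongrightarrow> (LBINT s:{0..t}. site_drift A s (?p s) i)"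
    unfolding set_lebesgue_integral_def
  proof (rule integral_dominated_convergence[where w = "\<lambda>s. indicator {0..t} s *\<^sub>R (C * 4 * exp (C * 4 * t))"])
    show "integrable lborel (\<lambda>s. indicator {0..t} s *\<^sub>R (C * 4 * exp (C * 4 * t)))"
      by (intro integrable_scaleR_left) (simp add: integrable_indicator_iff emeasure_lborel_Icc_eq)
    show "AE s in lborel. (\<lambda>k. indicator {0..t} s *\<^sub>R site_drift (A' k) s (?p' k s) i) \<longlonglongrightarrow> indicator {0..t} s *\<^sub>R site_drift A s (?p s) i"
    proof (rule AE_I2)
      fix s :: real
      show "(\<lambda>k. indicator {0..t} s *\<^sub>R site_drift (A' k) s (?p' k s) i) \<longlonglongrightarrow> indicator {0..t} s *\<^sub>R site_drift A s (?p s) i"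
      proof (cases "s \<in> {0..t}")
        case True
        then have s: "0 \<le> s" "s \<le> T" using Suc.prems by auto
        have "(\<lambda>k. site_drift (A' k) s (?p' k s) i) \<longlonglongrightarrow> site_drift A s (?p s) i"
          by (simp only: site_drift_def) (intro tendsto_diff tendsto_add tendsto_mult tendsto_const lim s Suc.IH)
        then show ?thesis using True by simp
      qed simp
    qed
    show "AE s in lborel. norm (indicator {0..t} s *\<^sub>R site_drift (A' k) s (?p' k s) i) \<le> indicator {0..t} s *\<^sub>R (C * 4 * exp (C * 4 * t))" for k
    proof (rule AE_I2)
      fix s :: real
      show "norm (indicator {0..t} s *\<^sub>R site_drift (A' k) s (?p' k s) i) \<le> indicator {0..t} s *\<^sub>R (C * 4 * exp (C * 4 * t))"
      proof (cases "s \<in> {0..t}")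
        case True
        then have s: "0 \<le> s" "s \<le> t" by auto
        have "\<bar>?p' k s j - 0\<bar> \<le> exp (C * 4 * t) * 1" for j
        proof -
          have "\<bar>?p' k s j\<bar> \<le> 1 * 1 * exp (C * (2 * 1 + 2) * s)"
            by (rule A'.pic_bound[OF weight_one tame_unit_at[of t]]) (use s in \<open>auto simp: unit_at_def\<close>)
          also have "\<dots> \<le> exp (C * 4 * t)" using s C by (simp add: mult_left_mono)
          finally show ?thesis by simp
        qed
        from A'.lip_weight[where k = k and s = s and i = i, OF weight_one this] True show ?thesis by (simp add: A'.zero)
      qed simp
    qed
  qed measurable
  then show ?case by (auto intro: tendsto_add)
qed simp

section \<open>The nonlinear flow and its derivative in one coordinate\<close>

context convex_potential
begin

definition gl_drift :: "real \<Rightarrow> (int \<Rightarrow> real) \<Rightarrow> int \<Rightarrow> real" where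
  "gl_drift s x i = deriv V (x (i + 1)) + deriv V (x (i - 1)) - 2 * deriv V (x i)"

sublocale gl: near_drift Cp gl_drift
proof
  fix s x y i
  show "\<bar>gl_drift s x i - gl_drift s y i\<bar>
      \<le> Cp * (\<bar>x (i + 1) - y (i + 1)\<bar> + \<bar>x (i - 1) - y (i - 1)\<bar> + 2 * \<bar>x i - y i\<bar>)"
    using V'_lipschitz[of "x (i + 1)" "y (i + 1)"] V'_lipschitz[of "x (i - 1)" "y (i - 1)"] V'_lipschitz[of "x i" "y i"]
    unfolding gl_drift_def distrib_left by linarith
next
  fix x :: "real \<Rightarrow> int \<Rightarrow> real" and i
  assume [measurable]: "\<And>j. (\<lambda>s. x s j) \<in> borel_measurable borel"
  show "(\<lambda>s. gl_drift s (x s) i) \<in> borel_measurable borel" unfolding gl_drift_def by measurable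
qed (use Cp_pos in \<open>auto simp: gl_drift_def\<close>)

definition forcing :: "(int \<Rightarrow> real) \<Rightarrow> (int \<Rightarrow> real \<Rightarrow> real) \<Rightarrow> real \<Rightarrow> int \<Rightarrow> real" where
  "forcing \<zeta> b t i = \<zeta> i + sqrt 2 * (path_eval (b i) t - path_eval (b (i - 1)) t)"

definition gl_flow :: "(int \<Rightarrow> real) \<Rightarrow> (int \<Rightarrow> real \<Rightarrow> real) \<Rightarrow> real \<Rightarrow> int \<Rightarrow> real" where
  "gl_flow \<zeta> b = flow gl_drift (forcing \<zeta> b)"

text \<open>Introduced as the solution of the linearised equation; that it is a derivative of the
  flow in \<open>\<zeta> 0\<close> is the content of \<open>difference_quotient_tendsto\<close>.
  Being a limit of iterates, it is jointly measurable.\<close>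

definition gl_derivative :: "(int \<Rightarrow> real) \<Rightarrow> (int \<Rightarrow> real \<Rightarrow> real) \<Rightarrow> real \<Rightarrow> int \<Rightarrow> real" where
  "gl_derivative \<zeta> b = flow (site_drift (stiffness (gl_flow \<zeta> b))) (unit_at 0)"

text \<open>What the pathwise theory needs on [0, T], with weight and constants hidden so that the
  condition is stable under changing one coordinate.\<close>

definition admissible :: "real \<Rightarrow> (int \<Rightarrow> real) \<Rightarrow> (int \<Rightarrow> real \<Rightarrow> real) \<Rightarrow> bool" where
  "admissible T \<zeta> b \<longleftrightarrow> tame T (forcing \<zeta> b) \<and>
    (\<exists>a w K. weight a w \<and> 0 \<le> K \<and> (\<forall>s\<in>{0..T}. \<forall>i. \<bar>forcing \<zeta> b s i\<bar> \<le> K * w i))"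

lemma admissible_upd:
  assumes "admissible T \<zeta> b" shows "admissible T (\<zeta>(j := x)) b"
proof -
  obtain a w K where w: "weight a w" and K: "0 \<le> K" and le: "\<And>s i. s \<in> {0..T} \<Longrightarrow> \<bar>forcing \<zeta> b s i\<bar> \<le> K * w i"
    using assms unfolding admissible_def by blast
  have wpos: "0 < w i" for i using w by (simp add: weight_def)
  have e: "forcing (\<zeta>(j := x)) b s i = forcing \<zeta> b s i + (if i = j then x - \<zeta> j else 0)" for s i
    by (simp add: forcing_def)
  define K' where "K' = K + \<bar>x - \<zeta> j\<bar> / w j"
  have le': "\<bar>forcing (\<zeta>(j := x)) b s i\<bar> \<le> K' * w i" if "0 \<le> s" "s \<le> T" for s i
  proof (cases "i = j")
    case True
    then show ?thesis using le[of s j] that wpos[of j] by (simp add: e K'_def distrib_right)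
  next
    case False
    have "0 \<le> \<bar>x - \<zeta> j\<bar> / w j * w i"
      using wpos[of i] wpos[of j] by (intro mult_nonneg_nonneg divide_nonneg_nonneg) auto
    moreover have "\<bar>forcing \<zeta> b s i\<bar> \<le> K * w i" using le that by simp
    ultimately show ?thesis using False unfolding e K'_def distrib_right by simp
  qed
  have "tame T (forcing (\<zeta>(j := x)) b)"
  proof (rule tame_weightI[OF _ le'])
    show "(\<lambda>s. forcing (\<zeta>(j := x)) b s i) \<in> borel_measurable borel" for i
      unfolding e using assms by (intro borel_measurable_add) (auto simp: admissible_def tame_def)
  qed
  moreover have "0 \<le> K'" using K wpos[of j] by (simp add: K'_def)
  ultimately show ?thesis using w le' unfolding admissible_def by (intro conjI exI[of _ a] exI[of _ w] exI[of _ K']) auto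
qed

lemma
  assumes "admissible T \<zeta> b"
  shows gl_flow_solves: "solves gl_drift (forcing \<zeta> b) T (gl_flow \<zeta> b)"
    and pic_tendsto_gl_flow: "0 \<le> t \<Longrightarrow> t \<le> T \<Longrightarrow> (\<lambda>n. pic gl_drift (forcing \<zeta> b) n t i) \<longlonglongrightarrow> gl_flow \<zeta> b t i"
    and gl_flow_measurable: "(\<lambda>s. gl_flow \<zeta> b s i) \<in> borel_measurable borel"
proof -
  obtain a w K where w: "weight a w" and K: "0 \<le> K" and le: "\<And>s i. s \<in> {0..T} \<Longrightarrow> \<bar>forcing \<zeta> b s i\<bar> \<le> K * w i"
    and tame: "tame T (forcing \<zeta> b)"
    using assms unfolding admissible_def by blast
  show "solves gl_drift (forcing \<zeta> b) T (gl_flow \<zeta> b)"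
    unfolding gl_flow_def by (rule gl.flow_solves[OF w tame K]) (use le in auto)
  show "(\<lambda>n. pic gl_drift (forcing \<zeta> b) n t i) \<longlonglongrightarrow> gl_flow \<zeta> b t i" if "0 \<le> t" "t \<le> T"
    unfolding gl_flow_def by (rule gl.pic_tendsto_flow[OF w tame K _ that]) (use le in auto)
  show "(\<lambda>s. gl_flow \<zeta> b s i) \<in> borel_measurable borel"
    unfolding gl_flow_def by (rule gl.flow_measurable[OF tame])
qed

text \<open>Configurations that differ at one site have a bounded difference although each may be
  unbounded, so the stability estimate applies with the constant weight 1.\<close>

lemma gl_flow_lipschitz:
  assumes "admissible T \<zeta> b" "0 \<le> t" "t \<le> T"
  shows "\<bar>gl_flow (\<zeta>(j := x)) b t i - gl_flow (\<zeta>(j := y)) b t i\<bar> \<le> exp (4 * Cp * t) * \<bar>x - y\<bar>"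
proof -
  have ax: "admissible T (\<zeta>(j := x)) b" and ay: "admissible T (\<zeta>(j := y)) b"
    by (rule admissible_upd[OF assms(1)])+
  have "\<bar>pic gl_drift (forcing (\<zeta>(j := x)) b) n t i - pic gl_drift (forcing (\<zeta>(j := y)) b) n t i\<bar>
      \<le> \<bar>x - y\<bar> * 1 * exp (Cp * (2 * 1 + 2) * t)" for n
    by (rule gl.pic_stable[OF weight_one, where T = T]) (use ax ay assms in \<open>auto simp: admissible_def forcing_def\<close>)
  then have "\<bar>pic gl_drift (forcing (\<zeta>(j := x)) b) n t i - pic gl_drift (forcing (\<zeta>(j := y)) b) n t i\<bar>
      \<le> exp (4 * Cp * t) * \<bar>x - y\<bar>" for n by (simp add: ac_simps)
  then show ?thesis
    using LIMSEQ_le_const2[OF tendsto_rabs[OF tendsto_diff[OF pic_tendsto_gl_flow[OF ax assms(2,3)] pic_tendsto_gl_flow[OF ay assms(2,3)]]]]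
    by blast
qed

definition slope_V' :: "real \<Rightarrow> real \<Rightarrow> real" where
  "slope_V' x y = (if y = x then deriv (deriv V) x else (deriv V y - deriv V x) / (y - x))"

lemma slope_V'_mult: "slope_V' x y * (y - x) = deriv V y - deriv V x"
  by (simp add: slope_V'_def)

lemma slope_V'_bounds: "0 \<le> slope_V' x y" "slope_V' x y \<le> Cp"
proof -
  have "0 \<le> slope_V' x y \<and> slope_V' x y \<le> Cp"
  proof (rule linorder_cases[of x y])
    assume "x < y"
    then have "0 < Cm * (y - x)" "Cm * (y - x) \<le> deriv V y - deriv V x" "deriv V y - deriv V x \<le> Cp * (y - x)"
      using V'_increment[of x y] Cm_pos by auto
    then show ?thesis using \<open>x < y\<close>
      by (simp add: slope_V'_def pos_divide_le_eq)
  next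
    assume "y < x"
    then have "0 < Cm * (x - y)" "Cm * (x - y) \<le> deriv V x - deriv V y" "deriv V x - deriv V y \<le> Cp * (x - y)"
      using V'_increment[of y x] Cm_pos by auto
    moreover have "slope_V' x y = (deriv V x - deriv V y) / (x - y)"
      using \<open>y < x\<close> minus_divide_divide[of "deriv V x - deriv V y" "x - y"] by (simp add: slope_V'_def)
    ultimately show ?thesis using \<open>y < x\<close>
      by (simp add: pos_divide_le_eq)
  next
    assume "x = y"
    then show ?thesis using V''_lower[of x] V''_upper[of x] Cm_pos by (simp add: slope_V'_def)
  qed
  then show "0 \<le> slope_V' x y" "slope_V' x y \<le> Cp" by auto
qed

text \<open>The endpoint \<open>x\<close> is fixed, so differentiability of \<open>V'\<close> at
  \<open>x\<close> suffices and \<open>V''\<close> may be discontinuous. This is why solutions are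
  compared through secants and not through intermediate values of \<open>V''\<close>.\<close>

lemma slope_V'_tendsto:
  assumes "(y \<longlongrightarrow> x) F" shows "((\<lambda>n. slope_V' x (y n)) \<longlongrightarrow> deriv (deriv V) x) F"
proof -
  obtain g where g: "\<And>z. deriv V z - deriv V x = g z * (z - x)" "isCont g x" "g x = deriv (deriv V) x"
    using DERIV_V'[of x] unfolding CARAT_DERIV by blast
  have "slope_V' x z = g z" for z
    using g(1)[of z] g(3) by (auto simp: slope_V'_def)
  moreover have "((\<lambda>n. g (y n)) \<longlongrightarrow> g x) F" by (rule isCont_tendsto_compose[OF g(2) assms])
  ultimately show ?thesis using g(3) by simp
qed

lemma slope_V'_measurable [measurable]:
  assumes [measurable]: "f \<in> borel_measurable N" "g \<in> borel_measurable N"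
  shows "(\<lambda>s. slope_V' (f s) (g s)) \<in> borel_measurable N"
  unfolding slope_V'_def by measurable

text \<open>The difference quotient of two solutions driven by the same noise solves the linear site
  equation with the secant slopes of \<open>V'\<close> as coefficients.\<close>

lemma difference_solves_site:
  fixes h :: real
  assumes adm: "admissible T \<zeta> b" and T: "0 \<le> T"
  defines "A \<equiv> \<lambda>s j. slope_V' (gl_flow \<zeta> b s j) (gl_flow (\<zeta>(0 := \<zeta> 0 + h)) b s j)"
  shows "solves (site_drift A) (\<lambda>s j. h * unit_at 0 s j) T (\<lambda>s j. gl_flow (\<zeta>(0 := \<zeta> 0 + h)) b s j - gl_flow \<zeta> b s j)"
proof -
  let ?\<zeta>' = "\<zeta>(0 := \<zeta> 0 + h)"
  let ?x = "gl_flow \<zeta> b" and ?y = "gl_flow ?\<zeta>' b"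
  have adm': "admissible T ?\<zeta>' b" by (rule admissible_upd[OF adm])
  note x = gl_flow_solves[OF adm] and y = gl_flow_solves[OF adm']
  have tame: "tame T ?x" "tame T ?y" using x y by (auto simp: solves_def)
  have "\<bar>?y s j - ?x s j\<bar> \<le> exp (4 * Cp * T) * \<bar>h\<bar> * 1" if "0 \<le> s" "s \<le> T" for s j
  proof -
    have "\<bar>?y s j - ?x s j\<bar> \<le> exp (4 * Cp * s) * \<bar>h\<bar>"
      using gl_flow_lipschitz[OF adm that, of 0 "\<zeta> 0 + h" j "\<zeta> 0"] by simp
    also have "\<dots> \<le> exp (4 * Cp * T) * \<bar>h\<bar>"
      using that Cp_pos by (intro mult_right_mono) auto
    finally show ?thesis by simp
  qed
  then have tame_diff: "tame T (\<lambda>s j. ?y s j - ?x s j)"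
    using tame by (intro tame_weightI[where w = "\<lambda>_. 1"]) (auto simp: tame_def intro!: borel_measurable_diff)
  have "?y t i - ?x t i = h * unit_at 0 t i + (LBINT s:{0..t}. site_drift A s (\<lambda>j. ?y s j - ?x s j) i)"
    if t: "t \<in> {0..T}" for t i
  proof -
    have "site_drift A s (\<lambda>j. ?y s j - ?x s j) i = gl_drift s (?y s) i - gl_drift s (?x s) i" for s
      unfolding site_drift_def gl_drift_def A_def slope_V'_mult by simp
    moreover have "(LBINT s:{0..t}. gl_drift s (?y s) i - gl_drift s (?x s) i)
        = (LBINT s:{0..t}. gl_drift s (?y s) i) - (LBINT s:{0..t}. gl_drift s (?x s) i)"
      using t by (intro set_integral_diff(2) gl.tame_integrable[OF tame(1)] gl.tame_integrable[OF tame(2)]) auto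
    ultimately show ?thesis
      using x y t by (simp add: solves_def forcing_def unit_at_def)
  qed
  then show ?thesis using tame_diff by (auto simp: solves_def)
qed

lemma gl_flow_mono:
  assumes adm: "admissible T \<zeta> b" and t: "0 \<le> t" "t \<le> T" and h: "0 \<le> h"
  shows "gl_flow \<zeta> b t i \<le> gl_flow (\<zeta>(0 := \<zeta> 0 + h)) b t i"
proof -
  let ?\<zeta>' = "\<zeta>(0 := \<zeta> 0 + h)"
  define A where "A s j = slope_V' (gl_flow \<zeta> b s j) (gl_flow ?\<zeta>' b s j)" for s j
  have adm': "admissible T ?\<zeta>' b" by (rule admissible_upd[OF adm])
  note [measurable] = gl_flow_measurable[OF adm] gl_flow_measurable[OF adm']
  have unit: "(\<lambda>s j. h * unit_at 0 s j) = (\<lambda>_ j. if j = 0 then h else 0)"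
    by (simp add: unit_at_def fun_eq_iff)
  have "0 \<le> gl_flow ?\<zeta>' b t i - gl_flow \<zeta> b t i"
  proof (rule site_solution_nonneg[where A = A and C = Cp and T = T and u = "\<lambda>j. if j = 0 then h else 0"
        and z = "\<lambda>s j. gl_flow ?\<zeta>' b s j - gl_flow \<zeta> b s j" and K = "exp (4 * Cp * T) * \<bar>h\<bar>"])
    show "solves (site_drift A) (\<lambda>_ j. if j = 0 then h else 0) T (\<lambda>s j. gl_flow ?\<zeta>' b s j - gl_flow \<zeta> b s j)"
      using difference_solves_site[OF adm, of h] t unfolding unit A_def by simp
    show "\<bar>gl_flow ?\<zeta>' b s j - gl_flow \<zeta> b s j\<bar> \<le> exp (4 * Cp * T) * \<bar>h\<bar>" if "0 \<le> s" "s \<le> T" for s j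
    proof -
      have "\<bar>gl_flow ?\<zeta>' b s j - gl_flow \<zeta> b s j\<bar> \<le> exp (4 * Cp * s) * \<bar>h\<bar>"
        using gl_flow_lipschitz[OF adm that, of 0 "\<zeta> 0 + h" j "\<zeta> 0"] by simp
      also have "\<dots> \<le> exp (4 * Cp * T) * \<bar>h\<bar>"
        using that Cp_pos by (intro mult_right_mono) auto
      finally show ?thesis .
    qed
    show "(\<lambda>s. A s j) \<in> borel_measurable borel" for j unfolding A_def by measurable
  qed (use Cp_pos slope_V'_bounds h t in \<open>auto simp: A_def\<close>)
  then show ?thesis by simp
qed

lemma stiffness_measurable:
  "(\<And>j. (\<lambda>s. x s j) \<in> borel_measurable borel) \<Longrightarrow> (\<lambda>s. stiffness x s j) \<in> borel_measurable borel"
  unfolding stiffness_def by measurable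

lemma near_drift_stiffness:
  assumes "\<And>j. (\<lambda>s. x s j) \<in> borel_measurable borel"
  shows "near_drift Cp (site_drift (stiffness x))" "near_drift Cp (bond_drift (stiffness x))"
  using Cp_pos stiffness_bounds stiffness_measurable[OF assms]
  by (auto intro!: near_drift_site near_drift_bond)

lemma site_flow_error:
  assumes nd: "near_drift Cp (site_drift A)" and t: "0 \<le> t"
  shows "\<bar>flow (site_drift A) (unit_at a) t i - pic (site_drift A) (unit_at a) n t i\<bar>
      \<le> exp (4 * Cp * t) * ((4 * Cp * t) ^ n / fact n)"
    and "\<bar>pic (site_drift A) (unit_at a) n t i\<bar> \<le> exp (4 * Cp * t)"
proof -
  interpret near_drift Cp "site_drift A" by (rule nd)
  have u: "\<bar>unit_at a s j\<bar> \<le> 1 * 1" for s j by (simp add: unit_at_def)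
  note sol = flow_solves[OF weight_one tame_unit_at[of t a] zero_le_one u]
  have fb: "\<bar>flow (site_drift A) (unit_at a) s j\<bar> \<le> exp (4 * Cp * t) * 1" if "0 \<le> s" "s \<le> t" for s j
  proof -
    have "\<bar>flow (site_drift A) (unit_at a) s j\<bar> \<le> 1 * 1 * exp (Cp * (2 * 1 + 2) * s)"
      by (rule flow_bound[OF weight_one tame_unit_at[of t a] zero_le_one u that])
    also have "\<dots> \<le> exp (4 * Cp * t)" using that Cp_pos by simp
    finally show ?thesis by simp
  qed
  have "\<bar>flow (site_drift A) (unit_at a) t i - pic (site_drift A) (unit_at a) n t i\<bar>
      \<le> exp (4 * Cp * t) * 1 * ((Cp * (2 * 1 + 2) * t) ^ n / fact n)"
    by (rule pic_error[OF weight_one tame_unit_at[of t a] sol _ fb]) (use t in auto)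
  then show "\<bar>flow (site_drift A) (unit_at a) t i - pic (site_drift A) (unit_at a) n t i\<bar>
      \<le> exp (4 * Cp * t) * ((4 * Cp * t) ^ n / fact n)" by (simp add: ac_simps)
  have "\<bar>pic (site_drift A) (unit_at a) n t i\<bar> \<le> 1 * 1 * exp (Cp * (2 * 1 + 2) * t)"
    by (rule pic_bound[OF weight_one tame_unit_at[of t a] zero_le_one u t order_refl])
  then show "\<bar>pic (site_drift A) (unit_at a) n t i\<bar> \<le> exp (4 * Cp * t)" by (simp add: ac_simps)
qed

text \<open>The difference quotient solves a site equation whose coefficients are secant slopes, and
  these converge to the stiffness. Replacing both solutions by iterates of a common order costs an
  error independent of the step, and at that order the iterates converge.\<close>

lemma difference_quotient_tendsto:
  assumes adm: "admissible T \<zeta> b" and t: "0 \<le> t" "t \<le> T"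
  shows "(\<lambda>k. (gl_flow \<zeta> b t i - gl_flow (\<zeta>(0 := \<zeta> 0 - ibp_step k)) b t i) / ibp_step k) \<longlonglongrightarrow> gl_derivative \<zeta> b t i"
proof -
  \<comment> \<open>Backward steps, to match the quotients in \<open>site_ibp\<close>; the sign
    cancels in the quotient.\<close>
  define h where "h k = - ibp_step k" for k
  define \<zeta>' where "\<zeta>' k = \<zeta>(0 := \<zeta> 0 + h k)" for k
  have h: "h k \<noteq> 0" "h \<longlonglongrightarrow> 0" for k
    using ibp_step tendsto_minus[OF ibp_step(3)] by (auto simp: h_def[abs_def] less_imp_neq[THEN not_sym])
  define A where "A k s j = slope_V' (gl_flow \<zeta> b s j) (gl_flow (\<zeta>' k) b s j)" for k s j
  have adm': "admissible T (\<zeta>' k) b" for k unfolding \<zeta>'_def by (rule admissible_upd[OF adm])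
  note m[measurable] = gl_flow_measurable[OF adm] gl_flow_measurable[OF adm']
  have Am: "(\<lambda>s. A k s j) \<in> borel_measurable borel" for k j unfolding A_def by measurable
  have A: "0 \<le> A k s j" "A k s j \<le> Cp" for k s j by (simp_all add: A_def slope_V'_bounds)
  have ndA: "near_drift Cp (site_drift (A k))" for k by (rule near_drift_site) (use A Am Cp_pos in auto)
  have ndS: "near_drift Cp (site_drift (stiffness (gl_flow \<zeta> b)))" by (rule near_drift_stiffness) (rule m)
  have T: "0 \<le> T" using t by simp
  define \<delta> where "\<delta> k s j = (gl_flow (\<zeta>' k) b s j - gl_flow \<zeta> b s j) / h k" for k s j
  have d_bound: "\<bar>\<delta> k s j\<bar> \<le> exp (4 * Cp * T) * 1" if "0 \<le> s" "s \<le> T" for k s j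
  proof -
    have "\<bar>gl_flow (\<zeta>' k) b s j - gl_flow \<zeta> b s j\<bar> \<le> exp (4 * Cp * s) * \<bar>h k\<bar>"
      using gl_flow_lipschitz[OF adm that, of 0 "\<zeta> 0 + h k" j "\<zeta> 0"] by (simp add: \<zeta>'_def)
    then have "\<bar>\<delta> k s j\<bar> \<le> exp (4 * Cp * s)" using h(1)[of k] by (simp add: \<delta>_def abs_divide divide_le_eq)
    also have "\<dots> \<le> exp (4 * Cp * T)" using that Cp_pos by simp
    finally show ?thesis by simp
  qed
  have d_solves: "solves (site_drift (A k)) (unit_at 0) T (\<delta> k)" for k
  proof -
    have *: "solves (site_drift (A k)) (\<lambda>s j. h k * unit_at 0 s j) T (\<lambda>s j. gl_flow (\<zeta>' k) b s j - gl_flow \<zeta> b s j)"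
      using difference_solves_site[OF adm T, of "h k"] unfolding A_def \<zeta>'_def .
    have scale: "site_drift (A k) s (\<delta> k s) j = site_drift (A k) s (\<lambda>j. gl_flow (\<zeta>' k) b s j - gl_flow \<zeta> b s j) j / h k" for s j
      by (simp only: site_drift_def \<delta>_def times_divide_eq_right add_divide_distrib[symmetric] diff_divide_distrib[symmetric])
    have "tame T (\<delta> k)"
      using d_bound by (intro tame_weightI[where w = "\<lambda>_. 1"]) (auto simp: \<delta>_def)
    moreover have "\<delta> k t i = unit_at 0 t i + (LBINT s:{0..t}. site_drift (A k) s (\<delta> k s) i)" if "t \<in> {0..T}" for t i
    proof -
      have "\<delta> k t i = (h k * unit_at 0 t i + (LBINT s:{0..t}. site_drift (A k) s (\<lambda>j. gl_flow (\<zeta>' k) b s j - gl_flow \<zeta> b s j) i)) / h k"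
        using * that by (simp add: solves_def \<delta>_def)
      then show ?thesis unfolding scale using h(1)[of k] by (simp add: add_divide_distrib)
    qed
    ultimately show ?thesis by (auto simp: solves_def)
  qed
  have d_flow: "\<delta> k t i = flow (site_drift (A k)) (unit_at 0) t i" for k
    by (rule near_drift.solves_eq_flow[OF ndA weight_one tame_unit_at d_solves d_bound t])
  have A_lim: "(\<lambda>k. A k s j) \<longlonglongrightarrow> stiffness (gl_flow \<zeta> b) s j" if "0 \<le> s" "s \<le> T" for s j
    unfolding A_def stiffness_def
  proof (rule slope_V'_tendsto)
    have "(\<lambda>k. gl_flow (\<zeta>' k) b s j - gl_flow \<zeta> b s j) \<longlonglongrightarrow> 0"
    proof (rule Lim_null_comparison[OF always_eventually[OF allI]])
      show "norm (gl_flow (\<zeta>' k) b s j - gl_flow \<zeta> b s j) \<le> exp (4 * Cp * s) * \<bar>h k\<bar>" for k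
        using gl_flow_lipschitz[OF adm that, of 0 "\<zeta> 0 + h k" j "\<zeta> 0"] by (simp add: \<zeta>'_def)
      show "(\<lambda>k. exp (4 * Cp * s) * \<bar>h k\<bar>) \<longlonglongrightarrow> 0"
        by (intro tendsto_mult_right_zero tendsto_rabs_zero h)
    qed
    then show "(\<lambda>k. gl_flow (\<zeta>' k) b s j) \<longlonglongrightarrow> gl_flow \<zeta> b s j" by (rule LIM_zero_cancel)
  qed
  define \<epsilon> where "\<epsilon> n = exp (4 * Cp * t) * ((4 * Cp * t) ^ n / fact n)" for n
  have \<epsilon>: "\<epsilon> \<longlonglongrightarrow> 0" unfolding \<epsilon>_def[abs_def] by (intro tendsto_mult_right_zero power_fact_tendsto_0)
  have "(\<lambda>k. \<delta> k t i) \<longlonglongrightarrow> gl_derivative \<zeta> b t i"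
  proof (rule LIMSEQ_I)
    fix e :: real assume e: "0 < e"
    obtain n where n: "\<bar>\<epsilon> n\<bar> < e / 4" using LIMSEQ_D[OF \<epsilon>, of "e / 4"] e by auto
    have "(\<lambda>k. pic (site_drift (A k)) (unit_at 0) n t i) \<longlonglongrightarrow> pic (site_drift (stiffness (gl_flow \<zeta> b))) (unit_at 0) n t i"
      by (rule pic_site_tendsto[OF _ _ _ _ A Am A_lim t])
        (use Cp_pos stiffness_bounds stiffness_measurable[of "gl_flow \<zeta> b"] m in auto)
    then obtain k0 where k0: "\<And>k. k0 \<le> k \<Longrightarrow> \<bar>pic (site_drift (A k)) (unit_at 0) n t i - pic (site_drift (stiffness (gl_flow \<zeta> b))) (unit_at 0) n t i\<bar> < e / 4"
      using LIMSEQ_D[of _ _ "e / 4"] e by (metis real_norm_def zero_less_divide_iff zero_less_numeral)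
    have "norm (\<delta> k t i - gl_derivative \<zeta> b t i) < e" if "k0 \<le> k" for k
      using site_flow_error(1)[OF ndA[of k] t(1), of 0 i n] site_flow_error(1)[OF ndS t(1), of 0 i n] k0[OF that] n
      unfolding d_flow gl_derivative_def \<epsilon>_def[symmetric] real_norm_def by linarith
    then show "\<exists>k0. \<forall>k\<ge>k0. norm (\<delta> k t i - gl_derivative \<zeta> b t i) < e" by blast
  qed
  moreover have "\<delta> k t i = (gl_flow \<zeta> b t i - gl_flow (\<zeta>(0 := \<zeta> 0 - ibp_step k)) b t i) / ibp_step k" for k
    using ibp_step(1)[of k] by (simp add: \<delta>_def \<zeta>'_def h_def divide_simps)
  ultimately show ?thesis by simp
qed

text \<open>With everything but \<open>\<zeta> 0\<close> frozen, the flow is a nondecreasing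
  Lipschitz function of one real variable. The mean of its difference quotients has two limits, one
  from integration by parts and one from differentiation of the flow, which must coincide.\<close>

lemma resampled_covariance_bounds:
  fixes l :: real
  assumes adm: "admissible T \<zeta> b" and t: "0 \<le> t" "t \<le> T"
    and m: "(\<lambda>x. gl_derivative (\<zeta>(0 := x)) b t i) \<in> borel_measurable borel"
  defines "mean \<equiv> (LINT x|site_measure V l. x)"
  shows "1 / Cp * (LINT x|site_measure V l. gl_derivative (\<zeta>(0 := x)) b t i)
      \<le> (LINT x|site_measure V l. (x - mean) * gl_flow (\<zeta>(0 := x)) b t i)"
    and "(LINT x|site_measure V l. (x - mean) * gl_flow (\<zeta>(0 := x)) b t i)
      \<le> 1 / Cm * (LINT x|site_measure V l. gl_derivative (\<zeta>(0 := x)) b t i)"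
proof -
  define f where "f x = gl_flow (\<zeta>(0 := x)) b t i" for x
  have lip: "\<bar>f x - f y\<bar> \<le> exp (4 * Cp * t) * \<bar>x - y\<bar>" for x y
    unfolding f_def by (rule gl_flow_lipschitz[OF adm t])
  have mono: "f x \<le> f y" if "x \<le> y" for x y
    using gl_flow_mono[OF admissible_upd[OF adm, of 0 x] t, of "y - x" i] that by (simp add: f_def)
  have [measurable]: "f \<in> borel_measurable borel" by (rule lipschitz_measurable[OF lip])
  have lim: "(\<lambda>k. LINT x|site_measure V l. (f x - f (x - ibp_step k)) / ibp_step k)
      \<longlonglongrightarrow> (LINT x|site_measure V l. gl_derivative (\<zeta>(0 := x)) b t i)"
  proof (rule integral_dominated_convergence[where w = "\<lambda>_. exp (4 * Cp * t)"])
    show "AE x in site_measure V l. (\<lambda>k. (f x - f (x - ibp_step k)) / ibp_step k) \<longlonglongrightarrow> gl_derivative (\<zeta>(0 := x)) b t i"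
      using difference_quotient_tendsto[OF admissible_upd[OF adm, of 0] t, of _ i] by (intro AE_I2) (simp add: f_def)
    show "AE x in site_measure V l. norm ((f x - f (x - ibp_step k)) / ibp_step k) \<le> exp (4 * Cp * t)" for k
    proof (rule AE_I2)
      fix x
      show "norm ((f x - f (x - ibp_step k)) / ibp_step k) \<le> exp (4 * Cp * t)"
        using lip[of x "x - ibp_step k"] ibp_step(1)[of k] by (simp add: abs_divide divide_le_eq)
    qed
  qed (use m in simp_all)
  have eq: "(LINT x|site_measure V l. (deriv V x - l) * f x) = (LINT x|site_measure V l. gl_derivative (\<zeta>(0 := x)) b t i)"
    by (rule LIMSEQ_unique[OF site_ibp[OF lip] lim])
  show "1 / Cp * (LINT x|site_measure V l. gl_derivative (\<zeta>(0 := x)) b t i)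
      \<le> (LINT x|site_measure V l. (x - mean) * gl_flow (\<zeta>(0 := x)) b t i)"
    "(LINT x|site_measure V l. (x - mean) * gl_flow (\<zeta>(0 := x)) b t i)
      \<le> 1 / Cm * (LINT x|site_measure V l. gl_derivative (\<zeta>(0 := x)) b t i)"
    using site_covariance_bounds[OF mono lip, of l] unfolding eq mean_def by (simp_all add: f_def)
qed

end

section \<open>The product of initial law and noise\<close>

lemma AE_pair_fst:
  assumes M2: "sigma_finite_measure M2" and P: "AE x in M1. P x" shows "AE z in M1 \<Otimes>\<^sub>M M2. P (fst z)"
proof -
  interpret sigma_finite_measure M2 by fact
  obtain N where N: "{x \<in> space M1. \<not> P x} \<subseteq> N" "emeasure M1 N = 0" "N \<in> sets M1"
    using P by (rule AE_E)
  show ?thesis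
  proof (rule AE_I)
    show "{z \<in> space (M1 \<Otimes>\<^sub>M M2). \<not> P (fst z)} \<subseteq> N \<times> space M2"
      using N(1) by (auto simp: space_pair_measure)
    show "emeasure (M1 \<Otimes>\<^sub>M M2) (N \<times> space M2) = 0"
      using N by (simp add: emeasure_pair_measure_Times)
  qed (use N in simp)
qed

lemma AE_pair_snd:
  assumes M2: "sigma_finite_measure M2" and P: "AE y in M2. P y" shows "AE z in M1 \<Otimes>\<^sub>M M2. P (snd z)"
proof -
  interpret sigma_finite_measure M2 by fact
  obtain N where N: "{x \<in> space M2. \<not> P x} \<subseteq> N" "emeasure M2 N = 0" "N \<in> sets M2"
    using P by (rule AE_E)
  show ?thesis
  proof (rule AE_I)
    show "{z \<in> space (M1 \<Otimes>\<^sub>M M2). \<not> P (snd z)} \<subseteq> space M1 \<times> N"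
      using N(1) by (auto simp: space_pair_measure)
    show "emeasure (M1 \<Otimes>\<^sub>M M2) (space M1 \<times> N) = 0"
      using N by (simp add: emeasure_pair_measure_Times)
  qed (use N in simp)
qed

lemma nn_integral_PiM_component:
  assumes "\<And>i. i \<in> I \<Longrightarrow> prob_space (M i)" "i \<in> I" "f \<in> borel_measurable (M i)"
  shows "(\<integral>\<^sup>+x. f (x i) \<partial>PiM I M) = (\<integral>\<^sup>+y. f y \<partial>M i)"
proof -
  have "(\<integral>\<^sup>+y. f y \<partial>M i) = (\<integral>\<^sup>+y. f y \<partial>distr (PiM I M) (M i) (\<lambda>x. x i))"
    using assms by (simp add: distr_PiM_component)
  also have "\<dots> = (\<integral>\<^sup>+x. f (x i) \<partial>PiM I M)"
    using assms by (intro nn_integral_distr) auto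
  finally show ?thesis ..
qed

text \<open>The values are summed with weights exp (- k |i|). The sum has finite mean, hence is
  finite almost surely; it dominates each of its terms and serves as the random constant
  \<open>K\<close>.\<close>

lemma AE_PiM_exponential_growth:
  fixes f :: "'b \<Rightarrow> ennreal" and k :: real
  assumes prob: "prob_space N" and f[measurable]: "f \<in> borel_measurable N" and fin: "(\<integral>\<^sup>+y. f y \<partial>N) < \<infinity>" and k: "0 < k"
  shows "AE x in (\<Pi>\<^sub>M i\<in>(UNIV :: int set). N). \<exists>K\<ge>0. \<forall>i. f (x i) \<le> ennreal (K * exp (k * real_of_int \<bar>i\<bar>))"
proof -
  let ?P = "\<Pi>\<^sub>M i\<in>(UNIV :: int set). N"
  define Z where "Z x = (\<Sum>n. ennreal (exp (- k) ^ n) * (f (x (int n)) + f (x (- int n))))" for x :: "int \<Rightarrow> 'b"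
  have [measurable]: "(\<lambda>x. x i) \<in> ?P \<rightarrow>\<^sub>M N" for i by (rule measurable_component_singleton) simp
  have comp: "(\<integral>\<^sup>+x. f (x i) \<partial>?P) = (\<integral>\<^sup>+y. f y \<partial>N)" for i
    by (rule nn_integral_PiM_component) (use prob in auto)
  have "(\<integral>\<^sup>+x. Z x \<partial>?P) = (\<Sum>n. \<integral>\<^sup>+x. ennreal (exp (- k) ^ n) * (f (x (int n)) + f (x (- int n))) \<partial>?P)"
    unfolding Z_def by (rule nn_integral_suminf) measurable
  also have "\<dots> = (\<Sum>n. ennreal (exp (- k) ^ n) * (2 * (\<integral>\<^sup>+y. f y \<partial>N)))"
    by (simp add: nn_integral_cmult nn_integral_add comp mult_2)
  also have "\<dots> = (\<Sum>n. ennreal (exp (- k) ^ n)) * (2 * (\<integral>\<^sup>+y. f y \<partial>N))"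
    by (rule ennreal_suminf_multc)
  also have "(\<Sum>n. ennreal (exp (- k) ^ n)) = ennreal (\<Sum>n. exp (- k) ^ n)"
    by (rule suminf_ennreal2) (use k in \<open>auto intro!: summable_geometric\<close>)
  also have "ennreal (\<Sum>n. exp (- k) ^ n) * (2 * (\<integral>\<^sup>+y. f y \<partial>N)) < \<infinity>"
    using fin by (simp add: ennreal_mult_less_top)
  finally have "AE x in ?P. Z x \<noteq> \<infinity>"
    by (intro nn_integral_PInf_AE) (auto simp: Z_def)
  then show ?thesis
  proof eventually_elim
    case (elim x)
    define K where "K = enn2real (Z x)"
    have Z: "Z x = ennreal K" using elim by (simp add: K_def less_top)
    have "f (x i) \<le> ennreal (K * exp (k * real_of_int \<bar>i\<bar>))" for i
    proof -
      define n where "n = nat \<bar>i\<bar>"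
      have n: "real n = real_of_int \<bar>i\<bar>" "i = int n \<or> i = - int n" by (auto simp: n_def)
      have "ennreal (exp (- k) ^ n) * f (x i) \<le> ennreal (exp (- k) ^ n) * (f (x (int n)) + f (x (- int n)))"
        using n(2) by (intro mult_left_mono) (auto simp: add_increasing add_increasing2)
      also have "\<dots> = (\<Sum>n\<in>{n}. ennreal (exp (- k) ^ n) * (f (x (int n)) + f (x (- int n))))" by simp
      also have "\<dots> \<le> Z x" unfolding Z_def by (rule sum_le_suminf) auto
      finally have "ennreal (exp (k * n)) * (ennreal (exp (- k) ^ n) * f (x i)) \<le> ennreal (exp (k * n)) * ennreal K"
        unfolding Z by (intro mult_left_mono) auto
      moreover have "ennreal (exp (k * n)) * ennreal (exp (- k) ^ n) = 1"
        by (simp add: ennreal_mult[symmetric] exp_of_nat_mult[symmetric] exp_add[symmetric] mult.commute)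
      moreover have "ennreal (exp (k * n)) * ennreal K = ennreal (K * exp (k * n))"
        by (simp add: K_def ennreal_mult[symmetric] mult.commute)
      ultimately show ?thesis unfolding n(1)[symmetric] by (simp add: mult.assoc[symmetric])
    qed
    then show ?case by (intro exI[of _ K]) (auto simp: K_def)
  qed
qed

lemma pic_shift:
  assumes G: "\<And>s x i. G' s (\<lambda>j. x (j + 1)) i = G s x (i + 1)" and v: "\<And>t i. v' t i = v t (i + 1)"
  shows "pic G' v' n t i = pic G v n t (i + 1)"
proof (induction n arbitrary: t i)
  case (Suc n)
  have "pic G' v' n s = (\<lambda>j. pic G v n s (j + 1))" for s using Suc by (intro ext)
  then have "(LBINT s:{0..t}. G' s (pic G' v' n s) i) = (LBINT s:{0..t}. G s (pic G v n s) (i + 1))"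
    by (simp only: G)
  then show ?case by (simp only: pic.simps v[of t i])
qed simp

abbreviation config_space :: "(int \<Rightarrow> real) measure" where
  "config_space \<equiv> (\<Pi>\<^sub>M i\<in>UNIV. borel)"

abbreviation noise_space :: "(int \<Rightarrow> real \<Rightarrow> real) measure" where
  "noise_space \<equiv> (\<Pi>\<^sub>M i\<in>UNIV. path_space)"

text \<open>The growth rate is a parameter because it has to match the weighted space of a given
  solution, where it is r / 2; for admissibility under the product law the rate 1 is used.\<close>

definition good_noise :: "real \<Rightarrow> nat \<Rightarrow> (int \<Rightarrow> real \<Rightarrow> real) \<Rightarrow> bool" where
  "good_noise k N b \<longleftrightarrow> (\<forall>i. b i 0 = 0) \<and>
    (\<exists>K\<ge>0. \<forall>i. path_sup N (b i) \<le> ennreal (K * exp (k * real_of_int \<bar>i\<bar>)))"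

lemma noise_component: "(\<lambda>b. b i) \<in> noise_space \<rightarrow>\<^sub>M path_space"
  by (rule measurable_component_singleton) simp

context convex_potential
begin

lemma forcing_bound:
  assumes k: "0 \<le> k" and T: "0 \<le> T" "T + 1 \<le> real N" and good: "good_noise k N b"
    and \<zeta>: "\<And>i. \<bar>\<zeta> i\<bar> \<le> K0 * exp (k * real_of_int \<bar>i\<bar>)"
  obtains S where "0 \<le> S" "\<And>s i. 0 \<le> s \<Longrightarrow> s \<le> T \<Longrightarrow> \<bar>forcing \<zeta> b s i\<bar> \<le> S * exp (k * real_of_int \<bar>i\<bar>)"
proof -
  let ?w = "\<lambda>i. exp (k * real_of_int \<bar>i\<bar>)"
  obtain K where K: "0 \<le> K" "\<And>i. path_sup N (b i) \<le> ennreal (K * ?w i)" and b0: "\<And>i. b i 0 = 0"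
    using good unfolding good_noise_def by blast
  have pe: "\<bar>path_eval (b i) s\<bar> \<le> real N * K * ?w i" if "0 \<le> s" "s \<le> T" for i s
    using path_eval_bound[where b = "b i" and t = s and N = N, OF b0 _ K(2)] that T K(1) by simp
  have w: "?w (i - 1) \<le> exp k * ?w i" for i using weight_exp[OF k] by (simp add: weight_def)
  define S where "S = \<bar>K0\<bar> + sqrt 2 * (real N * K + real N * K * exp k)"
  have "\<bar>forcing \<zeta> b s i\<bar> \<le> S * ?w i" if s: "0 \<le> s" "s \<le> T" for s i
  proof -
    have "\<bar>forcing \<zeta> b s i\<bar> \<le> \<bar>\<zeta> i\<bar> + sqrt 2 * (\<bar>path_eval (b i) s\<bar> + \<bar>path_eval (b (i - 1)) s\<bar>)"
      unfolding forcing_def by (rule order_trans[OF abs_triangle_ineq]) (simp add: abs_mult)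
    also have "\<dots> \<le> \<bar>K0\<bar> * ?w i + sqrt 2 * (real N * K * ?w i + real N * K * (exp k * ?w i))"
    proof (intro add_mono mult_left_mono)
      show "\<bar>\<zeta> i\<bar> \<le> \<bar>K0\<bar> * ?w i" by (rule order_trans[OF \<zeta>]) (intro mult_right_mono, auto)
      show "\<bar>path_eval (b i) s\<bar> \<le> real N * K * ?w i" by (rule pe[OF s])
      show "\<bar>path_eval (b (i - 1)) s\<bar> \<le> real N * K * (exp k * ?w i)"
        by (rule order_trans[OF pe[OF s]]) (intro mult_left_mono w, use K in auto)
    qed auto
    also have "\<dots> = S * ?w i" by (simp add: S_def algebra_simps)
    finally show ?thesis .
  qed
  moreover have "0 \<le> S" using K(1) by (simp add: S_def)
  ultimately show ?thesis using that by blast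
qed

lemma forcing_measurable:
  assumes "b \<in> space noise_space" shows "(\<lambda>s. forcing \<zeta> b s i) \<in> borel_measurable borel"
proof -
  have "(\<lambda>s. path_eval (b j) s) \<in> borel_measurable borel" for j
    using measurable_compose[OF measurable_Pair1'[OF measurable_space[OF noise_component assms]] path_eval_measurable] by simp
  then show ?thesis unfolding forcing_def by measurable
qed

lemma admissibleI:
  assumes k: "0 \<le> k" and T: "0 \<le> T" "T + 1 \<le> real N" and good: "good_noise k N b" and b: "b \<in> space noise_space"
    and \<zeta>: "\<And>i. \<bar>\<zeta> i\<bar> \<le> K0 * exp (k * real_of_int \<bar>i\<bar>)"
  shows "admissible T \<zeta> b"
proof -
  obtain S where S: "0 \<le> S" "\<And>s i. 0 \<le> s \<Longrightarrow> s \<le> T \<Longrightarrow> \<bar>forcing \<zeta> b s i\<bar> \<le> S * exp (k * real_of_int \<bar>i\<bar>)"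
    using forcing_bound[where \<zeta> = \<zeta>, OF k T good \<zeta>] by blast
  have "tame T (forcing \<zeta> b)" by (rule tame_weightI[OF forcing_measurable[OF b] S(2)])
  then show ?thesis unfolding admissible_def using weight_exp[OF k] S
    by (intro conjI exI[of _ "exp k"] exI[of _ "\<lambda>i. exp (k * real_of_int \<bar>i\<bar>)"] exI[of _ S] ballI allI) auto
qed

end

text \<open>\<open>\<beta>\<close> plays the role of the law of one bond's noise path, reduced to
  two facts: it starts at 0 and has integrable dyadic suprema. The canonical space of initial
  configuration and noise is built on it.\<close>

locale gl_product = convex_potential +
  fixes l :: real and \<beta> :: "(real \<Rightarrow> real) measure"
  assumes \<beta>_prob: "prob_space \<beta>" and \<beta>_sets [measurable_cong]: "sets \<beta> = sets path_space"
    and \<beta>_start: "AE b in \<beta>. b 0 = 0" and \<beta>_sup: "\<And>N. (\<integral>\<^sup>+b. path_sup N b \<partial>\<beta>) < \<infinity>"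
begin

definition config :: "(int \<Rightarrow> real) measure" where
  "config = (\<Pi>\<^sub>M i\<in>UNIV. site_measure V l)"

definition noise :: "(int \<Rightarrow> real \<Rightarrow> real) measure" where
  "noise = (\<Pi>\<^sub>M i\<in>UNIV. \<beta>)"

definition joint :: "((int \<Rightarrow> real) \<times> (int \<Rightarrow> real \<Rightarrow> real)) measure" where
  "joint = config \<Otimes>\<^sub>M noise"

lemma sets_config [measurable_cong]: "sets config = sets config_space"
  unfolding config_def by (rule sets_PiM_cong) auto

lemma sets_noise [measurable_cong]: "sets noise = sets noise_space"
  unfolding noise_def by (rule sets_PiM_cong) (auto simp: \<beta>_sets)

lemma space_noise: "space noise = space noise_space"
  by (rule sets_eq_imp_space_eq[OF sets_noise])

lemma sets_joint [measurable_cong]: "sets joint = sets (config_space \<Otimes>\<^sub>M noise_space)"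
  unfolding joint_def by (rule sets_pair_measure_cong[OF sets_config sets_noise])

sublocale config: prob_space config
  unfolding config_def by (rule prob_space_PiM) (rule site.prob_space_axioms)

sublocale noise: prob_space noise
  unfolding noise_def by (rule prob_space_PiM) (rule \<beta>_prob)

sublocale config_noise: pair_prob_space config noise ..

sublocale joint: prob_space joint
  unfolding joint_def by (rule config_noise.prob_space_axioms)

lemma joint_fst: "fst \<in> joint \<rightarrow>\<^sub>M config_space" and joint_snd: "snd \<in> joint \<rightarrow>\<^sub>M noise_space"
  unfolding measurable_cong_sets[OF sets_joint refl] by (rule measurable_fst measurable_snd)+

lemma joint_fst_component [measurable]: "(\<lambda>z. fst z i) \<in> borel_measurable joint"
  by (rule measurable_compose[OF joint_fst measurable_component_singleton]) simp

lemma joint_snd_component: "(\<lambda>z. snd z i) \<in> joint \<rightarrow>\<^sub>M path_space"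
  by (rule measurable_compose[OF joint_snd noise_component])

lemma forcing_joint [measurable]:
  "(\<lambda>(z, s). forcing (fst z) (snd z) s i) \<in> borel_measurable (joint \<Otimes>\<^sub>M borel)"
proof -
  have "(\<lambda>x. (snd (fst x) j, snd x)) \<in> joint \<Otimes>\<^sub>M borel \<rightarrow>\<^sub>M path_space \<Otimes>\<^sub>M (borel :: real measure)" for j
    by (intro measurable_Pair measurable_compose[OF measurable_fst joint_snd_component] measurable_snd)
  from measurable_compose[OF this path_eval_measurable]
  have [measurable]: "(\<lambda>x. path_eval (snd (fst x) j) (snd x)) \<in> borel_measurable (joint \<Otimes>\<^sub>M borel)" for j
    by simp
  show ?thesis unfolding forcing_def case_prod_beta' by measurable
qed

lemma joint_section:
  assumes "(\<lambda>(z, s). f z s) \<in> borel_measurable (joint \<Otimes>\<^sub>M borel)" shows "(\<lambda>z. f z (t :: real)) \<in> borel_measurable joint"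
  using measurable_compose[OF measurable_Pair2'[of t borel joint] assms] by simp

lemma pic_gl_joint [measurable]:
  "(\<lambda>(z, s). pic gl_drift (forcing (fst z) (snd z)) n s i) \<in> borel_measurable (joint \<Otimes>\<^sub>M borel)"
proof (rule pic_jointly_measurable[where G = "\<lambda>_. gl_drift" and v = "\<lambda>z. forcing (fst z) (snd z)"])
  fix x :: "(int \<Rightarrow> real) \<times> (int \<Rightarrow> real \<Rightarrow> real) \<Rightarrow> real \<Rightarrow> int \<Rightarrow> real" and i
  assume [measurable]: "\<And>j. (\<lambda>(\<omega>, s). x \<omega> s j) \<in> borel_measurable (joint \<Otimes>\<^sub>M borel)"
  show "(\<lambda>(\<omega>, s). gl_drift s (x \<omega> s) i) \<in> borel_measurable (joint \<Otimes>\<^sub>M borel)"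
    unfolding gl_drift_def by measurable
qed (rule forcing_joint)

lemma gl_flow_joint [measurable]:
  "(\<lambda>(z, s). gl_flow (fst z) (snd z) s i) \<in> borel_measurable (joint \<Otimes>\<^sub>M borel)"
  using pic_gl_joint[of _ i] unfolding gl_flow_def flow_def case_prod_beta' by (rule borel_measurable_lim_metric)

lemma stiffness_joint [measurable]:
  "(\<lambda>(z, s). stiffness (gl_flow (fst z) (snd z)) s i) \<in> borel_measurable (joint \<Otimes>\<^sub>M borel)"
  using measurable_compose[OF gl_flow_joint[of i] V''_measurable] by (simp add: stiffness_def case_prod_beta')

lemma pic_site_joint [measurable]:
  "(\<lambda>(z, s). pic (site_drift (stiffness (gl_flow (fst z) (snd z)))) (unit_at a) n s i) \<in> borel_measurable (joint \<Otimes>\<^sub>M borel)"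
proof (rule pic_jointly_measurable[where G = "\<lambda>z. site_drift (stiffness (gl_flow (fst z) (snd z)))" and v = "\<lambda>_. unit_at a"])
  fix x :: "(int \<Rightarrow> real) \<times> (int \<Rightarrow> real \<Rightarrow> real) \<Rightarrow> real \<Rightarrow> int \<Rightarrow> real" and i
  assume [measurable]: "\<And>j. (\<lambda>(\<omega>, s). x \<omega> s j) \<in> borel_measurable (joint \<Otimes>\<^sub>M borel)"
  show "(\<lambda>(z, s). site_drift (stiffness (gl_flow (fst z) (snd z))) s (x z s) i) \<in> borel_measurable (joint \<Otimes>\<^sub>M borel)"
    unfolding site_drift_def by measurable
qed (simp add: unit_at_def)

lemma pic_bond_joint [measurable]:
  "(\<lambda>(z, s). pic (bond_drift (stiffness (gl_flow (fst z) (snd z)))) (unit_at a) n s i) \<in> borel_measurable (joint \<Otimes>\<^sub>M borel)"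
proof (rule pic_jointly_measurable[where G = "\<lambda>z. bond_drift (stiffness (gl_flow (fst z) (snd z)))" and v = "\<lambda>_. unit_at a"])
  fix x :: "(int \<Rightarrow> real) \<times> (int \<Rightarrow> real \<Rightarrow> real) \<Rightarrow> real \<Rightarrow> int \<Rightarrow> real" and i
  assume [measurable]: "\<And>j. (\<lambda>(\<omega>, s). x \<omega> s j) \<in> borel_measurable (joint \<Otimes>\<^sub>M borel)"
  show "(\<lambda>(z, s). bond_drift (stiffness (gl_flow (fst z) (snd z))) s (x z s) i) \<in> borel_measurable (joint \<Otimes>\<^sub>M borel)"
    unfolding bond_drift_def by measurable
qed (simp add: unit_at_def)

lemma gl_derivative_joint [measurable]:
  "(\<lambda>(z, s). gl_derivative (fst z) (snd z) s i) \<in> borel_measurable (joint \<Otimes>\<^sub>M borel)"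
  using pic_site_joint[of 0 _ i] unfolding gl_derivative_def flow_def case_prod_beta' by (rule borel_measurable_lim_metric)

lemma AE_good_noise:
  assumes k: "0 < k" shows "AE b in noise. good_noise k N b"
proof -
  have "AE b in noise. b i 0 = 0" for i
    unfolding noise_def using AE_PiM_component[of UNIV "\<lambda>_. \<beta>" i "\<lambda>b. b 0 = 0"] \<beta>_prob \<beta>_start by simp
  then have 1: "AE b in noise. \<forall>i. b i 0 = 0" by (simp add: AE_all_countable)
  have m: "path_sup N \<in> borel_measurable \<beta>" by measurable
  have "AE b in noise. \<exists>K\<ge>0. \<forall>i. path_sup N (b i) \<le> ennreal (K * exp (k * real_of_int \<bar>i\<bar>))"
    unfolding noise_def by (rule AE_PiM_exponential_growth[OF \<beta>_prob m \<beta>_sup k])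
  with 1 show ?thesis unfolding good_noise_def by eventually_elim blast
qed

lemma site_abs_finite: "(\<integral>\<^sup>+x. ennreal \<bar>x\<bar> \<partial>site_measure V l) < \<infinity>"
proof -
  have "integrable (site_measure V l) (\<lambda>x. x)" by (rule integrable_site_lipschitz[of _ 1]) simp
  then show ?thesis by (simp add: integrable_iff_bounded)
qed

lemma AE_admissible:
  assumes T: "0 \<le> T" shows "AE z in joint. admissible T (fst z) (snd z)"
proof -
  obtain N where N: "T + 1 \<le> real N" using real_arch_simple by blast
  have m: "(\<lambda>x. ennreal \<bar>x\<bar>) \<in> borel_measurable (site_measure V l)" by measurable
  have "AE \<zeta> in config. \<exists>K\<ge>0. \<forall>i. ennreal \<bar>\<zeta> i\<bar> \<le> ennreal (K * exp (1 * real_of_int \<bar>i\<bar>))"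
    unfolding config_def by (rule AE_PiM_exponential_growth[OF site.prob_space_axioms m site_abs_finite]) simp
  then have 1: "AE z in joint. \<exists>K\<ge>0. \<forall>i. ennreal \<bar>fst z i\<bar> \<le> ennreal (K * exp (1 * real_of_int \<bar>i\<bar>))"
    unfolding joint_def by (rule AE_pair_fst[OF noise.sigma_finite_measure_axioms])
  have 2: "AE z in joint. good_noise 1 N (snd z)"
    unfolding joint_def by (rule AE_pair_snd[OF noise.sigma_finite_measure_axioms AE_good_noise]) simp
  show ?thesis using 1 2 AE_space
  proof eventually_elim
    case (elim z)
    then obtain K where K: "0 \<le> K" "\<And>i. ennreal \<bar>fst z i\<bar> \<le> ennreal (K * exp (1 * real_of_int \<bar>i\<bar>))" by blast
    have "snd z \<in> space noise_space" using elim(3) by (auto simp: joint_def space_pair_measure space_noise)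
    moreover have "\<bar>fst z i\<bar> \<le> K * exp (1 * real_of_int \<bar>i\<bar>)" for i using K(2)[of i] K(1) by (simp add: ennreal_le_iff)
    ultimately show ?case using admissibleI[OF _ T N elim(2), of "fst z" K] by simp
  qed
qed

lemma nn_integral_joint_fst:
  assumes f: "f \<in> borel_measurable (site_measure V l)"
  shows "(\<integral>\<^sup>+z. f (fst z i) \<partial>joint) = (\<integral>\<^sup>+x. f x \<partial>site_measure V l)"
proof -
  have "f \<in> borel_measurable borel" using f by simp
  from measurable_compose[OF joint_fst_component this]
  have m: "(\<lambda>z. f (fst z i)) \<in> borel_measurable (config \<Otimes>\<^sub>M noise)" by (simp add: joint_def)
  have "(\<integral>\<^sup>+z. f (fst z i) \<partial>joint) = (\<integral>\<^sup>+\<zeta>. \<integral>\<^sup>+b. f (fst (\<zeta>, b) i) \<partial>noise \<partial>config)"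
    unfolding joint_def by (rule noise.nn_integral_fst[OF m, symmetric])
  also have "\<dots> = (\<integral>\<^sup>+\<zeta>. f (\<zeta> i) \<partial>config)" by (simp add: noise.emeasure_space_1)
  also have "\<dots> = (\<integral>\<^sup>+x. f x \<partial>site_measure V l)"
    unfolding config_def by (rule nn_integral_PiM_component) (use site.prob_space_axioms f in auto)
  finally show ?thesis .
qed

lemma nn_integral_joint_snd:
  assumes f: "f \<in> borel_measurable path_space"
  shows "(\<integral>\<^sup>+z. f (snd z i) \<partial>joint) = (\<integral>\<^sup>+x. f x \<partial>\<beta>)"
proof -
  have m: "(\<lambda>z. f (snd z i)) \<in> borel_measurable (config \<Otimes>\<^sub>M noise)"
    using measurable_compose[OF joint_snd_component f] by (simp add: joint_def)
  have "(\<integral>\<^sup>+z. f (snd z i) \<partial>joint) = (\<integral>\<^sup>+\<zeta>. \<integral>\<^sup>+b. f (snd (\<zeta>, b) i) \<partial>noise \<partial>config)"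
    unfolding joint_def by (rule noise.nn_integral_fst[OF m, symmetric])
  also have "\<dots> = (\<integral>\<^sup>+b. f (b i) \<partial>noise)" by (simp add: config.emeasure_space_1)
  also have "\<dots> = (\<integral>\<^sup>+x. f x \<partial>\<beta>)"
    unfolding noise_def by (rule nn_integral_PiM_component) (use \<beta>_prob f \<beta>_sets in \<open>auto cong: measurable_cong_sets\<close>)
  finally show ?thesis .
qed

lemma nn_integral_forcing_bounded:
  assumes T: "0 \<le> T"
  obtains c where "0 \<le> c" "\<And>t i. 0 \<le> t \<Longrightarrow> t \<le> T \<Longrightarrow> (\<integral>\<^sup>+z. ennreal \<bar>forcing (fst z) (snd z) t i\<bar> \<partial>joint) \<le> ennreal c"
proof -
  obtain N where N: "T + 1 \<le> real N" using real_arch_simple by blast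
  then have N1: "1 \<le> N" using T by linarith
  have pe: "AE b in \<beta>. ennreal \<bar>path_eval b t\<bar> \<le> ennreal (real N) * path_sup N b" if t: "0 \<le> t" "t \<le> T" for t
    using \<beta>_start
  proof eventually_elim
    case (elim b)
    show ?case
    proof (cases "path_sup N b = \<infinity>")
      case True
      then show ?thesis using N1 by (simp add: ennreal_mult_top)
    next
      case False
      define K where "K = enn2real (path_sup N b)"
      have K: "path_sup N b = ennreal K" "0 \<le> K" using False by (auto simp: K_def less_top)
      have "\<bar>path_eval b t\<bar> \<le> real N * K"
        by (rule path_eval_bound) (use elim N t K in auto)
      then show ?thesis using K by (simp add: ennreal_mult[symmetric] ennreal_leI)
    qed
  qed
  have pm: "(\<lambda>b. ennreal \<bar>path_eval b t\<bar>) \<in> borel_measurable path_space" for t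
    using measurable_compose[OF measurable_Pair2'[of t borel path_space] path_eval_measurable] by measurable
  define cb where "cb = ennreal (real N) * (\<integral>\<^sup>+b. path_sup N b \<partial>\<beta>)"
  have E: "(\<integral>\<^sup>+z. ennreal \<bar>path_eval (snd z i) t\<bar> \<partial>joint) \<le> cb" if "0 \<le> t" "t \<le> T" for t i
  proof -
    have "(\<integral>\<^sup>+z. ennreal \<bar>path_eval (snd z i) t\<bar> \<partial>joint) = (\<integral>\<^sup>+b. ennreal \<bar>path_eval b t\<bar> \<partial>\<beta>)"
      by (rule nn_integral_joint_snd[OF pm])
    also have "\<dots> \<le> (\<integral>\<^sup>+b. ennreal (real N) * path_sup N b \<partial>\<beta>)" by (rule nn_integral_mono_AE[OF pe[OF that]])
    also have "\<dots> = cb" unfolding cb_def by (rule nn_integral_cmult) measurable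
    finally show ?thesis .
  qed
  define C where "C = (\<integral>\<^sup>+x. ennreal \<bar>x\<bar> \<partial>site_measure V l) + ennreal (sqrt 2) * (cb + cb)"
  have "C < \<infinity>" unfolding C_def cb_def using site_abs_finite \<beta>_sup[of N] by (simp add: ennreal_mult_less_top)
  have bound: "(\<integral>\<^sup>+z. ennreal \<bar>forcing (fst z) (snd z) t i\<bar> \<partial>joint) \<le> C" if t: "0 \<le> t" "t \<le> T" for t i
  proof -
    have [measurable]: "(\<lambda>z. ennreal \<bar>path_eval (snd z j) t\<bar>) \<in> borel_measurable joint" for j
      by (rule measurable_compose[OF joint_snd_component pm])
    have "(\<integral>\<^sup>+z. ennreal \<bar>forcing (fst z) (snd z) t i\<bar> \<partial>joint)
        \<le> (\<integral>\<^sup>+z. ennreal \<bar>fst z i\<bar> + ennreal (sqrt 2) * (ennreal \<bar>path_eval (snd z i) t\<bar> + ennreal \<bar>path_eval (snd z (i - 1)) t\<bar>) \<partial>joint)"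
    proof (rule nn_integral_mono)
      fix z
      have "\<bar>forcing (fst z) (snd z) t i\<bar> \<le> \<bar>fst z i\<bar> + sqrt 2 * (\<bar>path_eval (snd z i) t\<bar> + \<bar>path_eval (snd z (i - 1)) t\<bar>)"
        unfolding forcing_def by (rule order_trans[OF abs_triangle_ineq]) (simp add: abs_mult)
      then show "ennreal \<bar>forcing (fst z) (snd z) t i\<bar>
          \<le> ennreal \<bar>fst z i\<bar> + ennreal (sqrt 2) * (ennreal \<bar>path_eval (snd z i) t\<bar> + ennreal \<bar>path_eval (snd z (i - 1)) t\<bar>)"
        by (simp add: ennreal_mult[symmetric] ennreal_plus[symmetric] ennreal_leI del: ennreal_plus)
    qed
    also have "\<dots> = (\<integral>\<^sup>+z. ennreal \<bar>fst z i\<bar> \<partial>joint) + ennreal (sqrt 2) *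
        ((\<integral>\<^sup>+z. ennreal \<bar>path_eval (snd z i) t\<bar> \<partial>joint) + (\<integral>\<^sup>+z. ennreal \<bar>path_eval (snd z (i - 1)) t\<bar> \<partial>joint))"
      by (simp add: nn_integral_add nn_integral_cmult)
    also have "\<dots> \<le> C"
      unfolding C_def by (intro add_mono mult_left_mono E t eq_refl[OF nn_integral_joint_fst]) auto
    finally show ?thesis .
  qed
  show ?thesis
    by (rule that[of "enn2real C"]) (use bound \<open>C < \<infinity>\<close> in \<open>auto simp: less_top\<close>)
qed

end

section \<open>Integrability, resampling of site 0 and translation invariance\<close>

context gl_product
begin

text \<open>The self-reproducing exponential of \<open>pic_stable\<close> again, now for the
  supremum over sites of the first moment; with expectations taken site by site the weight is
  constant.\<close>

lemma nn_integral_pic_gl: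
  assumes c: "0 \<le> c" and le: "\<And>t i. 0 \<le> t \<Longrightarrow> t \<le> T \<Longrightarrow> (\<integral>\<^sup>+z. ennreal \<bar>forcing (fst z) (snd z) t i\<bar> \<partial>joint) \<le> ennreal c"
    and t: "0 \<le> t" "t \<le> T"
  shows "(\<integral>\<^sup>+z. ennreal \<bar>pic gl_drift (forcing (fst z) (snd z)) n t i\<bar> \<partial>joint) \<le> ennreal (c * exp (4 * Cp * t))"
  using t
proof (induction n arbitrary: t i)
  case (Suc n)
  let ?p = "\<lambda>z s. pic gl_drift (forcing (fst z) (snd z)) n s"
  define q where "q s = c * (4 * Cp * exp (4 * Cp * s))" for s
  have q0: "0 \<le> q s" for s using c Cp_pos by (simp add: q_def)
  note [measurable] = joint_section[OF pic_gl_joint] joint_section[OF forcing_joint]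
  have g[measurable]: "(\<lambda>(z, s). gl_drift s (?p z s) i) \<in> borel_measurable (joint \<Otimes>\<^sub>M borel)"
    by (simp only: gl_drift_def) measurable
  have gz: "(\<lambda>z. LBINT s:{0..t}. gl_drift s (?p z s) i) \<in> borel_measurable joint"
    by (rule borel_measurable_set_integral_Icc[OF g]) simp
  have lin: "ennreal Cp * (ennreal A + ennreal B + ennreal 2 * ennreal D) = ennreal (Cp * (A + B + 2 * D))"
    if "0 \<le> A" "0 \<le> B" "0 \<le> D" for A B D
    using that Cp_pos by (simp add: ennreal_mult)
  have drift: "(\<integral>\<^sup>+z. ennreal \<bar>gl_drift s (?p z s) i\<bar> \<partial>joint) \<le> ennreal (q s)" if s: "0 \<le> s" "s \<le> T" for s
  proof -
    have "(\<integral>\<^sup>+z. ennreal \<bar>gl_drift s (?p z s) i\<bar> \<partial>joint)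
        \<le> (\<integral>\<^sup>+z. ennreal Cp * (ennreal \<bar>?p z s (i + 1)\<bar> + ennreal \<bar>?p z s (i - 1)\<bar> + ennreal 2 * ennreal \<bar>?p z s i\<bar>) \<partial>joint)"
    proof (rule nn_integral_mono)
      fix z
      show "ennreal \<bar>gl_drift s (?p z s) i\<bar> \<le> ennreal Cp * (ennreal \<bar>?p z s (i + 1)\<bar> + ennreal \<bar>?p z s (i - 1)\<bar> + ennreal 2 * ennreal \<bar>?p z s i\<bar>)"
        unfolding lin[OF abs_ge_zero abs_ge_zero abs_ge_zero] by (rule ennreal_leI[OF gl.G_bound])
    qed
    also have "\<dots> = ennreal Cp * ((\<integral>\<^sup>+z. ennreal \<bar>?p z s (i + 1)\<bar> \<partial>joint) + (\<integral>\<^sup>+z. ennreal \<bar>?p z s (i - 1)\<bar> \<partial>joint)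
        + ennreal 2 * (\<integral>\<^sup>+z. ennreal \<bar>?p z s i\<bar> \<partial>joint))"
      by (simp add: nn_integral_add nn_integral_cmult)
    also have "\<dots> \<le> ennreal Cp * (ennreal (c * exp (4 * Cp * s)) + ennreal (c * exp (4 * Cp * s)) + ennreal 2 * ennreal (c * exp (4 * Cp * s)))"
      by (intro mult_left_mono add_mono Suc.IH s) auto
    also have "\<dots> = ennreal (Cp * (c * exp (4 * Cp * s) + c * exp (4 * Cp * s) + 2 * (c * exp (4 * Cp * s))))"
      by (rule lin) (use c in auto)
    also have "Cp * (c * exp (4 * Cp * s) + c * exp (4 * Cp * s) + 2 * (c * exp (4 * Cp * s))) = q s"
      by (simp add: q_def)
    finally show ?thesis .
  qed
  have "(\<integral>\<^sup>+z. ennreal \<bar>LBINT s:{0..t}. gl_drift s (?p z s) i\<bar> \<partial>joint)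
      \<le> (\<integral>\<^sup>+z. \<integral>\<^sup>+s. ennreal \<bar>gl_drift s (?p z s) i\<bar> * indicator {0..t} s \<partial>lborel \<partial>joint)"
  proof (rule nn_integral_mono)
    fix z
    show "ennreal \<bar>LBINT s:{0..t}. gl_drift s (?p z s) i\<bar> \<le> (\<integral>\<^sup>+s. ennreal \<bar>gl_drift s (?p z s) i\<bar> * indicator {0..t} s \<partial>lborel)"
    proof (cases "integrable lborel (\<lambda>s. indicator {0..t} s *\<^sub>R gl_drift s (?p z s) i)")
      case True
      from integral_norm_bound_ennreal[OF True]
      have "ennreal \<bar>LBINT s:{0..t}. gl_drift s (?p z s) i\<bar> \<le> (\<integral>\<^sup>+s. ennreal \<bar>indicator {0..t} s * gl_drift s (?p z s) i\<bar> \<partial>lborel)"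
        by (simp add: set_lebesgue_integral_def)
      also have "\<dots> = (\<integral>\<^sup>+s. ennreal \<bar>gl_drift s (?p z s) i\<bar> * indicator {0..t} s \<partial>lborel)"
        by (rule nn_integral_cong) (auto simp: indicator_def)
      finally show ?thesis .
    next
      \<comment> \<open>A non-integrable integrand gives the value 0 by convention, so the
        inequality holds for every \<open>z\<close> and not just for admissible data.\<close>
      case False
      then show ?thesis by (simp add: set_lebesgue_integral_def not_integrable_integral_eq)
    qed
  qed
  also have "\<dots> = (\<integral>\<^sup>+s. \<integral>\<^sup>+z. ennreal \<bar>gl_drift s (?p z s) i\<bar> * indicator {0..t} s \<partial>joint \<partial>lborel)"
  proof -
    interpret P: pair_sigma_finite joint lborel ..
    have "(\<lambda>(z, s). ennreal \<bar>gl_drift s (?p z s) i\<bar> * indicator {0..t} s) \<in> borel_measurable (joint \<Otimes>\<^sub>M lborel)"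
      using g by (simp add: case_prod_beta' cong: measurable_cong_sets) measurable
    then show ?thesis by (rule P.Fubini'[symmetric])
  qed
  also have "\<dots> \<le> (\<integral>\<^sup>+s. ennreal (q s) * indicator {0..t} s \<partial>lborel)"
  proof (rule nn_integral_mono)
    fix s :: real
    show "(\<integral>\<^sup>+z. ennreal \<bar>gl_drift s (?p z s) i\<bar> * indicator {0..t} s \<partial>joint) \<le> ennreal (q s) * indicator {0..t} s"
      using drift[of s] Suc.prems by (auto simp: indicator_def)
  qed
  also have "\<dots> = ennreal (c * exp (4 * Cp * t) - c * exp (4 * Cp * 0))"
  proof (rule nn_integral_FTC_Icc)
    show "((\<lambda>s. c * exp (4 * Cp * s)) has_real_derivative q s) (at s)" for s
      unfolding q_def by (rule derivative_eq_intros refl | simp)+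
    show "q \<in> borel_measurable borel" unfolding q_def by measurable
  qed (use q0 Suc.prems in auto)
  finally have I: "(\<integral>\<^sup>+z. ennreal \<bar>LBINT s:{0..t}. gl_drift s (?p z s) i\<bar> \<partial>joint) \<le> ennreal (c * exp (4 * Cp * t) - c)" by simp
  have "(\<integral>\<^sup>+z. ennreal \<bar>pic gl_drift (forcing (fst z) (snd z)) (Suc n) t i\<bar> \<partial>joint)
      \<le> (\<integral>\<^sup>+z. ennreal \<bar>forcing (fst z) (snd z) t i\<bar> + ennreal \<bar>LBINT s:{0..t}. gl_drift s (?p z s) i\<bar> \<partial>joint)"
  proof (rule nn_integral_mono)
    fix z
    show "ennreal \<bar>pic gl_drift (forcing (fst z) (snd z)) (Suc n) t i\<bar>
        \<le> ennreal \<bar>forcing (fst z) (snd z) t i\<bar> + ennreal \<bar>LBINT s:{0..t}. gl_drift s (?p z s) i\<bar>"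
      unfolding ennreal_plus[OF abs_ge_zero abs_ge_zero, symmetric] pic.simps
      by (rule ennreal_leI[OF abs_triangle_ineq])
  qed
  also have "\<dots> = (\<integral>\<^sup>+z. ennreal \<bar>forcing (fst z) (snd z) t i\<bar> \<partial>joint) + (\<integral>\<^sup>+z. ennreal \<bar>LBINT s:{0..t}. gl_drift s (?p z s) i\<bar> \<partial>joint)"
    by (rule nn_integral_add) (use gz in simp_all)
  also have "\<dots> \<le> ennreal c + ennreal (c * exp (4 * Cp * t) - c)"
    by (intro add_mono le Suc.prems I)
  also have "\<dots> = ennreal (c * exp (4 * Cp * t))"
  proof -
    have "c * 1 \<le> c * exp (4 * Cp * t)" using c Suc.prems Cp_pos by (intro mult_left_mono) auto
    then show ?thesis using c by (simp add: ennreal_plus[symmetric] del: ennreal_plus)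
  qed
  finally show ?case .
qed simp

text \<open>Fatou's lemma along the iterates, whose first moments are bounded uniformly in the
  order.\<close>

lemma integrable_gl_flow:
  assumes t: "0 \<le> t" shows "integrable joint (\<lambda>z. gl_flow (fst z) (snd z) t i)"
proof -
  obtain c where c: "0 \<le> c" "\<And>s i. 0 \<le> s \<Longrightarrow> s \<le> t \<Longrightarrow> (\<integral>\<^sup>+z. ennreal \<bar>forcing (fst z) (snd z) s i\<bar> \<partial>joint) \<le> ennreal c"
    using nn_integral_forcing_bounded[OF t] by blast
  note [measurable] = joint_section[OF pic_gl_joint] joint_section[OF gl_flow_joint]
  have "(\<integral>\<^sup>+z. ennreal \<bar>gl_flow (fst z) (snd z) t i\<bar> \<partial>joint)
      \<le> (\<integral>\<^sup>+z. liminf (\<lambda>n. ennreal \<bar>pic gl_drift (forcing (fst z) (snd z)) n t i\<bar>) \<partial>joint)"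
  proof (rule nn_integral_mono_AE)
    show "AE z in joint. ennreal \<bar>gl_flow (fst z) (snd z) t i\<bar> \<le> liminf (\<lambda>n. ennreal \<bar>pic gl_drift (forcing (fst z) (snd z)) n t i\<bar>)"
      using AE_admissible[OF t]
    proof eventually_elim
      case (elim z)
      have "(\<lambda>n. ennreal \<bar>pic gl_drift (forcing (fst z) (snd z)) n t i\<bar>) \<longlonglongrightarrow> ennreal \<bar>gl_flow (fst z) (snd z) t i\<bar>"
        by (intro tendsto_ennrealI tendsto_rabs pic_tendsto_gl_flow[OF elim t order_refl])
      from lim_imp_Liminf[OF sequentially_bot this] show ?case by (simp only: order_refl)
    qed
  qed
  also have "\<dots> \<le> liminf (\<lambda>n. \<integral>\<^sup>+z. ennreal \<bar>pic gl_drift (forcing (fst z) (snd z)) n t i\<bar> \<partial>joint)"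
    by (rule nn_integral_liminf) measurable
  also have "\<dots> \<le> ennreal (c * exp (4 * Cp * t))"
    by (rule order_trans[OF Liminf_le_Limsup Limsup_bounded])
      (use nn_integral_pic_gl[OF c t order_refl] in auto)
  also have "\<dots> < \<infinity>" by simp
  finally show ?thesis by (simp add: integrable_iff_bounded)
qed

text \<open>Replacing the value at site 0 by an independent draw from the single-site measure
  preserves the joint law. This is the device for integrating first over \<open>\<zeta> 0\<close>
  with everything else frozen.\<close>

definition resample :: "((int \<Rightarrow> real) \<times> (int \<Rightarrow> real \<Rightarrow> real)) \<times> real \<Rightarrow> (int \<Rightarrow> real) \<times> (int \<Rightarrow> real \<Rightarrow> real)"
  where "resample p = ((fst (fst p))(0 := snd p), snd (fst p))"

lemma upd_measurable: "(\<lambda>(x, \<zeta>). \<zeta>(0 := x)) \<in> borel \<Otimes>\<^sub>M config_space \<rightarrow>\<^sub>M config_space"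
  unfolding case_prod_beta' by (rule measurable_fun_upd[where J = UNIV]) (auto intro: measurable_snd measurable_fst)

lemma resample_measurable [measurable]: "resample \<in> joint \<Otimes>\<^sub>M borel \<rightarrow>\<^sub>M joint"
proof -
  have "(\<lambda>p. (snd p, fst (fst p))) \<in> joint \<Otimes>\<^sub>M borel \<rightarrow>\<^sub>M (borel :: real measure) \<Otimes>\<^sub>M config_space"
    by (intro measurable_Pair measurable_snd measurable_compose[OF measurable_fst joint_fst])
  from measurable_compose[OF this upd_measurable]
  have "(\<lambda>p. (fst (fst p))(0 := snd p)) \<in> joint \<Otimes>\<^sub>M (borel :: real measure) \<rightarrow>\<^sub>M config_space" by simp
  then have "resample \<in> joint \<Otimes>\<^sub>M borel \<rightarrow>\<^sub>M config_space \<Otimes>\<^sub>M noise_space"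
    unfolding resample_def[abs_def] by (intro measurable_Pair measurable_compose[OF measurable_fst joint_snd])
  then show ?thesis by (simp cong: measurable_cong_sets)
qed

lemma nn_integral_resample:
  assumes f: "f \<in> borel_measurable joint"
  shows "(\<integral>\<^sup>+z. \<integral>\<^sup>+x. f (resample (z, x)) \<partial>site_measure V l \<partial>joint) = (\<integral>\<^sup>+z. f z \<partial>joint)"
proof -
  let ?S = "site_measure V l"
  interpret sc: pair_sigma_finite ?S config ..
  have f': "f \<in> borel_measurable (config \<Otimes>\<^sub>M noise)" using f by (simp add: joint_def)
  have fr: "(\<lambda>p. f (resample p)) \<in> borel_measurable (joint \<Otimes>\<^sub>M ?S)"
    using measurable_compose[OF resample_measurable f] by (simp cong: measurable_cong_sets)
  have upd: "(\<lambda>(x, \<zeta>). \<zeta>(0 := x)) \<in> ?S \<Otimes>\<^sub>M config \<rightarrow>\<^sub>M config"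
    using upd_measurable by (simp cong: measurable_cong_sets)
  have law: "distr (?S \<Otimes>\<^sub>M config) config (\<lambda>(x, \<zeta>). \<zeta>(0 := x)) = config"
    using distr_pair_PiM_eq_PiM[of UNIV "\<lambda>_ :: int. ?S" 0] site.prob_space_axioms by (simp add: config_def)
  have inner: "(\<integral>\<^sup>+\<zeta>. \<integral>\<^sup>+x. f (\<zeta>(0 := x), b) \<partial>?S \<partial>config) = (\<integral>\<^sup>+\<zeta>. f (\<zeta>, b) \<partial>config)" if b: "b \<in> space noise" for b
  proof -
    have fb: "(\<lambda>\<zeta>. f (\<zeta>, b)) \<in> borel_measurable config" by (rule measurable_compose[OF measurable_Pair2'[OF b] f'])
    have "(\<integral>\<^sup>+\<zeta>. f (\<zeta>, b) \<partial>config) = (\<integral>\<^sup>+\<zeta>. f (\<zeta>, b) \<partial>distr (?S \<Otimes>\<^sub>M config) config (\<lambda>(x, \<zeta>). \<zeta>(0 := x)))"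
      by (simp only: law)
    also have "\<dots> = (\<integral>\<^sup>+p. f ((\<lambda>(x, \<zeta>). \<zeta>(0 := x)) p, b) \<partial>(?S \<Otimes>\<^sub>M config))"
      by (rule nn_integral_distr[OF upd]) (use fb in simp)
    also have "\<dots> = (\<integral>\<^sup>+\<zeta>. \<integral>\<^sup>+x. f ((\<lambda>(x, \<zeta>). \<zeta>(0 := x)) (x, \<zeta>), b) \<partial>?S \<partial>config)"
      by (rule sc.nn_integral_snd[OF measurable_compose[OF upd fb], symmetric])
    finally show ?thesis by simp
  qed
  have "(\<lambda>z. \<integral>\<^sup>+x. f (resample (z, x)) \<partial>?S) \<in> borel_measurable (config \<Otimes>\<^sub>M noise)"
    using site.borel_measurable_nn_integral_fst[OF fr] by (simp add: joint_def)
  from config_noise.nn_integral_snd[OF this]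
  have "(\<integral>\<^sup>+z. \<integral>\<^sup>+x. f (resample (z, x)) \<partial>?S \<partial>joint) = (\<integral>\<^sup>+b. \<integral>\<^sup>+\<zeta>. \<integral>\<^sup>+x. f (\<zeta>(0 := x), b) \<partial>?S \<partial>config \<partial>noise)"
    by (simp add: joint_def resample_def)
  also have "\<dots> = (\<integral>\<^sup>+b. \<integral>\<^sup>+\<zeta>. f (\<zeta>, b) \<partial>config \<partial>noise)"
    by (rule nn_integral_cong) (rule inner)
  also have "\<dots> = (\<integral>\<^sup>+z. f z \<partial>joint)" unfolding joint_def by (rule config_noise.nn_integral_snd[OF f'])
  finally show ?thesis .
qed

lemma distr_resample: "distr (joint \<Otimes>\<^sub>M site_measure V l) joint resample = joint"
proof (rule measure_eqI)
  fix A assume "A \<in> sets (distr (joint \<Otimes>\<^sub>M site_measure V l) joint resample)"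
  then have A[measurable]: "A \<in> sets joint" by simp
  have rm: "resample \<in> joint \<Otimes>\<^sub>M site_measure V l \<rightarrow>\<^sub>M joint"
    using resample_measurable by (simp cong: measurable_cong_sets)
  have "emeasure (distr (joint \<Otimes>\<^sub>M site_measure V l) joint resample) A
      = (\<integral>\<^sup>+p. indicator A (resample p) \<partial>(joint \<Otimes>\<^sub>M site_measure V l))"
    using nn_integral_distr[OF rm, of "indicator A"] A by simp
  also have "\<dots> = (\<integral>\<^sup>+z. \<integral>\<^sup>+x. indicator A (resample (z, x)) \<partial>site_measure V l \<partial>joint)"
    by (rule site.nn_integral_fst[symmetric]) (rule measurable_compose[OF rm], simp)
  also have "\<dots> = emeasure joint A" by (subst nn_integral_resample) auto
  finally show "emeasure (distr (joint \<Otimes>\<^sub>M site_measure V l) joint resample) A = emeasure joint A" .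
qed simp

lemma
  fixes f :: "(int \<Rightarrow> real) \<times> (int \<Rightarrow> real \<Rightarrow> real) \<Rightarrow> real"
  assumes f: "integrable joint f"
  shows integrable_resample: "integrable joint (\<lambda>z. LINT x|site_measure V l. f (resample (z, x)))"
    and integral_resample: "(LINT z|joint. LINT x|site_measure V l. f (resample (z, x))) = (LINT z|joint. f z)"
proof -
  interpret P: pair_sigma_finite joint "site_measure V l" ..
  have rm: "resample \<in> joint \<Otimes>\<^sub>M site_measure V l \<rightarrow>\<^sub>M joint"
    using resample_measurable by (simp cong: measurable_cong_sets)
  have m: "f \<in> borel_measurable joint" using f by simp
  have i: "integrable (joint \<Otimes>\<^sub>M site_measure V l) (\<lambda>p. f (resample p))"
    using f integrable_distr_eq[OF rm m] by (simp add: distr_resample)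
  show "integrable joint (\<lambda>z. LINT x|site_measure V l. f (resample (z, x)))"
    using P.integrable_fst'[OF i] .
  have "(LINT z|joint. LINT x|site_measure V l. f (resample (z, x))) = (LINT p|(joint \<Otimes>\<^sub>M site_measure V l). f (resample p))"
    by (rule P.integral_fst'[OF i])
  also have "\<dots> = (LINT z|joint. f z)"
    using integral_distr[OF rm m] by (simp add: distr_resample)
  finally show "(LINT z|joint. LINT x|site_measure V l. f (resample (z, x))) = (LINT z|joint. f z)" .
qed

text \<open>Both factors depend on \<open>\<zeta> 0\<close>, and for the flow only a first moment is
  at hand. Lipschitz dependence separates the variables: the flow is within L |\<zeta> 0| of
  \<open>U\<close>, which ignores site 0; the product is then at most |U| |\<zeta> 0| with
  independent factors, plus L times a square of finite mean.\<close>

lemma integrable_weighted_gl_flow: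
  assumes t: "0 \<le> t" shows "integrable joint (\<lambda>z. (fst z 0 - c) * gl_flow (fst z) (snd z) t i)"
proof -
  let ?S = "site_measure V l" and ?\<Phi> = "\<lambda>z. gl_flow (fst z) (snd z) t i"
  define U where "U z = ?\<Phi> (resample (z, 0))" for z
  define L where "L = exp (4 * Cp * t)"
  have L: "0 < L" by (simp add: L_def)
  note \<Phi>m[measurable] = joint_section[OF gl_flow_joint[of i], of t]
  have Um[measurable]: "U \<in> borel_measurable joint"
    unfolding U_def[abs_def] by (rule measurable_compose[OF measurable_compose[OF measurable_Pair2' resample_measurable] \<Phi>m]) simp
  have lip: "AE z in joint. \<forall>x. \<bar>?\<Phi> (resample (z, x)) - U z\<bar> \<le> L * \<bar>x\<bar>"
    using AE_admissible[OF t]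
  proof eventually_elim
    case (elim z)
    show ?case
      using gl_flow_lipschitz[OF elim t order_refl, of 0 _ i 0] by (simp add: resample_def U_def L_def)
  qed
  have id: "resample (z, fst z 0) = z" for z by (simp add: resample_def)
  have ix: "integrable joint (\<lambda>z. fst z 0)"
  proof -
    have "(\<integral>\<^sup>+z. ennreal \<bar>fst z 0\<bar> \<partial>joint) = (\<integral>\<^sup>+x. ennreal \<bar>x\<bar> \<partial>?S)"
      by (rule nn_integral_joint_fst) simp
    then show ?thesis using site_abs_finite by (simp add: integrable_iff_bounded)
  qed
  have iU: "integrable joint U"
  proof (rule Bochner_Integration.integrable_bound)
    show "integrable joint (\<lambda>z. \<bar>?\<Phi> z\<bar> + L * \<bar>fst z 0\<bar>)"
      using integrable_gl_flow[OF t, of i] ix by simp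
    show "AE z in joint. norm (U z) \<le> norm (\<bar>?\<Phi> z\<bar> + L * \<bar>fst z 0\<bar>)"
      using lip
    proof eventually_elim
      case (elim z)
      have "\<bar>?\<Phi> z - U z\<bar> \<le> L * \<bar>fst z 0\<bar>" using elim[rule_format, of "fst z 0"] by (simp only: id)
      then have "\<bar>U z\<bar> \<le> \<bar>?\<Phi> z\<bar> + L * \<bar>fst z 0\<bar>" by linarith
      then show ?case by simp
    qed
  qed simp
  have "integrable joint (\<lambda>z. fst z 0 * ?\<Phi> z)"
  proof (rule integrableI_bounded)
    have i2: "integrable ?S (\<lambda>x. x * x)" by (rule integrable_site_lipschitz_mult[of _ 1 _ 1]) auto
    have fin2: "(\<integral>\<^sup>+x. ennreal (L * (x * x)) \<partial>?S) < \<infinity>"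
      using nn_integral_eq_integral[OF integrable_mult_right[OF i2, of L]] L by simp
    have xm: "(\<lambda>x :: real. ennreal \<bar>x\<bar>) \<in> borel_measurable ?S" "(\<lambda>x :: real. ennreal (L * (x * x))) \<in> borel_measurable ?S"
      by measurable
    have "(\<integral>\<^sup>+z. ennreal (norm (fst z 0 * ?\<Phi> z)) \<partial>joint)
        = (\<integral>\<^sup>+z. \<integral>\<^sup>+x. ennreal (norm (fst (resample (z, x)) 0 * ?\<Phi> (resample (z, x)))) \<partial>?S \<partial>joint)"
      by (rule nn_integral_resample[symmetric]) measurable
    also have "\<dots> \<le> (\<integral>\<^sup>+z. \<integral>\<^sup>+x. ennreal \<bar>U z\<bar> * ennreal \<bar>x\<bar> + ennreal (L * (x * x)) \<partial>?S \<partial>joint)"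
    proof (rule nn_integral_mono_AE)
      show "AE z in joint. (\<integral>\<^sup>+x. ennreal (norm (fst (resample (z, x)) 0 * ?\<Phi> (resample (z, x)))) \<partial>?S)
          \<le> (\<integral>\<^sup>+x. ennreal \<bar>U z\<bar> * ennreal \<bar>x\<bar> + ennreal (L * (x * x)) \<partial>?S)"
        using lip
      proof eventually_elim
        case (elim z)
        show ?case
        proof (rule nn_integral_mono)
          fix x
          have b: "\<bar>?\<Phi> (resample (z, x))\<bar> \<le> \<bar>U z\<bar> + L * \<bar>x\<bar>" using elim[rule_format, of x] by linarith
          have "fst (resample (z, x)) 0 = x" by (simp add: resample_def)
          then have "norm (fst (resample (z, x)) 0 * ?\<Phi> (resample (z, x))) = \<bar>x\<bar> * \<bar>?\<Phi> (resample (z, x))\<bar>"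
            by (simp only: real_norm_def abs_mult)
          also have "\<dots> \<le> \<bar>x\<bar> * (\<bar>U z\<bar> + L * \<bar>x\<bar>)" by (rule mult_left_mono[OF b abs_ge_zero])
          also have "\<dots> = \<bar>U z\<bar> * \<bar>x\<bar> + L * (x * x)" by (simp add: distrib_left abs_mult_self_eq[of x, symmetric] del: abs_mult_self_eq)
          finally have "ennreal (norm (fst (resample (z, x)) 0 * ?\<Phi> (resample (z, x)))) \<le> ennreal (\<bar>U z\<bar> * \<bar>x\<bar> + L * (x * x))"
            by (rule ennreal_leI)
          also have "\<dots> = ennreal \<bar>U z\<bar> * ennreal \<bar>x\<bar> + ennreal (L * (x * x))"
            using L by (subst ennreal_plus) (auto simp: ennreal_mult)
          finally show "ennreal (norm (fst (resample (z, x)) 0 * ?\<Phi> (resample (z, x)))) \<le> ennreal \<bar>U z\<bar> * ennreal \<bar>x\<bar> + ennreal (L * (x * x))" .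
        qed
      qed
    qed
    also have "\<dots> = (\<integral>\<^sup>+z. ennreal \<bar>U z\<bar> * (\<integral>\<^sup>+x. ennreal \<bar>x\<bar> \<partial>?S) + (\<integral>\<^sup>+x. ennreal (L * (x * x)) \<partial>?S) \<partial>joint)"
    proof (rule nn_integral_cong)
      fix z
      have "(\<integral>\<^sup>+x. ennreal \<bar>U z\<bar> * ennreal \<bar>x\<bar> + ennreal (L * (x * x)) \<partial>?S)
          = (\<integral>\<^sup>+x. ennreal \<bar>U z\<bar> * ennreal \<bar>x\<bar> \<partial>?S) + (\<integral>\<^sup>+x. ennreal (L * (x * x)) \<partial>?S)"
        by (rule nn_integral_add) (use xm in auto)
      then show "(\<integral>\<^sup>+x. ennreal \<bar>U z\<bar> * ennreal \<bar>x\<bar> + ennreal (L * (x * x)) \<partial>?S)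
          = ennreal \<bar>U z\<bar> * (\<integral>\<^sup>+x. ennreal \<bar>x\<bar> \<partial>?S) + (\<integral>\<^sup>+x. ennreal (L * (x * x)) \<partial>?S)"
        by (simp only: nn_integral_cmult[OF xm(1)])
    qed
    also have "\<dots> = (\<integral>\<^sup>+z. ennreal \<bar>U z\<bar> \<partial>joint) * (\<integral>\<^sup>+x. ennreal \<bar>x\<bar> \<partial>?S) + (\<integral>\<^sup>+x. ennreal (L * (x * x)) \<partial>?S)"
      by (simp add: nn_integral_add nn_integral_multc joint.emeasure_space_1)
    also have "\<dots> < \<infinity>"
      using iU site_abs_finite fin2 by (simp add: integrable_iff_bounded ennreal_mult_less_top)
    finally show "(\<integral>\<^sup>+z. ennreal (norm (fst z 0 * ?\<Phi> z)) \<partial>joint) < \<infinity>" .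
  qed measurable
  then show ?thesis using integrable_gl_flow[OF t, of i] by (simp add: left_diff_distrib)
qed

lemma
  assumes adm: "admissible T \<zeta> b" and t: "0 \<le> t"
  shows gl_derivative_error: "\<bar>gl_derivative \<zeta> b t i - pic (site_drift (stiffness (gl_flow \<zeta> b))) (unit_at 0) n t i\<bar>
      \<le> exp (4 * Cp * t) * ((4 * Cp * t) ^ n / fact n)"
    and gl_derivative_bound: "\<bar>gl_derivative \<zeta> b t i\<bar> \<le> exp (4 * Cp * t)"
    and pic_site_bound: "\<bar>pic (site_drift (stiffness (gl_flow \<zeta> b))) (unit_at a) n t i\<bar> \<le> exp (4 * Cp * t)"
    and pic_bond_bound: "\<bar>pic (bond_drift (stiffness (gl_flow \<zeta> b))) (unit_at a) n t i\<bar> \<le> exp (4 * Cp * t)"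
proof -
  note nd = near_drift_stiffness[OF gl_flow_measurable[OF adm]]
  show "\<bar>gl_derivative \<zeta> b t i - pic (site_drift (stiffness (gl_flow \<zeta> b))) (unit_at 0) n t i\<bar>
      \<le> exp (4 * Cp * t) * ((4 * Cp * t) ^ n / fact n)"
    unfolding gl_derivative_def by (rule site_flow_error(1)[OF nd(1) t])
  show "\<bar>gl_derivative \<zeta> b t i\<bar> \<le> exp (4 * Cp * t)"
    \<comment> \<open>Order 0 is the zero iterate, so the error estimate is a bound on the
      derivative itself.\<close>
    using site_flow_error(1)[OF nd(1) t, where a = 0 and i = i and n = 0] by (simp add: gl_derivative_def)
  show "\<bar>pic (site_drift (stiffness (gl_flow \<zeta> b))) (unit_at a) n t i\<bar> \<le> exp (4 * Cp * t)"
    by (rule site_flow_error(2)[OF nd(1) t])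
  have "\<bar>pic (bond_drift (stiffness (gl_flow \<zeta> b))) (unit_at a) n t i\<bar> \<le> 1 * 1 * exp (Cp * (2 * 1 + 2) * t)"
    by (rule near_drift.pic_bound[OF nd(2) weight_one tame_unit_at[of t a] _ _ t order_refl]) (auto simp: unit_at_def)
  then show "\<bar>pic (bond_drift (stiffness (gl_flow \<zeta> b))) (unit_at a) n t i\<bar> \<le> exp (4 * Cp * t)" by (simp add: ac_simps)
qed

lemma
  assumes t: "0 \<le> t"
  shows integrable_gl_derivative: "integrable joint (\<lambda>z. gl_derivative (fst z) (snd z) t i)"
    and integrable_pic_site: "integrable joint (\<lambda>z. pic (site_drift (stiffness (gl_flow (fst z) (snd z)))) (unit_at a) n t i)"
    and integrable_pic_bond: "integrable joint (\<lambda>z. pic (bond_drift (stiffness (gl_flow (fst z) (snd z)))) (unit_at a) n t i)"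
proof -
  show "integrable joint (\<lambda>z. gl_derivative (fst z) (snd z) t i)"
  proof (rule joint.integrable_const_bound)
    show "AE z in joint. norm (gl_derivative (fst z) (snd z) t i) \<le> exp (4 * Cp * t)"
      using AE_admissible[OF t] by eventually_elim (simp only: real_norm_def gl_derivative_bound[OF _ t])
  qed (rule joint_section[OF gl_derivative_joint])
  show "integrable joint (\<lambda>z. pic (site_drift (stiffness (gl_flow (fst z) (snd z)))) (unit_at a) n t i)"
  proof (rule joint.integrable_const_bound)
    show "AE z in joint. norm (pic (site_drift (stiffness (gl_flow (fst z) (snd z)))) (unit_at a) n t i) \<le> exp (4 * Cp * t)"
      using AE_admissible[OF t] by eventually_elim (simp only: real_norm_def pic_site_bound[OF _ t])
  qed (rule joint_section[OF pic_site_joint])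
  show "integrable joint (\<lambda>z. pic (bond_drift (stiffness (gl_flow (fst z) (snd z)))) (unit_at a) n t i)"
  proof (rule joint.integrable_const_bound)
    show "AE z in joint. norm (pic (bond_drift (stiffness (gl_flow (fst z) (snd z)))) (unit_at a) n t i) \<le> exp (4 * Cp * t)"
      using AE_admissible[OF t] by eventually_elim (simp only: real_norm_def pic_bond_bound[OF _ t])
  qed (rule joint_section[OF pic_bond_joint])
qed

text \<open>The one-site inequality holds for almost every frozen remainder, and averaging it over
  the remainder is averaging over \<open>joint\<close>, by invariance under resampling.\<close>

lemma joint_covariance_bounds:
  fixes i :: int
  assumes t: "0 \<le> t"
  defines "mean \<equiv> (LINT x|site_measure V l. x)"
  shows "1 / Cp * (LINT z|joint. gl_derivative (fst z) (snd z) t i) \<le> (LINT z|joint. (fst z 0 - mean) * gl_flow (fst z) (snd z) t i)"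
    and "(LINT z|joint. (fst z 0 - mean) * gl_flow (fst z) (snd z) t i) \<le> 1 / Cm * (LINT z|joint. gl_derivative (fst z) (snd z) t i)"
proof -
  let ?S = "site_measure V l"
  define D where "D z = gl_derivative (fst z) (snd z) t i" for z
  define F where "F z = (fst z 0 - mean) * gl_flow (fst z) (snd z) t i" for z
  have iD: "integrable joint D" unfolding D_def by (rule integrable_gl_derivative[OF t])
  have iF: "integrable joint F" unfolding F_def by (rule integrable_weighted_gl_flow[OF t])
  have both: "AE z in joint. 1 / Cp * (LINT x|?S. D (resample (z, x))) \<le> (LINT x|?S. F (resample (z, x))) \<and>
      (LINT x|?S. F (resample (z, x))) \<le> 1 / Cm * (LINT x|?S. D (resample (z, x)))"
    using AE_admissible[OF t] AE_space
  proof eventually_elim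
    case (elim z)
    have D: "D (resample (z, x)) = gl_derivative ((fst z)(0 := x)) (snd z) t i"
      and F: "F (resample (z, x)) = (x - mean) * gl_flow ((fst z)(0 := x)) (snd z) t i" for x
      by (simp_all add: D_def F_def resample_def)
    have "(\<lambda>x. D (resample (z, x))) \<in> borel_measurable borel"
      by (rule measurable_compose[OF measurable_compose[OF measurable_Pair1'[OF elim(2)] resample_measurable]])
        (use iD in simp)
    then have m: "(\<lambda>x. gl_derivative ((fst z)(0 := x)) (snd z) t i) \<in> borel_measurable borel" unfolding D .
    show ?case unfolding D F mean_def
      using resampled_covariance_bounds[OF elim(1) t order_refl m, of l] by blast
  qed
  have "1 / Cp * (LINT z|joint. D z) = (LINT z|joint. 1 / Cp * (LINT x|?S. D (resample (z, x))))"
    by (simp only: integral_mult_right_zero integral_resample[OF iD])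
  also have "\<dots> \<le> (LINT z|joint. LINT x|?S. F (resample (z, x)))"
    by (rule integral_mono_AE)
      (use both integrable_resample[OF iD] integrable_resample[OF iF] in \<open>auto elim: eventually_mono\<close>)
  finally show "1 / Cp * (LINT z|joint. gl_derivative (fst z) (snd z) t i) \<le> (LINT z|joint. (fst z 0 - mean) * gl_flow (fst z) (snd z) t i)"
    by (simp only: integral_resample[OF iF]) (simp only: D_def F_def)
  have "(LINT z|joint. LINT x|?S. F (resample (z, x))) \<le> (LINT z|joint. 1 / Cm * (LINT x|?S. D (resample (z, x))))"
    by (rule integral_mono_AE)
      (use both integrable_resample[OF iD] integrable_resample[OF iF] in \<open>auto elim: eventually_mono\<close>)
  also have "\<dots> = 1 / Cm * (LINT z|joint. D z)"
    by (simp only: integral_mult_right_zero integral_resample[OF iD])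
  finally show "(LINT z|joint. (fst z 0 - mean) * gl_flow (fst z) (snd z) t i) \<le> 1 / Cm * (LINT z|joint. gl_derivative (fst z) (snd z) t i)"
    by (simp only: integral_resample[OF iF]) (simp only: D_def F_def)
qed

text \<open>Configuration and noise are translated together: their joint law is then invariant and
  the flow commutes with the translation.\<close>

definition shift :: "(int \<Rightarrow> real) \<times> (int \<Rightarrow> real \<Rightarrow> real) \<Rightarrow> (int \<Rightarrow> real) \<times> (int \<Rightarrow> real \<Rightarrow> real)"
  where "shift = (\<lambda>(\<zeta>, b). (\<lambda>j. \<zeta> (j + 1), \<lambda>j. b (j + 1)))"

lemma shift_measurable: "shift \<in> joint \<rightarrow>\<^sub>M joint" and distr_shift: "distr joint joint shift = joint"
proof -
  have c: "(\<lambda>\<zeta> j. \<zeta> (j + 1)) \<in> config \<rightarrow>\<^sub>M config"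
    unfolding config_def by (rule measurable_PiM_single') (auto intro: measurable_component_singleton simp: space_PiM)
  have n: "(\<lambda>b j. b (j + 1)) \<in> noise \<rightarrow>\<^sub>M noise"
    unfolding noise_def by (rule measurable_PiM_single') (auto intro: measurable_component_singleton simp: space_PiM PiE_iff)
  have dc: "distr config config (\<lambda>\<zeta> j. \<zeta> (j + 1)) = config"
    using distr_PiM_reindex[of UNIV "\<lambda>_. site_measure V l" "\<lambda>j :: int. j + 1" UNIV] site.prob_space_axioms
    by (simp add: config_def restrict_UNIV)
  have dn: "distr noise noise (\<lambda>b j. b (j + 1)) = noise"
    using distr_PiM_reindex[of UNIV "\<lambda>_. \<beta>" "\<lambda>j :: int. j + 1" UNIV] \<beta>_prob
    by (simp add: noise_def restrict_UNIV)
  show "shift \<in> joint \<rightarrow>\<^sub>M joint"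
    unfolding shift_def joint_def case_prod_beta'
    by (intro measurable_Pair measurable_compose[OF measurable_fst c] measurable_compose[OF measurable_snd n])
  have "distr config config (\<lambda>\<zeta> j. \<zeta> (j + 1)) \<Otimes>\<^sub>M distr noise noise (\<lambda>b j. b (j + 1)) = distr (config \<Otimes>\<^sub>M noise) (config \<Otimes>\<^sub>M noise) shift"
    unfolding shift_def by (rule pair_measure_distr[OF c n]) (simp add: dn noise.sigma_finite_measure_axioms)
  then show "distr joint joint shift = joint" by (simp add: dc dn joint_def)
qed

lemma forcing_shift: "forcing (fst (shift z)) (snd (shift z)) t i = forcing (fst z) (snd z) t (i + 1)"
  by (simp add: forcing_def shift_def case_prod_beta')

lemma gl_flow_shift: "gl_flow (fst (shift z)) (snd (shift z)) t i = gl_flow (fst z) (snd z) t (i + 1)"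
proof -
  have "pic gl_drift (forcing (fst (shift z)) (snd (shift z))) n t i = pic gl_drift (forcing (fst z) (snd z)) n t (i + 1)" for n
    by (rule pic_shift) (simp_all add: gl_drift_def forcing_shift)
  then show ?thesis by (simp only: gl_flow_def flow_def)
qed

lemma pic_site_shift:
  "pic (site_drift (stiffness (gl_flow (fst (shift z)) (snd (shift z))))) (unit_at a) n t i
    = pic (site_drift (stiffness (gl_flow (fst z) (snd z)))) (unit_at (a + 1)) n t (i + 1)"
  by (rule pic_shift) (simp_all add: site_drift_def stiffness_def gl_flow_shift unit_at_def)

text \<open>By translation invariance the gradient relation becomes a telescoping identity in the
  position, and both sides vanish far away.\<close>

lemma expectation_site_eq_bond:
  assumes t: "0 \<le> t"
  shows "(LINT z|joint. pic (site_drift (stiffness (gl_flow (fst z) (snd z)))) (unit_at 0) n t i)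
    = (LINT z|joint. pic (bond_drift (stiffness (gl_flow (fst z) (snd z)))) (unit_at 0) n t i)"
proof -
  define s where "s a i = (LINT z|joint. pic (site_drift (stiffness (gl_flow (fst z) (snd z)))) (unit_at a) n t i)" for a i
  define p where "p i = (LINT z|joint. pic (bond_drift (stiffness (gl_flow (fst z) (snd z)))) (unit_at 0) n t i)" for i
  \<comment> \<open>In the mean, starting from site 1 instead of site 0 is only a translation of the
    target.\<close>
  have shift: "s 1 (j + 1) = s 0 j" for j
  proof -
    have "s 0 j = (LINT z|distr joint joint shift. pic (site_drift (stiffness (gl_flow (fst z) (snd z)))) (unit_at 0) n t j)"
      unfolding s_def distr_shift ..
    also have "\<dots> = (LINT z|joint. pic (site_drift (stiffness (gl_flow (fst (shift z)) (snd (shift z))))) (unit_at 0) n t j)"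
      by (rule integral_distr[OF shift_measurable joint_section[OF pic_site_joint]])
    also have "\<dots> = s 1 (j + 1)" unfolding s_def by (simp only: pic_site_shift add_0)
    finally show ?thesis ..
  qed
  have grad: "s 1 j - s 0 j = p (j - 1) - p j" for j
  proof -
    have "s 1 j - s 0 j = (LINT z|joint. pic (site_drift (stiffness (gl_flow (fst z) (snd z)))) (unit_at 1) n t j
        - pic (site_drift (stiffness (gl_flow (fst z) (snd z)))) (unit_at 0) n t j)"
      unfolding s_def by (rule Bochner_Integration.integral_diff[symmetric]) (rule integrable_pic_site[OF t])+
    also have "\<dots> = (LINT z|joint. pic (bond_drift (stiffness (gl_flow (fst z) (snd z)))) (unit_at 0) n t (j - 1)
        - pic (bond_drift (stiffness (gl_flow (fst z) (snd z)))) (unit_at 0) n t j)"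
    proof (rule integral_cong_AE)
      show "AE z in joint. pic (site_drift (stiffness (gl_flow (fst z) (snd z)))) (unit_at 1) n t j
        - pic (site_drift (stiffness (gl_flow (fst z) (snd z)))) (unit_at 0) n t j
        = pic (bond_drift (stiffness (gl_flow (fst z) (snd z)))) (unit_at 0) n t (j - 1)
        - pic (bond_drift (stiffness (gl_flow (fst z) (snd z)))) (unit_at 0) n t j"
        using AE_admissible[OF t]
      proof eventually_elim
        case (elim z)
        show ?case
          using pic_site_bond_gradient[OF less_imp_le[OF Cp_pos] stiffness_bounds stiffness_measurable[OF gl_flow_measurable[OF elim]], where a = 0 and n = n and t = t and i = j]
          by (simp only: add_0)
      qed
    qed (intro borel_measurable_diff joint_section[OF pic_site_joint] joint_section[OF pic_bond_joint])+
    also have "\<dots> = p (j - 1) - p j"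
      unfolding p_def by (rule Bochner_Integration.integral_diff) (rule integrable_pic_bond[OF t])+
    finally show ?thesis .
  qed
  \<comment> \<open>The difference \<open>s 0 j - p j\<close> does not depend on \<open>j\<close>;
    it is evaluated beyond the range of the iterates, where both terms are 0.\<close>
  have step: "s 0 j - p j = s 0 (j + 1) - p (j + 1)" for j
    using grad[of "j + 1"] shift[of j] by simp
  have steps: "s 0 i - p i = s 0 (i + int k) - p (i + int k)" for k
  proof (induction k)
    case (Suc k)
    have "i + int (Suc k) = i + int k + 1" by simp
    then show ?case using Suc step[of "i + int k"] by (simp only:)
  qed simp
  define k where "k = nat (int n + \<bar>i\<bar>)"
  have far: "int n \<le> \<bar>i + int k - 0\<bar>" by (simp add: k_def)
  have "s 0 (i + int k) = 0" "p (i + int k) = 0"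
    unfolding s_def p_def by (simp_all only: pic_site_finite_support[OF far] pic_bond_finite_support[OF far] integral_zero)
  then show ?thesis using steps[of k] by (simp add: s_def p_def)
qed

text \<open>The derivative is exchanged for its site iterate path by path, then the site iterate for
  the bond iterate in the mean. The second exchange is exact, so the error is that of the
  first.\<close>

lemma expectation_derivative_bond:
  assumes t: "0 \<le> t"
  shows "\<bar>(LINT z|joint. gl_derivative (fst z) (snd z) t i)
      - (LINT z|joint. pic (bond_drift (stiffness (gl_flow (fst z) (snd z)))) (unit_at 0) n t i)\<bar>
    \<le> exp (4 * Cp * t) * ((4 * Cp * t) ^ n / fact n)"
proof -
  let ?p = "\<lambda>z. pic (site_drift (stiffness (gl_flow (fst z) (snd z)))) (unit_at 0) n t i"
  let ?D = "\<lambda>z. gl_derivative (fst z) (snd z) t i"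
  have "\<bar>LINT z|joint. ?D z - ?p z\<bar> \<le> (LINT z|joint. \<bar>?D z - ?p z\<bar>)" by (rule integral_abs_bound)
  also have "\<dots> \<le> (LINT z|joint. exp (4 * Cp * t) * ((4 * Cp * t) ^ n / fact n))"
  proof (rule integral_mono_AE)
    show "AE z in joint. \<bar>?D z - ?p z\<bar> \<le> exp (4 * Cp * t) * ((4 * Cp * t) ^ n / fact n)"
      using AE_admissible[OF t] by eventually_elim (rule gl_derivative_error[OF _ t])
  qed (auto intro!: integrable_abs Bochner_Integration.integrable_diff integrable_gl_derivative[OF t] integrable_pic_site[OF t])
  also have "\<dots> = exp (4 * Cp * t) * ((4 * Cp * t) ^ n / fact n)" by (simp add: joint.prob_space)
  finally show ?thesis
    unfolding expectation_site_eq_bond[OF t, symmetric]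
    by (simp only: Bochner_Integration.integral_diff[OF integrable_gl_derivative[OF t] integrable_pic_site[OF t]])
qed

end

section \<open>The dynamics as the flow of its data\<close>

text \<open>An enumeration of the integers turns summability into a Cauchy condition on partial sums
  that involve finitely many coordinates each; measurability of the weighted space follows from
  it.\<close>

lemma weighted_space_iff:
  "\<zeta> \<in> weighted_space r \<longleftrightarrow> summable (\<lambda>n. (\<zeta> (int_decode n))\<^sup>2 * exp (- r * real_of_int \<bar>int_decode n\<bar>))"
proof -
  let ?f = "\<lambda>i. (\<zeta> i)\<^sup>2 * exp (- r * real_of_int \<bar>i\<bar>)"
  have "\<zeta> \<in> weighted_space r \<longleftrightarrow> (\<lambda>n. ?f (int_decode n)) summable_on UNIV"
    unfolding weighted_space_def mem_Collect_eq by (rule summable_on_reindex_bij_betw[OF bij_int_decode, symmetric])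
  also have "\<dots> \<longleftrightarrow> summable (\<lambda>n. ?f (int_decode n))"
    by (rule summable_on_UNIV_nonneg_real_iff) simp
  finally show ?thesis .
qed

lemma weighted_space_measurable: "weighted_space r \<in> sets config_space"
proof -
  have [measurable]: "(\<lambda>\<zeta>. \<zeta> j) \<in> borel_measurable config_space" for j by (rule measurable_component_singleton) simp
  have "weighted_space r = {\<zeta> \<in> space config_space.
      Cauchy (\<lambda>N. \<Sum>n<N. (\<zeta> (int_decode n))\<^sup>2 * exp (- r * real_of_int \<bar>int_decode n\<bar>))}"
    by (auto simp: weighted_space_iff summable_iff_convergent Cauchy_convergent_iff space_PiM)
  also have "\<dots> \<in> sets config_space"
    by (rule sets_Collect_Cauchy) measurable
  finally show ?thesis .
qed

text \<open>A single term is at most the whole sum, and the square root turns the rate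
  \<open>r\<close> into r / 2.\<close>

lemma weighted_space_growth:
  assumes "\<zeta> \<in> weighted_space r"
  obtains K where "0 \<le> K" "\<And>i. \<bar>\<zeta> i\<bar> \<le> K * exp (r / 2 * real_of_int \<bar>i\<bar>)"
proof -
  let ?f = "\<lambda>i. (\<zeta> i)\<^sup>2 * exp (- r * real_of_int \<bar>i\<bar>)"
  have sm: "summable (\<lambda>n. ?f (int_decode n))" using assms by (simp add: weighted_space_iff)
  define S where "S = (\<Sum>n. ?f (int_decode n))"
  have S0: "0 \<le> S" unfolding S_def by (rule suminf_nonneg[OF sm]) simp
  have "\<bar>\<zeta> i\<bar> \<le> sqrt S * exp (r / 2 * real_of_int \<bar>i\<bar>)" for i
  proof (rule power2_le_imp_le)
    have "?f i \<le> S"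
      using sum_le_suminf[OF sm, of "{int_encode i}"] by (simp add: S_def)
    then have "?f i * exp (r * real_of_int \<bar>i\<bar>) \<le> S * exp (r * real_of_int \<bar>i\<bar>)"
      by (intro mult_right_mono) auto
    moreover have "exp (- r * real_of_int \<bar>i\<bar>) * exp (r * real_of_int \<bar>i\<bar>) = 1"
      unfolding exp_add[symmetric] by simp
    ultimately have "(\<zeta> i)\<^sup>2 \<le> S * exp (r * real_of_int \<bar>i\<bar>)"
      by (simp only: mult.assoc mult_1_right)
    also have "\<dots> = (sqrt S * exp (r / 2 * real_of_int \<bar>i\<bar>))\<^sup>2"
      using S0 by (simp add: power_mult_distrib exp_double[symmetric])
    finally show "\<bar>\<zeta> i\<bar>\<^sup>2 \<le> (sqrt S * exp (r / 2 * real_of_int \<bar>i\<bar>))\<^sup>2" by simp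
  qed (use S0 in simp)
  then show ?thesis using that S0 by (meson real_sqrt_ge_zero)
qed

abbreviation noise_path :: "(int \<Rightarrow> real \<Rightarrow> 'w \<Rightarrow> real) \<Rightarrow> 'w \<Rightarrow> int \<Rightarrow> real \<Rightarrow> real" where
  "noise_path B \<omega> \<equiv> (\<lambda>i. bm_path (B i) \<omega>)"

lemma noise_path_measurable:
  assumes "bond_brownian_motions M B" shows "noise_path B \<in> M \<rightarrow>\<^sub>M noise_space"
  by (rule measurable_PiM_single')
    (use assms bm_path_measurable in \<open>auto simp: bond_brownian_motions_def space_PiM PiE_iff\<close>)

lemma initial_measurable:
  assumes "\<And>i. (\<lambda>\<omega>. \<eta> \<omega> i) \<in> borel_measurable M" shows "\<eta> \<in> M \<rightarrow>\<^sub>M config_space"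
  by (rule measurable_PiM_single') (use assms in \<open>auto simp: space_PiM\<close>)

lemma gl_dynamics_independent:
  assumes "gl_dynamics V r M B \<eta>"
  shows "distr M config_space (\<eta> 0) \<Otimes>\<^sub>M distr M noise_space (noise_path B)
    = distr M (config_space \<Otimes>\<^sub>M noise_space) (\<lambda>\<omega>. (\<eta> 0 \<omega>, noise_path B \<omega>))"
proof -
  interpret prob_space M using assms by (simp add: gl_dynamics_def)
  have bb: "bond_brownian_motions M B" using assms by (simp add: gl_dynamics_def)
  have m0: "\<eta> 0 \<in> M \<rightarrow>\<^sub>M config_space"
    by (rule initial_measurable) (use assms in \<open>simp add: gl_dynamics_def\<close>)
  have mp: "noise_path B \<in> M \<rightarrow>\<^sub>M noise_space" by (rule noise_path_measurable[OF bb])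
  define U where "U \<omega> = (\<lambda>(i, t)\<in>UNIV \<times> {0..}. B i t \<omega>)" for \<omega>
  let ?PU = "\<Pi>\<^sub>M p\<in>(UNIV :: int set) \<times> {0 :: real..}. (borel :: real measure)"
  \<comment> \<open>The independence assumption treats the noise as one family over bonds and times,
    the canonical space as a family of paths. \<open>curry\<close> is the measurable passage from
    the first to the second, so events of the second are among those of the first.\<close>
  define curry where "curry u = (\<lambda>i. \<lambda>t\<in>{0..}. u (i, t))" for u :: "int \<times> real \<Rightarrow> real"
  have "(\<lambda>u. \<lambda>t\<in>{0..}. u (i, t)) \<in> ?PU \<rightarrow>\<^sub>M path_space" for i :: int
    by (rule measurable_restrict) (rule measurable_component_singleton, simp)
  then have cm: "curry \<in> ?PU \<rightarrow>\<^sub>M noise_space"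
    unfolding curry_def[abs_def] by (intro measurable_PiM_single') (auto simp: space_PiM)
  have cu: "curry (U \<omega>) = noise_path B \<omega>" for \<omega>
    by (simp add: curry_def U_def restrict_def fun_eq_iff)
  have Us: "U \<omega> \<in> space ?PU" for \<omega>
    by (simp add: U_def space_PiM)
  have ind: "indep_set {\<eta> 0 -` A \<inter> space M | A. A \<in> sets config_space} {U -` A \<inter> space M | A. A \<in> sets ?PU}"
    using assms unfolding gl_dynamics_def U_def[abs_def] by blast
  have sub: "{noise_path B -` A \<inter> space M | A. A \<in> sets noise_space} \<subseteq> {U -` A \<inter> space M | A. A \<in> sets ?PU}"
  proof
    fix a assume "a \<in> {noise_path B -` A \<inter> space M | A. A \<in> sets noise_space}"
    then obtain A where A: "A \<in> sets noise_space" and a: "a = noise_path B -` A \<inter> space M" by blast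
    have "noise_path B -` A \<inter> space M = U -` (curry -` A \<inter> space ?PU) \<inter> space M"
    proof (intro set_eqI iffI)
      fix \<omega> assume "\<omega> \<in> noise_path B -` A \<inter> space M"
      then show "\<omega> \<in> U -` (curry -` A \<inter> space ?PU) \<inter> space M" using Us[of \<omega>] by (simp add: cu)
    next
      fix \<omega> assume "\<omega> \<in> U -` (curry -` A \<inter> space ?PU) \<inter> space M"
      then show "\<omega> \<in> noise_path B -` A \<inter> space M" by (simp add: cu)
    qed
    moreover have "curry -` A \<inter> space ?PU \<in> sets ?PU" by (rule measurable_sets[OF cm A])
    ultimately show "a \<in> {U -` A \<inter> space M | A. A \<in> sets ?PU}" unfolding a by blast
  qed
  have indep: "prob (a \<inter> b) = prob a * prob b"
    if "a \<in> {\<eta> 0 -` A \<inter> space M | A. A \<in> sets config_space}" "b \<in> {noise_path B -` A \<inter> space M | A. A \<in> sets noise_space}" for a b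
    by (rule indep_setD[OF ind that(1) subsetD[OF sub that(2)]])
  interpret c: prob_space "distr M config_space (\<eta> 0)" by (rule prob_space_distr[OF m0])
  interpret n: prob_space "distr M noise_space (noise_path B)" by (rule prob_space_distr[OF mp])
  show ?thesis
  proof (rule pair_measure_eqI)
    fix A A' assume "A \<in> sets (distr M config_space (\<eta> 0))" "A' \<in> sets (distr M noise_space (noise_path B))"
    then have A: "A \<in> sets config_space" "A' \<in> sets noise_space" by auto
    have "emeasure (distr M (config_space \<Otimes>\<^sub>M noise_space) (\<lambda>\<omega>. (\<eta> 0 \<omega>, noise_path B \<omega>))) (A \<times> A')
        = emeasure M ((\<lambda>\<omega>. (\<eta> 0 \<omega>, noise_path B \<omega>)) -` (A \<times> A') \<inter> space M)"
      by (rule emeasure_distr[OF measurable_Pair[OF m0 mp]]) (use A in simp)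
    also have "(\<lambda>\<omega>. (\<eta> 0 \<omega>, noise_path B \<omega>)) -` (A \<times> A') \<inter> space M = (\<eta> 0 -` A \<inter> space M) \<inter> (noise_path B -` A' \<inter> space M)"
      by auto
    also have "emeasure M \<dots> = emeasure M (\<eta> 0 -` A \<inter> space M) * emeasure M (noise_path B -` A' \<inter> space M)"
    proof -
      have "prob ((\<eta> 0 -` A \<inter> space M) \<inter> (noise_path B -` A' \<inter> space M)) = prob (\<eta> 0 -` A \<inter> space M) * prob (noise_path B -` A' \<inter> space M)"
        by (rule indep) (use A in blast)+
      then show ?thesis unfolding emeasure_eq_measure by (simp only: ennreal_mult[OF measure_nonneg measure_nonneg])
    qed
    finally show "emeasure (distr M config_space (\<eta> 0)) A * emeasure (distr M noise_space (noise_path B)) A'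
        = emeasure (distr M (config_space \<Otimes>\<^sub>M noise_space) (\<lambda>\<omega>. (\<eta> 0 \<omega>, noise_path B \<omega>))) (A \<times> A')"
      by (simp only: emeasure_distr[OF m0 A(1)] emeasure_distr[OF mp A(2)])
  qed (rule c.sigma_finite_measure_axioms n.sigma_finite_measure_axioms
      | simp add: sets_pair_measure_cong[OF sets_distr sets_distr])+
qed

section \<open>Transfer from arbitrary solutions to the canonical product space\<close>

context gl_product
begin

text \<open>Pathwise uniqueness: on any probability space the solution is the canonical flow of its
  own data. The weighted norm, finite at each time, is first made uniform on [0, T] by
  \<open>weighted_bound_uniform\<close>.\<close>

lemma gl_dynamics_eq_flow:
  assumes dyn: "gl_dynamics V r M B \<eta>" and law: "distr M noise_space (noise_path B) = noise" and r: "0 < r" and T: "0 \<le> T"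
  shows "AE \<omega> in M. \<forall>s\<in>{0..T}. \<forall>i. \<eta> s \<omega> i = gl_flow (\<eta> 0 \<omega>) (noise_path B \<omega>) s i"
proof -
  have bb: "bond_brownian_motions M B" using dyn by (simp add: gl_dynamics_def)
  obtain N where N: "T + 1 \<le> real N" using real_arch_simple by blast
  have r2: "0 < r / 2" "0 \<le> r / 2" using r by auto
  have good: "AE \<omega> in M. good_noise (r / 2) N (noise_path B \<omega>)"
    by (rule AE_distrD[OF noise_path_measurable[OF bb]]) (simp only: law AE_good_noise[OF r2(1)])
  have cont: "AE \<omega> in M. \<forall>i. continuous_on {0..} (\<lambda>t. B i t \<omega>)"
    using bb by (simp add: AE_all_countable bond_brownian_motions_def brownian_motion_def)
  have wt: "AE \<omega> in M. \<forall>t\<ge>0. \<eta> t \<omega> \<in> weighted_space r" using dyn by (simp add: gl_dynamics_def)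
  have sde: "AE \<omega> in M. \<forall>t\<ge>0. \<forall>i.
        \<eta> t \<omega> i = \<eta> 0 \<omega> i
          + (LBINT s:{0..t}. deriv V (\<eta> s \<omega> (i + 1)) + deriv V (\<eta> s \<omega> (i - 1)) - 2 * deriv V (\<eta> s \<omega> i))
          + sqrt 2 * (B i t \<omega> - B (i - 1) t \<omega>)" using dyn by (simp add: gl_dynamics_def)
  show ?thesis using good cont wt sde AE_space
  proof eventually_elim
    case (elim \<omega>)
    let ?b = "noise_path B \<omega>" and ?w = "\<lambda>i. exp (r / 2 * real_of_int \<bar>i\<bar>)"
    have b: "?b \<in> space noise_space" by (rule measurable_space[OF noise_path_measurable[OF bb] elim(5)])
    obtain K0 where K0: "\<And>i. \<bar>\<eta> 0 \<omega> i\<bar> \<le> K0 * ?w i"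
      using weighted_space_growth[of "\<eta> 0 \<omega>" r] elim(3) by (metis order_refl)
    obtain S where S: "0 \<le> S" "\<And>s i. 0 \<le> s \<Longrightarrow> s \<le> T \<Longrightarrow> \<bar>forcing (\<eta> 0 \<omega>) ?b s i\<bar> \<le> S * ?w i"
      using forcing_bound[where \<zeta> = "\<eta> 0 \<omega>", OF r2(2) T N elim(1) K0] by blast
    have force: "forcing (\<eta> 0 \<omega>) ?b s i = \<eta> 0 \<omega> i + sqrt 2 * (B i s \<omega> - B (i - 1) s \<omega>)" if "0 \<le> s" for s i
      unfolding forcing_def by (simp only: path_eval_continuous[OF elim(2)[rule_format] that])
    \<comment> \<open>Freezing the path before time 0 makes it measurable in time on the whole
      line.\<close>
    define x where "x s = \<eta> (max 0 s) \<omega>" for s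
    have c\<eta>: "continuous_on {0..} (\<lambda>t. \<eta> t \<omega> i)" for i using dyn elim(5) by (simp add: gl_dynamics_def)
    have cx: "continuous_on UNIV (\<lambda>s. x s i)" for i
      unfolding x_def by (rule continuous_on_compose2[OF c\<eta>]) (auto intro!: continuous_intros)
    have w: "weight (exp (r / 2)) ?w" by (rule weight_exp[OF r2(2)])
    have tame: "tame T (forcing (\<eta> 0 \<omega>) ?b)" by (rule tame_weightI[OF forcing_measurable[OF b] S(2)])
    have main: "solves gl_drift (forcing (\<eta> 0 \<omega>) ?b) T x \<and> (\<exists>K. \<forall>s\<in>{0..T}. \<forall>i. \<bar>x s i\<bar> \<le> K * ?w i)"
    proof (rule gl.weighted_bound_uniform[OF w T S])
      show "(\<lambda>s. x s i) \<in> borel_measurable borel" for i by (rule borel_measurable_continuous_onI[OF cx])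
      show "continuous_on {0..T} (\<lambda>s. x s i)" for i by (rule continuous_on_subset[OF cx]) simp
      show "x t i = forcing (\<eta> 0 \<omega>) ?b t i + (LBINT s:{0..t}. gl_drift s (x s) i)" if "0 \<le> t" "t \<le> T" for t i
      proof -
        have "(LBINT s:{0..t}. gl_drift s (x s) i)
            = (LBINT s:{0..t}. deriv V (\<eta> s \<omega> (i + 1)) + deriv V (\<eta> s \<omega> (i - 1)) - 2 * deriv V (\<eta> s \<omega> i))"
          by (rule set_lebesgue_integral_cong) (auto simp: gl_drift_def x_def)
        moreover have "x t i = \<eta> t \<omega> i" using that by (simp add: x_def)
        ultimately show ?thesis using elim(4)[rule_format, OF that(1), of i] force[OF that(1), of i] by linarith
      qed
      show "\<exists>K. \<forall>i. \<bar>x s i\<bar> \<le> K * ?w i" if "0 \<le> s" "s \<le> T" for s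
        using weighted_space_growth[of "x s" r] elim(3) that by (metis x_def max.cobounded1)
    qed
    obtain K where K': "\<forall>s\<in>{0..T}. \<forall>i. \<bar>x s i\<bar> \<le> K * ?w i" using conjunct2[OF main] by blast
    then have K: "\<bar>x s i\<bar> \<le> K * ?w i" if "0 \<le> s" "s \<le> T" for s i using that by simp
    have "x s i = gl_flow (\<eta> 0 \<omega>) ?b s i" if "0 \<le> s" "s \<le> T" for s i
      unfolding gl_flow_def by (rule gl.solves_eq_flow[OF w tame conjunct1[OF main] K that])
    then show ?case by (auto simp: x_def)
  qed
qed

lemma dynamics_joint_law:
  assumes dyn: "gl_dynamics V r M B \<eta>" and law: "distr M noise_space (noise_path B) = noise"
    and start: "distr M config_space (\<eta> 0) = config"
  shows "distr M joint (\<lambda>\<omega>. (\<eta> 0 \<omega>, noise_path B \<omega>)) = joint" and "(\<lambda>\<omega>. (\<eta> 0 \<omega>, noise_path B \<omega>)) \<in> M \<rightarrow>\<^sub>M joint"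
proof -
  interpret prob_space M using dyn by (simp add: gl_dynamics_def)
  have iv: "\<eta> 0 \<in> M \<rightarrow>\<^sub>M config_space" "noise_path B \<in> M \<rightarrow>\<^sub>M noise_space"
    using dyn by (auto intro!: initial_measurable noise_path_measurable simp: gl_dynamics_def)
  show "(\<lambda>\<omega>. (\<eta> 0 \<omega>, noise_path B \<omega>)) \<in> M \<rightarrow>\<^sub>M joint"
    unfolding measurable_cong_sets[OF refl sets_joint] by (rule measurable_Pair[OF iv(1,2)])
  have "distr M joint (\<lambda>\<omega>. (\<eta> 0 \<omega>, noise_path B \<omega>)) = distr M (config_space \<Otimes>\<^sub>M noise_space) (\<lambda>\<omega>. (\<eta> 0 \<omega>, noise_path B \<omega>))"
    by (rule distr_cong) (auto simp: sets_joint)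
  then show "distr M joint (\<lambda>\<omega>. (\<eta> 0 \<omega>, noise_path B \<omega>)) = joint"
    using gl_dynamics_independent[OF dyn] by (simp add: law start joint_def)
qed

lemma covar_eq_joint:
  assumes dyn: "gl_dynamics V r M B \<eta>" and law: "distr M noise_space (noise_path B) = noise"
    and start: "distr M config_space (\<eta> 0) = config" and r: "0 < r" and t: "0 \<le> t"
  shows "covar M (\<lambda>\<omega>. \<eta> 0 \<omega> 0) (\<lambda>\<omega>. \<eta> t \<omega> i)
    = (LINT z|joint. (fst z 0 - (LINT x|site_measure V l. x)) * gl_flow (fst z) (snd z) t i)"
proof -
  interpret prob_space M using dyn by (simp add: gl_dynamics_def)
  let ?J = "\<lambda>\<omega>. (\<eta> 0 \<omega>, noise_path B \<omega>)" and ?\<Phi> = "\<lambda>z. gl_flow (fst z) (snd z) t i"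
  define m where "m = (LINT x|site_measure V l. x)"
  note J = dynamics_joint_law[OF dyn law start]
  have tr: "integrable M (\<lambda>\<omega>. f (?J \<omega>))" "(LINT \<omega>|M. f (?J \<omega>)) = (LINT z|joint. f z)" if f: "integrable joint f" for f :: "_ \<Rightarrow> real"
  proof -
    have fm: "f \<in> borel_measurable joint" using f by simp
    show "integrable M (\<lambda>\<omega>. f (?J \<omega>))" using integrable_distr_eq[OF J(2) fm] f by (simp add: J(1))
    show "(LINT \<omega>|M. f (?J \<omega>)) = (LINT z|joint. f z)" using integral_distr[OF J(2) fm] by (simp add: J(1))
  qed
  have i\<Phi>: "integrable joint ?\<Phi>" by (rule integrable_gl_flow[OF t])
  have ip: "integrable joint (\<lambda>z. (fst z 0 - m) * ?\<Phi> z)" by (rule integrable_weighted_gl_flow[OF t])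
  have i0: "integrable joint (\<lambda>z. fst z 0)"
  proof -
    have "(\<integral>\<^sup>+z. ennreal \<bar>fst z 0\<bar> \<partial>joint) = (\<integral>\<^sup>+x. ennreal \<bar>x\<bar> \<partial>site_measure V l)"
      by (rule nn_integral_joint_fst) simp
    then show ?thesis using site_abs_finite by (simp add: integrable_iff_bounded)
  qed
  have mean: "(LINT \<omega>|M. \<eta> 0 \<omega> 0) = m"
  proof -
    have "(LINT z|joint. fst z 0) = m"
      using integral_resample[OF i0] by (simp add: resample_def m_def joint.prob_space)
    then show ?thesis using tr(2)[OF i0] by simp
  qed
  define g where "g = (LINT \<omega>|M. \<eta> t \<omega> i)"
  have eq: "AE \<omega> in M. \<eta> t \<omega> i = ?\<Phi> (?J \<omega>)"
    using gl_dynamics_eq_flow[OF dyn law r t] by eventually_elim (use t in auto)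
  have m0: "(\<lambda>\<omega>. \<eta> 0 \<omega> 0) \<in> borel_measurable M" "(\<lambda>\<omega>. \<eta> t \<omega> i) \<in> borel_measurable M"
    using dyn t by (auto simp: gl_dynamics_def)
  have "covar M (\<lambda>\<omega>. \<eta> 0 \<omega> 0) (\<lambda>\<omega>. \<eta> t \<omega> i) = (LINT \<omega>|M. (\<eta> 0 \<omega> 0 - m) * (\<eta> t \<omega> i - g))"
    by (simp add: covar_def mean g_def)
  \<comment> \<open>Centring one factor is enough: the mean \<open>g\<close> of the other multiplies
    a centred variable, and its contribution vanishes.\<close>
  also have "\<dots> = (LINT \<omega>|M. (fst (?J \<omega>) 0 - m) * ?\<Phi> (?J \<omega>) - g * (fst (?J \<omega>) 0 - m))"
  proof (rule integral_cong_AE)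
    show "AE \<omega> in M. (\<eta> 0 \<omega> 0 - m) * (\<eta> t \<omega> i - g) = (fst (?J \<omega>) 0 - m) * ?\<Phi> (?J \<omega>) - g * (fst (?J \<omega>) 0 - m)"
      using eq by eventually_elim (simp add: algebra_simps)
    show "(\<lambda>\<omega>. (fst (?J \<omega>) 0 - m) * ?\<Phi> (?J \<omega>) - g * (fst (?J \<omega>) 0 - m)) \<in> borel_measurable M"
      by (intro borel_measurable_integrable Bochner_Integration.integrable_diff integrable_mult_right tr(1)[OF ip] tr(1)[OF i0] integrable_const)
  qed (use m0 in simp)
  also have "\<dots> = (LINT \<omega>|M. (fst (?J \<omega>) 0 - m) * ?\<Phi> (?J \<omega>)) - (LINT \<omega>|M. g * (fst (?J \<omega>) 0 - m))"
    by (intro Bochner_Integration.integral_diff integrable_mult_right Bochner_Integration.integrable_diff tr(1)[OF ip] tr(1)[OF i0] integrable_const)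
  also have "(LINT \<omega>|M. g * (fst (?J \<omega>) 0 - m)) = 0"
    using tr(1)[OF i0] mean by (simp add: prob_space)
  also have "(LINT \<omega>|M. (fst (?J \<omega>) 0 - m) * ?\<Phi> (?J \<omega>)) = (LINT z|joint. (fst z 0 - m) * ?\<Phi> z)"
    by (rule tr(2)[OF ip])
  finally show ?thesis by (simp add: m_def)
qed

text \<open>Here \<open>\<zeta>\<close> is fixed and only the noise is averaged. Once the
  environment is replaced by the canonical flow started at \<open>\<zeta>\<close>, the iterate sees
  the space \<open>P\<close> only through the law of its noise.\<close>

lemma walk_probability_error:
  assumes proc: "joint_process_from V r \<zeta> 0 P W \<xi> X" and law: "distr P noise_space (noise_path W) = noise"
    and r: "0 < r" and t: "0 \<le> t"
  shows "\<bar>(LINT \<omega>|P. indicator {i} (X t \<omega>))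
      - (LINT b|noise. pic (bond_drift (stiffness (gl_flow \<zeta> b))) (unit_at 0) n t i)\<bar> \<le> (4 * Cp * t) ^ n / fact n"
proof -
  have dyn: "gl_dynamics V r P W \<xi>" and walk: "bond_walk V P \<xi> X" and \<xi>0: "AE \<omega> in P. \<xi> 0 \<omega> = \<zeta>" and X0: "AE \<omega> in P. X 0 \<omega> = 0"
    using proc by (auto simp: joint_process_from_def)
  have prob: "prob_space P" and bb: "bond_brownian_motions P W" using dyn by (simp_all add: gl_dynamics_def)
  note nm = noise_path_measurable[OF bb]
  let ?h = "\<lambda>b. pic (bond_drift (stiffness (gl_flow \<zeta> b))) (unit_at 0) n t i"
  have "\<zeta> \<in> space config" by (simp add: sets_eq_imp_space_eq[OF sets_config] space_PiM)
  then have "(\<lambda>b. (\<zeta>, b)) \<in> noise \<rightarrow>\<^sub>M joint" unfolding joint_def by (rule measurable_Pair1')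
  from measurable_compose[OF this joint_section[OF pic_bond_joint[of 0 n i], of t]]
  have hm: "?h \<in> borel_measurable noise_space" by (simp cong: measurable_cong_sets)
  have eq: "AE \<omega> in P. pic (bond_drift (stiffness (\<lambda>s. \<xi> (max 0 s) \<omega>))) (unit_at 0) n t i = ?h (noise_path W \<omega>)"
    using gl_dynamics_eq_flow[OF dyn law r t] \<xi>0
  proof eventually_elim
    case (elim \<omega>)
    show ?case
    proof (rule pic_cong[where T = t])
      fix s assume s: "0 \<le> s" "s \<le> t"
      then have "\<xi> s \<omega> j = gl_flow \<zeta> (noise_path W \<omega>) s j" for j using elim by simp
      then have "stiffness (\<lambda>s. \<xi> (max 0 s) \<omega>) s = stiffness (gl_flow \<zeta> (noise_path W \<omega>)) s"
        using s by (simp add: stiffness_def fun_eq_iff)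
      then show "bond_drift (stiffness (\<lambda>s. \<xi> (max 0 s) \<omega>)) s = bond_drift (stiffness (gl_flow \<zeta> (noise_path W \<omega>))) s"
        by (simp add: bond_drift_def fun_eq_iff)
    qed (use t in auto)
  qed
  have hP: "(\<lambda>\<omega>. ?h (noise_path W \<omega>)) \<in> borel_measurable P" by (rule measurable_compose[OF nm hm])
  have "(LINT \<omega>|P. pic (bond_drift (stiffness (\<lambda>s. \<xi> (max 0 s) \<omega>))) (unit_at 0) n t i) = (LINT \<omega>|P. ?h (noise_path W \<omega>))"
  proof (rule Bochner_Integration.integral_cong_AE[OF _ hP eq])
    show "(\<lambda>\<omega>. pic (bond_drift (stiffness (\<lambda>s. \<xi> (max 0 s) \<omega>))) (unit_at 0) n t i) \<in> borel_measurable P"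
    proof -
      have "(\<lambda>(\<omega>, s). pic (bond_drift (stiffness (\<lambda>s. \<xi> (max 0 s) \<omega>))) (unit_at 0) n s i) \<in> borel_measurable (P \<Otimes>\<^sub>M borel)"
        by (rule walk_pic_measurable) (use dyn in \<open>auto simp: gl_dynamics_def\<close>)
      from measurable_compose[OF measurable_Pair2'[of t] this] show ?thesis by simp
    qed
  qed
  also have "\<dots> = (LINT b|distr P noise_space (noise_path W). ?h b)" by (rule integral_distr[OF nm hm, symmetric])
  finally have E: "(LINT \<omega>|P. pic (bond_drift (stiffness (\<lambda>s. \<xi> (max 0 s) \<omega>))) (unit_at 0) n t i) = (LINT b|noise. ?h b)"
    by (simp only: law)
  show ?thesis
    unfolding E[symmetric]
    by (rule bond_walk_forward[OF prob walk _ _ X0 t]) (use dyn in \<open>auto simp: gl_dynamics_def\<close>)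
qed

text \<open>\<open>g\<close> is an arbitrary function obeying the error bound; its measurability on
  \<open>S\<close> is a consequence, since it is there a pointwise limit of the averages
  \<open>h n\<close>. Comparing the walk and the derivative with the bond iterate of the same order,
  and letting the order grow, identifies the two means.\<close>

lemma walk_average_eq_derivative:
  fixes g :: "(int \<Rightarrow> real) \<Rightarrow> real"
  assumes err: "\<And>\<zeta> n. \<zeta> \<in> S \<Longrightarrow> \<bar>g \<zeta> - (LINT b|noise. pic (bond_drift (stiffness (gl_flow \<zeta> b))) (unit_at 0) n t i)\<bar>
      \<le> (4 * Cp * t) ^ n / fact n"
    and S: "S \<in> sets config" "AE \<zeta> in config. \<zeta> \<in> S" and t: "0 \<le> t"
  shows "(LINT \<zeta>:S|config. g \<zeta>) = (LINT z|joint. gl_derivative (fst z) (snd z) t i)"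
proof -
  define h where "h n \<zeta> = (LINT b|noise. pic (bond_drift (stiffness (gl_flow \<zeta> b))) (unit_at 0) n t i)" for n \<zeta>
  have jb: "(\<lambda>z. pic (bond_drift (stiffness (gl_flow (fst z) (snd z)))) (unit_at 0) n t i) \<in> borel_measurable (config \<Otimes>\<^sub>M noise)" for n
    using joint_section[OF pic_bond_joint[of 0 n i], of t] by (simp add: joint_def)
  have ib: "integrable (config \<Otimes>\<^sub>M noise) (\<lambda>z. pic (bond_drift (stiffness (gl_flow (fst z) (snd z)))) (unit_at 0) n t i)" for n
    using integrable_pic_bond[OF t] by (simp add: joint_def)
  have ih: "integrable config (h n)" for n
    using config_noise.integrable_fst'[OF ib[of n]] by (simp add: h_def[abs_def])
  have Eh: "(LINT \<zeta>|config. h n \<zeta>) = (LINT z|joint. pic (bond_drift (stiffness (gl_flow (fst z) (snd z)))) (unit_at 0) n t i)" for n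
    using config_noise.integral_fst'[OF ib[of n]] by (simp add: h_def joint_def)
  note e0 = power_fact_tendsto_0[of "4 * Cp * t"]
  have hm: "h n \<in> borel_measurable config" for n using ih[of n] by simp
  have gm: "(\<lambda>\<zeta>. indicator S \<zeta> * g \<zeta>) \<in> borel_measurable config"
  proof (rule borel_measurable_LIMSEQ_real)
    show "(\<lambda>\<zeta>. indicator S \<zeta> * h n \<zeta>) \<in> borel_measurable config" for n
      using hm[of n] S(1) by (intro borel_measurable_times borel_measurable_indicator)
    fix \<zeta>
    show "(\<lambda>n. indicator S \<zeta> * h n \<zeta>) \<longlonglongrightarrow> indicator S \<zeta> * g \<zeta>"
    proof (cases "\<zeta> \<in> S")
      case True
      have "(\<lambda>n. h n \<zeta> - g \<zeta>) \<longlonglongrightarrow> 0"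
      proof (rule Lim_null_comparison[OF always_eventually[OF allI] e0])
        show "norm (h n \<zeta> - g \<zeta>) \<le> (4 * Cp * t) ^ n / fact n" for n
          using err[OF True, of n] unfolding h_def real_norm_def by (subst abs_minus_commute)
      qed
      then show ?thesis using True by (simp add: LIM_zero_iff)
    qed simp
  qed
  have ig: "integrable config (\<lambda>\<zeta>. indicator S \<zeta> * g \<zeta>)"
  proof (rule config.integrable_const_bound[OF _ gm])
    show "AE \<zeta> in config. norm (indicator S \<zeta> * g \<zeta>) \<le> 1"
    proof (rule AE_I2)
      fix \<zeta> show "norm (indicator S \<zeta> * g \<zeta>) \<le> 1"
        \<comment> \<open>At order 0 the iterate is 0 and the error bound is 1, so \<open>g\<close>
          is bounded by 1 on \<open>S\<close>.\<close>
        using err[of \<zeta> 0] by (cases "\<zeta> \<in> S") auto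
    qed
  qed
  have bound: "\<bar>(LINT \<zeta>:S|config. g \<zeta>) - (LINT \<zeta>|config. h n \<zeta>)\<bar> \<le> (4 * Cp * t) ^ n / fact n" for n
  proof -
    have "(LINT \<zeta>:S|config. g \<zeta>) - (LINT \<zeta>|config. h n \<zeta>) = (LINT \<zeta>|config. indicator S \<zeta> * g \<zeta> - h n \<zeta>)"
      using ig ih[of n] by (simp add: set_lebesgue_integral_def)
    also have "\<bar>\<dots>\<bar> \<le> (LINT \<zeta>|config. \<bar>indicator S \<zeta> * g \<zeta> - h n \<zeta>\<bar>)" by (rule integral_abs_bound)
    also have "\<dots> \<le> (LINT \<zeta>|config. (4 * Cp * t) ^ n / fact n)"
    proof (rule integral_mono_AE)
      show "AE \<zeta> in config. \<bar>indicator S \<zeta> * g \<zeta> - h n \<zeta>\<bar> \<le> (4 * Cp * t) ^ n / fact n"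
        using S(2)
      proof eventually_elim
        case (elim \<zeta>)
        then show ?case using err[OF elim, of n] by (simp add: h_def)
      qed
    qed (use ig ih[of n] in auto)
    also have "\<dots> = (4 * Cp * t) ^ n / fact n" by (simp add: config.prob_space)
    finally show ?thesis .
  qed
  let ?A = "LINT \<zeta>:S|config. g \<zeta>" and ?D = "LINT z|joint. gl_derivative (fst z) (snd z) t i"
  have "\<bar>?A - ?D\<bar> \<le> (1 + exp (4 * Cp * t)) * ((4 * Cp * t) ^ n / fact n)" for n
    using bound[of n] expectation_derivative_bond[OF t, of i n] unfolding Eh distrib_right by linarith
  moreover have "(\<lambda>n. (1 + exp (4 * Cp * t)) * ((4 * Cp * t) ^ n / fact n)) \<longlonglongrightarrow> 0"
    by (rule tendsto_mult_right_zero[OF e0])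
  ultimately have "\<bar>?A - ?D\<bar> \<le> 0" by (intro LIMSEQ_le_const) auto
  then show ?thesis by simp
qed

end

theorem proposition4p3:
  fixes V :: "real \<Rightarrow> real" and C\<^sub>m C\<^sub>p \<rho> r t :: real and i :: int
    and M :: "'w measure" and B :: "int \<Rightarrow> real \<Rightarrow> 'w \<Rightarrow> real"
    and \<eta> :: "real \<Rightarrow> 'w \<Rightarrow> int \<Rightarrow> real"
    and P :: "(int \<Rightarrow> real) \<Rightarrow> 'v measure"
    and W :: "(int \<Rightarrow> real) \<Rightarrow> int \<Rightarrow> real \<Rightarrow> 'v \<Rightarrow> real"
    and \<xi> :: "(int \<Rightarrow> real) \<Rightarrow> real \<Rightarrow> 'v \<Rightarrow> int \<Rightarrow> real"
    and X :: "(int \<Rightarrow> real) \<Rightarrow> real \<Rightarrow> 'v \<Rightarrow> int"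
  assumes V_diff: "\<And>x. V differentiable (at x)"
    and V'_diff: "\<And>x. deriv V differentiable (at x)"
    and C\<^sub>m_pos: "0 < C\<^sub>m"
    and V''_lower: "\<And>x. C\<^sub>m \<le> deriv (deriv V) x"
    and V''_upper: "\<And>x. deriv (deriv V) x \<le> C\<^sub>p"
    and r_pos: "0 < r"
    and stationary_dynamics: "gl_dynamics V r M B \<eta>"
    and stationary_start: "distr M (\<Pi>\<^sub>M j\<in>UNIV. borel) (\<eta> 0) = inv_measure V \<rho>"
    and walk: "\<And>\<zeta>. \<zeta> \<in> weighted_space r \<Longrightarrow>
                 joint_process_from V r \<zeta> 0 (P \<zeta>) (W \<zeta>) (\<xi> \<zeta>) (X \<zeta>)"
    and t_nonneg: "0 \<le> t"
  shows
    "1 / C\<^sub>p * (LINT \<zeta>:weighted_space r|inv_measure V \<rho>.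
                  (LINT \<omega>|P \<zeta>. indicator {i} (X \<zeta> t \<omega>)))
       \<le> covar M (\<lambda>\<omega>. \<eta> 0 \<omega> 0) (\<lambda>\<omega>. \<eta> t \<omega> i)
     \<and> covar M (\<lambda>\<omega>. \<eta> 0 \<omega> 0) (\<lambda>\<omega>. \<eta> t \<omega> i)
       \<le> 1 / C\<^sub>m * (LINT \<zeta>:weighted_space r|inv_measure V \<rho>.
                  (LINT \<omega>|P \<zeta>. indicator {i} (X \<zeta> t \<omega>)))"
proof -
  have prob: "prob_space M" and bb: "bond_brownian_motions M B"
    using stationary_dynamics by (simp_all add: gl_dynamics_def)
  have bm: "brownian_motion M (B 0)" using bb by (simp add: bond_brownian_motions_def)
  \<comment> \<open>The path law of one bond of the stationary noise serves as reference; uniqueness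
    of the Brownian law identifies it with the noise of each walk process as well.\<close>
  define \<beta> where "\<beta> = distr M path_space (bm_path (B 0))"
  interpret gl_product V C\<^sub>m C\<^sub>p "chem_pot V \<rho>" \<beta>
  proof (intro gl_product.intro convex_potential.intro gl_product_axioms.intro)
    show "prob_space \<beta>" unfolding \<beta>_def by (rule prob_space.prob_space_distr[OF prob bm_path_measurable[OF bm]])
    show "(\<integral>\<^sup>+b. path_sup N b \<partial>\<beta>) < \<infinity>" for N
      unfolding \<beta>_def by (rule brownian_path_sup_finite[OF prob bm])
    have "{b \<in> space path_space. b 0 = 0} \<in> sets path_space"
    proof -
      have "(\<lambda>b. b 0) \<in> borel_measurable path_space" by (rule measurable_component_singleton) simp
      then show ?thesis by (rule borel_measurable_eq) simp
    qed
    then show "AE b in \<beta>. b 0 = 0"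
      unfolding \<beta>_def using bm
      by (subst AE_distr_iff[OF bm_path_measurable[OF bm]]) (auto simp: brownian_motion_def)
  qed (use V_diff V'_diff C\<^sub>m_pos V''_lower V''_upper in \<open>auto simp: \<beta>_def\<close>)
  have config: "inv_measure V \<rho> = config" by (simp add: inv_measure_def config_def)
  have law: "distr M noise_space (noise_path B) = noise"
    unfolding noise_def unfolding \<beta>_def by (rule bond_brownian_law[OF prob bb prob bm])
  have start: "distr M config_space (\<eta> 0) = config" using stationary_start by (simp add: config)
  have S: "weighted_space r \<in> sets config" by (simp add: sets_config weighted_space_measurable)
  \<comment> \<open>The dynamics lies in the weighted space already at time 0, where its law is the
    invariant measure; so restricting the average to the weighted space loses no mass.\<close>
  have AE_S: "AE \<zeta> in config. \<zeta> \<in> weighted_space r"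
  proof -
    have m0: "\<eta> 0 \<in> M \<rightarrow>\<^sub>M config_space"
      by (rule initial_measurable) (use stationary_dynamics in \<open>simp add: gl_dynamics_def\<close>)
    have "AE \<omega> in M. \<eta> 0 \<omega> \<in> weighted_space r"
      using stationary_dynamics unfolding gl_dynamics_def by (auto elim: eventually_mono)
    moreover have "{\<zeta> \<in> space config_space. \<zeta> \<in> weighted_space r} \<in> sets config_space"
      using weighted_space_measurable[of r] by (simp add: space_PiM)
    ultimately have "AE \<zeta> in distr M config_space (\<eta> 0). \<zeta> \<in> weighted_space r"
      by (subst AE_distr_iff[OF m0])
    then show ?thesis by (simp only: start)
  qed
  have avg: "(LINT \<zeta>:weighted_space r|inv_measure V \<rho>. (LINT \<omega>|P \<zeta>. indicator {i} (X \<zeta> t \<omega>)))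
      = (LINT z|joint. gl_derivative (fst z) (snd z) t i)"
    unfolding config
  proof (rule walk_average_eq_derivative[OF _ S AE_S t_nonneg])
    fix \<zeta> n assume \<zeta>: "\<zeta> \<in> weighted_space r"
    have dyn: "gl_dynamics V r (P \<zeta>) (W \<zeta>) (\<xi> \<zeta>)" using walk[OF \<zeta>] by (simp add: joint_process_from_def)
    have "distr (P \<zeta>) noise_space (noise_path (W \<zeta>)) = noise"
      unfolding noise_def unfolding \<beta>_def by (rule bond_brownian_law[OF _ _ prob bm]) (use dyn in \<open>simp_all add: gl_dynamics_def\<close>)
    from walk_probability_error[OF walk[OF \<zeta>] this r_pos t_nonneg]
    show "\<bar>(LINT \<omega>|P \<zeta>. indicator {i} (X \<zeta> t \<omega>))
        - (LINT b|noise. pic (bond_drift (stiffness (gl_flow \<zeta> b))) (unit_at 0) n t i)\<bar> \<le> (4 * C\<^sub>p * t) ^ n / fact n" .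
  qed
  have cov: "covar M (\<lambda>\<omega>. \<eta> 0 \<omega> 0) (\<lambda>\<omega>. \<eta> t \<omega> i)
      = (LINT z|joint. (fst z 0 - (LINT x|site_measure V (chem_pot V \<rho>). x)) * gl_flow (fst z) (snd z) t i)"
    by (rule covar_eq_joint[OF stationary_dynamics law start r_pos t_nonneg])
  show ?thesis
    unfolding avg cov using joint_covariance_bounds[OF t_nonneg, of i] by simp
qed

end
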